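(* Let $K$ be a finite extension of $\mathbb{Q}_p$ with $p$ odd, let $f\in K[x]$ be squarefree with set of roots $\mathcal{R}\subset\overline{K}$, and let $I$ be the inertia subgroup of $\operatorname{Gal}(K(\mathcal{R})/K)$. Assume $I$ is tame (i.e. $p\nmid |I|$). Then: (i) $\operatorname{lcm}_{\mathfrak{s}} \operatorname{denom} d_{\mathfrak{s}} = |I|$, where the $\operatorname{lcm}$ runs over all proper clusters $\mathfrak{s}$. (ii) Fix a cluster $\mathfrak{s}$. Then the orbits under $I_{\mathfrak{s}}$ of the children of $\mathfrak{s}$ which are not orphans of $\mathfrak{s}$ all have equal length. (iii) Let $\mathfrak{s}'$ be a child of the proper cluster $\mathfrak{s}$ which is not an orphan of $\mathfrak{s}$. Then the length of the orbit of $\mathfrak{s}'$ under $I_{\mathfrak{s}}$ is $\operatorname{denom}(d_{\mathfrak{s}}[I:I_{\mathfrak{s}}])$. (iv) Let $\mathfrak{s}$ be a cluster. Then $[I:I_{\mathfrak{s}}]=\operatorname{lcm}_{\mathfrak{s}\subsetneq\mathfrak{s}'}\operatorname{denom} d^*_{\mathfrak{s}'}$, the $\operatorname{lcm}$ running over all clusters $\mathfrak{s}'$ properly containing $\mathfrak{s}$, where $d^*_{\mathfrak{s}'}=1$ if the child of $\mathfrak{s}'$ containing $\mathfrak{s}$ is an orphan of $\mathfrak{s}'$, and $d^*_{\mathfrak{s}'}=d_{\mathfrak{s}'}$ otherwise.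
   Context: $v$ is the valuation on $\overline{K}$ normalised so that $v(K^\times)=\mathbb{Z}$. For $\alpha=a/b\in\mathbb{Q}$ with $\gcd(a,b)=1$, $b>0$, $\operatorname{denom}\alpha=b$. A cluster is a nonempty subset $\mathfrak{s}\subseteq\mathcal{R}$ of the form $D\cap\mathcal{R}$ for a disc $D=\{x\in\overline{K}: v(x-z)\ge d\}$ with $z\in\overline{K}$, $d\in\mathbb{Q}$. A cluster is proper if $|\mathfrak{s}|>1$, and then its depth is $d_{\mathfrak{s}}=\min_{r,r'\in\mathfrak{s}}v(r-r')$. A child of $\mathfrak{s}$ is a maximal cluster properly contained in $\mathfrak{s}$. $I_{\mathfrak{s}}$ denotes the stabiliser of $\mathfrak{s}$ in $I$ (which acts on $\mathcal{R}$ and hence on clusters). If among the children of $\mathfrak{s}$ there is exactly one fixed by $I_{\mathfrak{s}}$, it is called an orphan of $\mathfrak{s}$. An empty $\operatorname{lcm}$ is $1$. *)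

theory Defs
  imports
    "HOL-Algebra.Algebraic_Closure_Type"
    "HOL-Algebra.Generated_Fields"
    "HOL-Algebra.Group_Action"
    "HOL-Algebra.Bij"
    "HOL-Computational_Algebra.Squarefree"
begin

definition denom :: "rat \<Rightarrow> nat" where
  "denom a = nat (snd (quotient_of a))"

section \<open>Valuations and finite extensions of the p-adic numbers\<close>

text \<open>
  Valuations are written additively with values in the rationals. The value at \<open>0\<close> is
  mathematically \<open>\<infinity>\<close>; here \<open>v 0\<close> is an arbitrary number that is never used, and
  \<open>val_ge v x d\<close> and \<open>val_gt v x d\<close> express \<open>v x \<ge> d\<close> and \<open>v x > d\<close> under the convention \<open>v 0 = \<infinity>\<close>.
\<close>

definition valuation :: "('a::field \<Rightarrow> rat) \<Rightarrow> bool" where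
  "valuation v \<longleftrightarrow>
     (\<forall>x y. x \<noteq> 0 \<longrightarrow> y \<noteq> 0 \<longrightarrow> v (x * y) = v x + v y) \<and>
     (\<forall>x y. x \<noteq> 0 \<longrightarrow> y \<noteq> 0 \<longrightarrow> x + y \<noteq> 0 \<longrightarrow> v (x + y) \<ge> min (v x) (v y))"

definition val_ge :: "('a::field \<Rightarrow> rat) \<Rightarrow> 'a \<Rightarrow> rat \<Rightarrow> bool" where
  "val_ge v x d \<longleftrightarrow> x = 0 \<or> v x \<ge> d"

definition val_gt :: "('a::field \<Rightarrow> rat) \<Rightarrow> 'a \<Rightarrow> rat \<Rightarrow> bool" where
  "val_gt v x d \<longleftrightarrow> x = 0 \<or> v x > d"

definition padic_val_rat :: "nat \<Rightarrow> rat \<Rightarrow> int" where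
  "padic_val_rat p q =
     int (multiplicity (int p) (fst (quotient_of q))) - int (multiplicity (int p) (snd (quotient_of q)))"

text \<open>
  The field \<open>'q\<close> with the valuation \<open>w\<close> is \<open>\<rat>\<^sub>p\<close> with its \<open>p\<close>-adic valuation, i.e. the completion of
  the rationals with respect to the \<open>p\<close>-adic valuation: \<open>w\<close> extends the latter, the rationals are
  dense, and every Cauchy sequence converges. This determines \<open>('q, w)\<close> up to unique isomorphism.
\<close>

definition is_Qp :: "nat \<Rightarrow> ('q::field_char_0 \<Rightarrow> rat) \<Rightarrow> bool" where
  "is_Qp p w \<longleftrightarrow>
     valuation w \<and>
     (\<forall>q. q \<noteq> 0 \<longrightarrow> w (of_rat q) = of_int (padic_val_rat p q)) \<and>
     (\<forall>x N. \<exists>q. val_ge w (x - of_rat q) N) \<and>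
     (\<forall>Y :: nat \<Rightarrow> 'q.
        (\<forall>N. \<exists>n0. \<forall>m\<ge>n0. \<forall>n\<ge>n0. val_ge w (Y m - Y n) N) \<longrightarrow>
        (\<exists>x. \<forall>N. \<exists>n0. \<forall>n\<ge>n0. val_ge w (Y n - x) N))"

definition finite_field_extension :: "('q::field \<Rightarrow> 'k::field) \<Rightarrow> bool" where
  "finite_field_extension \<iota> \<longleftrightarrow>
     \<iota> \<in> ring_hom ring_of_type_algebra ring_of_type_algebra \<and>
     (\<exists>B. finite B \<and> (\<forall>x. \<exists>c. x = (\<Sum>b\<in>B. \<iota> (c b) * b)))"

text \<open>
  The valuation on the algebraic closure of \<open>'k\<close> that extends, up to scaling, the valuation \<open>w\<close>
  of the base field, normalised to have value group \<open>\<int>\<close> on \<open>'k\<close>.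
\<close>

definition normalised_valuation ::
    "('q::field \<Rightarrow> rat) \<Rightarrow> ('q \<Rightarrow> 'k::field) \<Rightarrow> ('k alg_closure \<Rightarrow> rat) \<Rightarrow> bool" where
  "normalised_valuation w \<iota> v \<longleftrightarrow>
     valuation v \<and>
     (\<exists>c>0. \<forall>x. x \<noteq> 0 \<longrightarrow> v (to_ac (\<iota> x)) = c * w x) \<and>
     (\<lambda>x. v (to_ac x)) ` (UNIV - {0}) = \<int>"

section \<open>Galois and inertia groups\<close>

definition ac_roots :: "'k::field poly \<Rightarrow> 'k alg_closure set" where
  "ac_roots f = {x. poly (map_poly to_ac f) x = 0}"

definition root_field :: "'k::field poly \<Rightarrow> 'k alg_closure set" where
  "root_field f = generate_field ring_of_type_algebra (range to_ac \<union> ac_roots f)"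

definition galois_group :: "'a::field set \<Rightarrow> 'a set \<Rightarrow> ('a \<Rightarrow> 'a) monoid" where
  "galois_group K L = BijGroup L \<lparr>carrier :=
     {\<sigma> \<in> Bij L. (\<forall>x\<in>L. \<forall>y\<in>L. \<sigma> (x + y) = \<sigma> x + \<sigma> y \<and> \<sigma> (x * y) = \<sigma> x * \<sigma> y) \<and>
                (\<forall>x\<in>K. \<sigma> x = x)}\<rparr>"

definition inertia_group :: "('a::field \<Rightarrow> rat) \<Rightarrow> 'a set \<Rightarrow> 'a set \<Rightarrow> ('a \<Rightarrow> 'a) monoid" where
  "inertia_group v K L = galois_group K L \<lparr>carrier :=
     {\<sigma> \<in> carrier (galois_group K L). \<forall>x\<in>L. val_ge v x 0 \<longrightarrow> val_gt v (\<sigma> x - x) 0}\<rparr>"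

section \<open>Clusters\<close>

definition disc :: "('a::field \<Rightarrow> rat) \<Rightarrow> 'a \<Rightarrow> rat \<Rightarrow> 'a set" where
  "disc v z d = {x. val_ge v (x - z) d}"

definition cluster :: "('a::field \<Rightarrow> rat) \<Rightarrow> 'a set \<Rightarrow> 'a set \<Rightarrow> bool" where
  "cluster v R s \<longleftrightarrow> s \<noteq> {} \<and> (\<exists>z d. s = disc v z d \<inter> R)"

definition proper_cluster :: "('a::field \<Rightarrow> rat) \<Rightarrow> 'a set \<Rightarrow> 'a set \<Rightarrow> bool" where
  "proper_cluster v R s \<longleftrightarrow> cluster v R s \<and> card s > 1"

text \<open>Pairs with \<open>r = r'\<close> have \<open>v (r - r') = \<infinity>\<close> and do not affect the minimum for proper clusters.\<close>

definition depth :: "('a::field \<Rightarrow> rat) \<Rightarrow> 'a set \<Rightarrow> rat" where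
  "depth v s = Min {v (r - r') | r r'. r \<in> s \<and> r' \<in> s \<and> r \<noteq> r'}"

definition child :: "('a::field \<Rightarrow> rat) \<Rightarrow> 'a set \<Rightarrow> 'a set \<Rightarrow> 'a set \<Rightarrow> bool" where
  "child v R s c \<longleftrightarrow> cluster v R c \<and> c \<subset> s \<and> \<not> (\<exists>t. cluster v R t \<and> c \<subset> t \<and> t \<subset> s)"

definition cluster_stab :: "('a \<Rightarrow> 'a) monoid \<Rightarrow> 'a set \<Rightarrow> ('a \<Rightarrow> 'a) monoid" where
  "cluster_stab G s = G \<lparr>carrier := stabilizer G image s\<rparr>"

definition stab_index :: "('a \<Rightarrow> 'a) monoid \<Rightarrow> 'a set \<Rightarrow> nat" where
  "stab_index G s = card (rcosets\<^bsub>G\<^esub> (carrier (cluster_stab G s)))"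

definition orphan ::
    "('a::field \<Rightarrow> rat) \<Rightarrow> 'a set \<Rightarrow> ('a \<Rightarrow> 'a) monoid \<Rightarrow> 'a set \<Rightarrow> 'a set \<Rightarrow> bool" where
  "orphan v R G s c \<longleftrightarrow>
     {c'. child v R s c' \<and> (\<forall>\<sigma>\<in>carrier (cluster_stab G s). \<sigma> ` c' = c')} = {c}"

text \<open>
  \<open>depth_star v R G s s'\<close> is \<open>d\<^sup>*\<close> of \<open>s'\<close> relative to \<open>s \<subset> s'\<close>; exactly one child of \<open>s'\<close> contains \<open>s\<close>.
\<close>

definition depth_star ::
    "('a::field \<Rightarrow> rat) \<Rightarrow> 'a set \<Rightarrow> ('a \<Rightarrow> 'a) monoid \<Rightarrow> 'a set \<Rightarrow> 'a set \<Rightarrow> rat" where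
  "depth_star v R G s s' =
     (if \<exists>c. child v R s' c \<and> s \<subseteq> c \<and> orphan v R G s' c then 1 else depth v s')"

end

theory Submission
  imports Defs
begin

text \<open>
  Let \<open>L = K(\<R>)\<close>. For \<open>\<sigma> \<in> I\<close> and \<open>x \<in> L\<^sup>\<times>\<close> the residue class of \<open>\<sigma> x / x\<close> depends only on \<open>\<sigma>\<close> and
  \<open>v x\<close>, so that each value \<open>d\<close> of \<open>L\<close> gives a character \<open>\<theta>(d)\<close> of \<open>I\<close>, and these characters add up
  with \<open>d\<close>. Since \<open>|I|\<close> is a unit, averaging shows that a subgroup \<open>H\<close> of \<open>I\<close> has a fixed element of
  value \<open>d\<close> as soon as \<open>\<theta>(d)\<close> is trivial on \<open>H\<close>, and that \<open>\<sigma> x - x\<close> never has a value on which \<open>\<sigma>\<close> acts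
  trivially. As the field fixed by \<open>I\<close> is unramified over \<open>K\<close>, taking norms and counting roots of
  unity in the residue field gives that \<open>\<theta>(d)\<close> takes exactly \<open>denom ([I : H] d)\<close> values on \<open>H\<close>.

  The stabiliser \<open>H\<close> of a cluster \<open>s\<close> of depth \<open>d\<close> fixes a centre \<open>z\<close> of \<open>s\<close>, the average of an orbit.
  The child containing the roots close to \<open>z\<close>, if any, is fixed, and an element of \<open>H\<close> fixes any other
  child iff \<open>\<theta>(d)\<close> is trivial on it. This gives the orbit lengths, and the formula for the index of
  the stabiliser follows by induction along the chain of clusters containing \<open>s\<close>.
\<close>

subsection \<open>Subfields and their endomorphisms\<close>

text \<open>No residue field is formed: residues are integral elements up to differences of positive
  value, so classes and roots of unity are counted through representatives. That Galois elements
  preserve \<open>v\<close> has to come from uniqueness of extensions of valuations; this is where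
  completeness of the base and finiteness of K over it enter. The count of the values of \<theta>(d)
  on H meets a circularity: the bound from above needs \<theta>(b d) to be trivial on H for b =
  denom ([I : H] d), which is deduced from 1/|I| being a value of L. For H = I the triviality is
  immediate, since integers are values of fixed elements. That case, applied to a generator of the
  value group, makes 1/|I| a value, and then every subgroup can be treated. Orphans appear because
  at most one child lies around the fixed centre z, and it is fixed whatever \<theta>(d) does.
  Either \<theta>(d) is nontrivial on the stabiliser, and this child, if it exists, is the only
  fixed one, or all children are fixed and the general rule holds for the central one too.\<close>

locale field_set =
  fixes L :: "'a::field set"
  assumes zero_in: "0 \<in> L" and one_in: "1 \<in> L"
    and add_in: "x \<in> L \<Longrightarrow> y \<in> L \<Longrightarrow> x + y \<in> L"
    and mult_in: "x \<in> L \<Longrightarrow> y \<in> L \<Longrightarrow> x * y \<in> L"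
    and uminus_in: "x \<in> L \<Longrightarrow> - x \<in> L"
    and inverse_in: "x \<in> L \<Longrightarrow> inverse x \<in> L"
begin

lemma diff_in: "x \<in> L \<Longrightarrow> y \<in> L \<Longrightarrow> x - y \<in> L"
  using add_in[of x "- y"] uminus_in by simp

lemma divide_in: "x \<in> L \<Longrightarrow> y \<in> L \<Longrightarrow> x / y \<in> L"
  using mult_in[of x "inverse y"] inverse_in by (simp add: divide_inverse)

lemma power_in: "x \<in> L \<Longrightarrow> x ^ n \<in> L"
  by (induction n) (auto intro: mult_in one_in)

lemma of_nat_in: "of_nat n \<in> L"
  by (induction n) (auto intro: add_in one_in zero_in)

lemma sum_in: "(\<And>i. i \<in> A \<Longrightarrow> f i \<in> L) \<Longrightarrow> sum f A \<in> L"
  by (induction A rule: infinite_finite_induct) (auto intro: add_in zero_in)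

lemma prod_in: "(\<And>i. i \<in> A \<Longrightarrow> f i \<in> L) \<Longrightarrow> prod f A \<in> L"
  by (induction A rule: infinite_finite_induct) (auto intro: mult_in one_in)

lemmas closed = zero_in one_in add_in mult_in uminus_in inverse_in diff_in divide_in power_in
  of_nat_in sum_in prod_in

end

text \<open>Nothing is said about \<sigma> outside \<open>L\<close>, because Galois elements are
  functions on the whole type that are meaningful only on \<open>L\<close>. The clause
  \<open>one\<close> excludes the zero map.\<close>

locale field_endo = field_set L for L :: "'a::field set" +
  fixes \<sigma> :: "'a \<Rightarrow> 'a"
  assumes maps: "x \<in> L \<Longrightarrow> \<sigma> x \<in> L"
    and add: "x \<in> L \<Longrightarrow> y \<in> L \<Longrightarrow> \<sigma> (x + y) = \<sigma> x + \<sigma> y"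
    and mult: "x \<in> L \<Longrightarrow> y \<in> L \<Longrightarrow> \<sigma> (x * y) = \<sigma> x * \<sigma> y"
    and one: "\<sigma> 1 = 1"
begin

lemma zero: "\<sigma> 0 = 0"
  by (metis add add_0 add_cancel_right_right zero_in)

lemma uminus: "x \<in> L \<Longrightarrow> \<sigma> (- x) = - \<sigma> x"
  using add[of x "- x"] zero uminus_in by (simp add: eq_neg_iff_add_eq_0 add.commute)

lemma diff: "x \<in> L \<Longrightarrow> y \<in> L \<Longrightarrow> \<sigma> (x - y) = \<sigma> x - \<sigma> y"
  using add[of x "- y"] uminus uminus_in by simp

lemma nonzero: "x \<in> L \<Longrightarrow> x \<noteq> 0 \<Longrightarrow> \<sigma> x \<noteq> 0"
  using mult[of x "inverse x"] one inverse_in by auto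

lemma inverse: "x \<in> L \<Longrightarrow> \<sigma> (inverse x) = inverse (\<sigma> x)"
  using mult[of x "inverse x"] one inverse_in zero
  by (cases "x = 0") (auto intro: inverse_unique[symmetric])

lemma divide: "x \<in> L \<Longrightarrow> y \<in> L \<Longrightarrow> \<sigma> (x / y) = \<sigma> x / \<sigma> y"
  using mult[of x "inverse y"] inverse inverse_in by (simp add: divide_inverse)

lemma power: "x \<in> L \<Longrightarrow> \<sigma> (x ^ n) = \<sigma> x ^ n"
  by (induction n) (auto simp: one mult power_in)

lemma of_nat: "\<sigma> (of_nat n) = of_nat n"
  by (induction n) (auto simp: zero one add closed)

lemma sum: "(\<And>i. i \<in> A \<Longrightarrow> f i \<in> L) \<Longrightarrow> \<sigma> (sum f A) = (\<Sum>i\<in>A. \<sigma> (f i))"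
  by (induction A rule: infinite_finite_induct) (auto simp: zero add sum_in)

lemma prod: "(\<And>i. i \<in> A \<Longrightarrow> f i \<in> L) \<Longrightarrow> \<sigma> (prod f A) = (\<Prod>i\<in>A. \<sigma> (f i))"
  by (induction A rule: infinite_finite_induct) (auto simp: one mult prod_in)

end

subsection \<open>Valued fields\<close>

locale valued_field =
  fixes v :: "'a::field \<Rightarrow> rat"
  assumes valuation: "valuation v"
begin

abbreviation integral :: "'a \<Rightarrow> bool" where "integral x \<equiv> val_ge v x 0"
abbreviation infinitesimal :: "'a \<Rightarrow> bool" where "infinitesimal x \<equiv> val_gt v x 0"

lemma v_mult: "x \<noteq> 0 \<Longrightarrow> y \<noteq> 0 \<Longrightarrow> v (x * y) = v x + v y"
  using valuation unfolding valuation_def by blast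

lemma v_1 [simp]: "v 1 = 0"
  using v_mult[of 1 1] by simp

lemma v_uminus [simp]: "v (- x) = v x"
proof (cases "x = 0")
  case False
  have "v (-1) + v (-1) = 0" using v_mult[of "-1" "-1"] by simp
  then show ?thesis using v_mult[of "-1" x] False by simp
qed simp

lemma v_inverse: "x \<noteq> 0 \<Longrightarrow> v (inverse x) = - v x"
  using v_mult[of x "inverse x"] by simp

lemma v_divide: "x \<noteq> 0 \<Longrightarrow> y \<noteq> 0 \<Longrightarrow> v (x / y) = v x - v y"
  using v_mult[of x "inverse y"] v_inverse[of y] by (simp add: divide_inverse)

lemma v_power: "x \<noteq> 0 \<Longrightarrow> v (x ^ n) = of_nat n * v x"
  by (induction n) (simp_all add: v_mult algebra_simps)

lemma v_minus_commute: "v (x - y) = v (y - x)"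
  using v_uminus[of "x - y"] by simp

lemma val_ge_add: "val_ge v x d \<Longrightarrow> val_ge v y d \<Longrightarrow> val_ge v (x + y) d"
  using valuation unfolding valuation_def val_ge_def
  by (metis add.left_neutral add.right_neutral min.boundedI order.trans)

lemma val_gt_add: "val_gt v x d \<Longrightarrow> val_gt v y d \<Longrightarrow> val_gt v (x + y) d"
  using valuation unfolding valuation_def val_gt_def
  by (metis add.left_neutral add.right_neutral min_less_iff_conj order.strict_trans2)

lemma val_ge_uminus [simp]: "val_ge v (- x) d \<longleftrightarrow> val_ge v x d"
  unfolding val_ge_def by simp

lemma val_gt_uminus [simp]: "val_gt v (- x) d \<longleftrightarrow> val_gt v x d"
  unfolding val_gt_def by simp

lemma val_ge_minus_commute: "val_ge v (x - y) d \<longleftrightarrow> val_ge v (y - x) d"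
  using val_ge_uminus[of "x - y"] by simp

lemma val_gt_minus_commute: "val_gt v (x - y) d \<longleftrightarrow> val_gt v (y - x) d"
  using val_gt_uminus[of "x - y"] by simp

lemma val_ge_diff: "val_ge v x d \<Longrightarrow> val_ge v y d \<Longrightarrow> val_ge v (x - y) d"
  using val_ge_add[of x d "- y"] by simp

lemma val_gt_diff: "val_gt v x d \<Longrightarrow> val_gt v y d \<Longrightarrow> val_gt v (x - y) d"
  using val_gt_add[of x d "- y"] by simp

lemma val_ge_diff_trans: "val_ge v (x - y) d \<Longrightarrow> val_ge v (y - z) d \<Longrightarrow> val_ge v (x - z) d"
  using val_ge_add[of "x - y" d "y - z"] by simp

lemma val_gt_diff_trans: "val_gt v (x - y) d \<Longrightarrow> val_gt v (y - z) d \<Longrightarrow> val_gt v (x - z) d"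
  using val_gt_add[of "x - y" d "y - z"] by simp

lemma val_0 [simp]: "val_ge v 0 d" "val_gt v 0 d"
  unfolding val_ge_def val_gt_def by simp_all

lemma val_ge_1 [simp]: "integral 1"
  unfolding val_ge_def by simp

lemma val_gt_imp_ge: "val_gt v x d \<Longrightarrow> val_ge v x d"
  unfolding val_ge_def val_gt_def by auto

lemma val_ge_mono: "val_ge v x d \<Longrightarrow> d' \<le> d \<Longrightarrow> val_ge v x d'"
  unfolding val_ge_def by auto

lemma val_ge_sum: "(\<And>i. i \<in> A \<Longrightarrow> val_ge v (f i) d) \<Longrightarrow> val_ge v (sum f A) d"
  by (induction A rule: infinite_finite_induct) (auto intro: val_ge_add)

lemma val_gt_sum: "(\<And>i. i \<in> A \<Longrightarrow> val_gt v (f i) d) \<Longrightarrow> val_gt v (sum f A) d"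
  by (induction A rule: infinite_finite_induct) (auto intro: val_gt_add)

lemma val_ge_mult: "val_ge v x d \<Longrightarrow> val_ge v y d' \<Longrightarrow> val_ge v (x * y) (d + d')"
  unfolding val_ge_def by (cases "x = 0"; cases "y = 0") (auto simp: v_mult)

lemma val_gt_mult_left: "val_gt v x d \<Longrightarrow> val_ge v y d' \<Longrightarrow> val_gt v (x * y) (d + d')"
  unfolding val_ge_def val_gt_def by (cases "x = 0"; cases "y = 0") (auto simp: v_mult)

lemma val_gt_mult_right: "val_ge v x d \<Longrightarrow> val_gt v y d' \<Longrightarrow> val_gt v (x * y) (d + d')"
  unfolding val_ge_def val_gt_def by (cases "x = 0"; cases "y = 0") (auto simp: v_mult)

lemma integral_mult: "integral x \<Longrightarrow> integral y \<Longrightarrow> integral (x * y)"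
  using val_ge_mult[of x 0 y 0] by simp

lemma integral_power: "integral x \<Longrightarrow> integral (x ^ n)"
  by (induction n) (auto intro: integral_mult)

lemma integral_of_nat: "integral (of_nat n)"
  by (induction n) (auto intro: val_ge_add)

lemma infinitesimal_mult_iff:
  assumes "integral x" "integral y"
  shows "infinitesimal (x * y) \<longleftrightarrow> infinitesimal x \<or> infinitesimal y"
  using assms unfolding val_ge_def val_gt_def
  by (cases "x = 0"; cases "y = 0") (auto simp: v_mult)

lemma val_gt_mult_unit:
  assumes "x \<noteq> 0" shows "val_gt v (x * y) d \<longleftrightarrow> val_gt v y (d - v x)"
  using assms unfolding val_gt_def by (cases "x = 0"; cases "y = 0") (auto simp: v_mult)

lemma val_ge_mult_unit:
  assumes "x \<noteq> 0" shows "val_ge v (x * y) d \<longleftrightarrow> val_ge v y (d - v x)"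
  using assms unfolding val_ge_def by (cases "x = 0"; cases "y = 0") (auto simp: v_mult)

text \<open>The term of smaller value dominates a sum: were \<open>v y\<close> larger than
  \<open>v x\<close>, then x = y - (y - x) would have a value larger than its own.\<close>

lemma v_eq_of_val_gt_diff:
  assumes "x \<noteq> 0" "val_gt v (y - x) (v x)"
  shows "y \<noteq> 0" "v y = v x"
proof -
  show y: "y \<noteq> 0" using assms by (auto simp: val_gt_def)
  have "val_ge v (x + (y - x)) (v x)"
    using assms(2) by (intro val_ge_add) (auto simp: val_ge_def val_gt_def)
  then have 1: "v y \<ge> v x" using y by (auto simp: val_ge_def)
  have "\<not> v y > v x"
  proof
    assume "v y > v x"
    then have "val_gt v (y - (y - x)) (v x)"
      using val_gt_diff[of y "v x" "y - x"] assms by (auto simp: val_gt_def)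
    then show False using assms(1) by (simp add: val_gt_def)
  qed
  with 1 show "v y = v x" by simp
qed

lemma not_infinitesimal_1 [simp]: "\<not> infinitesimal 1"
  by (simp add: val_gt_def)

text \<open>Dedekind's independence of characters modulo the maximal ideal, where congruent characters
  are grouped together. The induction removes one character not congruent to \<open>t\<close> at a time.\<close>

lemma dedekind_independence:
  fixes \<chi> :: "'i \<Rightarrow> 'b::monoid_mult \<Rightarrow> 'a"
  assumes "finite T" "t \<in> T"
    and "\<And>i x. i \<in> T \<Longrightarrow> x \<in> U \<Longrightarrow> integral (\<chi> i x)"
    and "\<And>i x y. i \<in> T \<Longrightarrow> x \<in> U \<Longrightarrow> y \<in> U \<Longrightarrow> \<chi> i (x * y) = \<chi> i x * \<chi> i y"
    and "\<And>i. i \<in> T \<Longrightarrow> \<chi> i 1 = 1"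
    and U: "1 \<in> U" "\<And>x y. x \<in> U \<Longrightarrow> y \<in> U \<Longrightarrow> x * y \<in> U"
    and "\<And>i. i \<in> T \<Longrightarrow> integral (a i)"
    and "\<And>x. x \<in> U \<Longrightarrow> infinitesimal (\<Sum>i\<in>T. a i * \<chi> i x)"
  shows "infinitesimal (\<Sum>i | i \<in> T \<and> (\<forall>x\<in>U. infinitesimal (\<chi> i x - \<chi> t x)). a i)"
  using assms(1-5,8,9)
proof (induction "card T" arbitrary: T a)
  case 0
  then show ?case by simp
next
  case (Suc n)
  let ?C = "\<lambda>T. {i \<in> T. \<forall>x\<in>U. infinitesimal (\<chi> i x - \<chi> t x)}"
  show ?case
  proof (cases "?C T = T")
    case True
    have "infinitesimal (\<Sum>i\<in>T. a i * \<chi> i 1)" using Suc.prems(7) U(1) by blast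
    moreover have "(\<Sum>i\<in>T. a i * \<chi> i 1) = (\<Sum>i\<in>T. a i)"
      using Suc.prems(5) by (intro sum.cong) auto
    ultimately show ?thesis unfolding True by simp
  next
    case False
    then obtain j w where j: "j \<in> T" "w \<in> U" "\<not> infinitesimal (\<chi> j w - \<chi> t w)" by blast
    let ?T = "T - {j}" and ?a = "\<lambda>i. a i * (\<chi> i w - \<chi> j w)"
    have tj: "t \<noteq> j" using j(3) by (auto simp: val_gt_def)
    have "infinitesimal (\<Sum>i\<in>?C ?T. ?a i)"
    proof (rule Suc.hyps(1))
      show "n = card ?T" using Suc.hyps(2) j(1) Suc.prems(1) by simp
      show "integral (?a i)" if "i \<in> ?T" for i
        using that Suc.prems(3,6) j by (intro integral_mult val_ge_diff) auto
      show "infinitesimal (\<Sum>i\<in>?T. ?a i * \<chi> i x)" if x: "x \<in> U" for x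
      proof -
        have "infinitesimal ((\<Sum>i\<in>T. a i * \<chi> i (w * x)) - \<chi> j w * (\<Sum>i\<in>T. a i * \<chi> i x))"
          using Suc.prems(7) U(2) x j val_gt_mult_right[of "\<chi> j w" 0 _ 0] Suc.prems(3)
          by (intro val_gt_diff) auto
        also have "(\<Sum>i\<in>T. a i * \<chi> i (w * x)) - \<chi> j w * (\<Sum>i\<in>T. a i * \<chi> i x)
            = (\<Sum>i\<in>T. ?a i * \<chi> i x)"
          unfolding sum_distrib_left sum_subtractf[symmetric]
          using Suc.prems(4) x j by (intro sum.cong) (auto simp: algebra_simps)
        also have "\<dots> = (\<Sum>i\<in>?T. ?a i * \<chi> i x)"
          using Suc.prems(1) j(1) by (simp add: sum.remove[of T j])
        finally show ?thesis .
      qed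
    qed (use Suc.prems tj in auto)
    moreover have "?C ?T = ?C T"
      using j by auto
    ultimately have 1: "infinitesimal (\<Sum>i\<in>?C T. ?a i)" by simp
    have "infinitesimal (\<Sum>i\<in>?C T. a i * (\<chi> i w - \<chi> t w))"
      using Suc.prems(6) j(2) val_gt_mult_right[of _ 0 _ 0] by (intro val_gt_sum) auto
    from val_gt_diff[OF 1 this]
    have "infinitesimal (\<Sum>i\<in>?C T. a i * (\<chi> t w - \<chi> j w))"
      unfolding sum_subtractf[symmetric] by (simp add: algebra_simps)
    then have "infinitesimal ((\<Sum>i\<in>?C T. a i) * (\<chi> t w - \<chi> j w))"
      by (simp add: sum_distrib_right)
    moreover have "integral (\<Sum>i\<in>?C T. a i)"
      using Suc.prems(6) by (intro val_ge_sum) auto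
    moreover have "integral (\<chi> t w - \<chi> j w)"
      using Suc.prems j by (intro val_ge_diff) auto
    ultimately show ?thesis
      using j(3) by (auto simp: infinitesimal_mult_iff val_gt_minus_commute)
  qed
qed

text \<open>Over the residue field, a polynomial of degree \<open>n\<close> has at most
  \<open>n\<close> roots; \<open>A\<close> holds integral representatives of distinct residue
  classes.\<close>

lemma card_roots_mod_infinitesimal_le:
  assumes "finite A" "\<And>a. a \<in> A \<Longrightarrow> integral a"
    and "\<And>a b. a \<in> A \<Longrightarrow> b \<in> A \<Longrightarrow> infinitesimal (a - b) \<Longrightarrow> a = b"
    and "\<And>i. i \<le> n \<Longrightarrow> integral (c i)" "\<not> infinitesimal (c n)"
    and "\<And>a. a \<in> A \<Longrightarrow> infinitesimal (\<Sum>i\<le>n. c i * a ^ i)"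
  shows "card A \<le> n"
  using assms
proof (induction n arbitrary: A c)
  case 0
  then have "A = {}" by auto
  then show ?case by simp
next
  case (Suc n)
  show ?case
  proof (cases "A = {}")
    case False
    then obtain b where b: "b \<in> A" by blast
    \<comment> \<open>The coefficients of (P(x) - P(b)) / (x - b), whose leading coefficient is that
      of P.\<close>
    define c' where "c' = (\<lambda>j. \<Sum>i=Suc j..Suc n. c i * b ^ (i - j - 1))"
    have "card (A - {b}) \<le> n"
    proof (rule Suc.IH)
      show "integral (c' i)" for i
        unfolding c'_def using Suc.prems b by (intro val_ge_sum integral_mult integral_power) auto
      show "\<not> infinitesimal (c' n)" unfolding c'_def using Suc.prems(5) by simp
      show "infinitesimal (\<Sum>i\<le>n. c' i * a ^ i)" if a: "a \<in> A - {b}" for a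
      proof -
        have "infinitesimal ((\<Sum>i\<le>Suc n. c i * a ^ i) - (\<Sum>i\<le>Suc n. c i * b ^ i))"
          using a b Suc.prems(6) by (intro val_gt_diff) auto
        also have "(\<Sum>i\<le>Suc n. c i * a ^ i) - (\<Sum>i\<le>Suc n. c i * b ^ i) =
           (a - b) * (\<Sum>j<Suc n. c' j * a ^ j)"
          unfolding c'_def by (rule polyfun_diff) simp
        finally have "infinitesimal ((a - b) * (\<Sum>j\<le>n. c' j * a ^ j))"
          by (simp only: lessThan_Suc_atMost)
        moreover have "integral (a - b)" using Suc.prems(2) a b by (intro val_ge_diff) auto
        moreover have "integral (\<Sum>j\<le>n. c' j * a ^ j)"
          using a Suc.prems(2) \<open>\<And>i. integral (c' i)\<close>
          by (intro val_ge_sum integral_mult integral_power) auto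
        moreover have "\<not> infinitesimal (a - b)" using Suc.prems(3)[of a b] a b by auto
        ultimately show ?thesis by (simp add: infinitesimal_mult_iff)
      qed
    qed (use Suc.prems in auto)
    then show ?thesis using b Suc.prems(1) by simp
  qed simp
qed

end

subsection \<open>Finite extensions of complete fields\<close>

definition val_complete :: "('q::field \<Rightarrow> rat) \<Rightarrow> bool" where
  "val_complete w \<longleftrightarrow> (\<forall>Y :: nat \<Rightarrow> 'q.
        (\<forall>N. \<exists>n0. \<forall>m\<ge>n0. \<forall>n\<ge>n0. val_ge w (Y m - Y n) N) \<longrightarrow>
        (\<exists>x. \<forall>N. \<exists>n0. \<forall>n\<ge>n0. val_ge w (Y n - x) N))"

text \<open>Applied with \<open>j\<close> the inclusion of the p-adic field into the algebraic
  closure of K. The factor \<open>c\<close> records that \<open>v\<close> is normalised on K and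
  \<open>w\<close> on the base.\<close>

locale complete_base = valued_field v for v :: "'a::field \<Rightarrow> rat" +
  fixes w :: "'q::field \<Rightarrow> rat" and j :: "'q \<Rightarrow> 'a" and c :: rat
  assumes w: "valuation w" and complete: "val_complete w"
    and j_add: "j (x + y) = j x + j y" and j_mult: "j (x * y) = j x * j y" and j_1: "j 1 = 1"
    and c: "c > 0" and v_j: "x \<noteq> 0 \<Longrightarrow> v (j x) = c * w x"
begin

lemma j_0 [simp]: "j 0 = 0" by (metis add_cancel_right_right j_add)

lemma j_uminus: "j (- x) = - j x"
  using j_add[of x "- x"] by (simp add: eq_neg_iff_add_eq_0 add.commute)

lemma j_diff: "j (x - y) = j x - j y"
  using j_add[of x "- y"] by (simp add: j_uminus)

lemma j_eq_0 [simp]: "j x = 0 \<longleftrightarrow> x = 0"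
  using j_mult[of x "inverse x"] j_1 by (cases "x = 0") auto

lemma j_inverse: "j (inverse x) = inverse (j x)"
  using j_mult[of x "inverse x"] j_1 by (cases "x = 0") (auto intro: inverse_unique[symmetric])

lemma val_ge_j: "val_ge v (j x) d \<longleftrightarrow> val_ge w x (d / c)"
  using c v_j[of x] unfolding val_ge_def by (cases "x = 0") (auto simp: field_simps)

abbreviation lincombs :: "'a set \<Rightarrow> 'a set" where
  "lincombs S \<equiv> {\<Sum>s\<in>S. j (a s) * s | a. True}"

lemma lincombs_lin:
  assumes "x \<in> lincombs S" "y \<in> lincombs S"
  shows "j k * x + j l * y \<in> lincombs S"
proof -
  obtain a a' where a: "x = (\<Sum>s\<in>S. j (a s) * s)" "y = (\<Sum>s\<in>S. j (a' s) * s)"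
    using assms by blast
  have "j k * x + j l * y = (\<Sum>s\<in>S. j (k * a s + l * a' s) * s)"
    unfolding a by (simp add: sum_distrib_left sum.distrib[symmetric] j_add j_mult algebra_simps)
  then show ?thesis by (intro CollectI exI conjI TrueI)
qed

lemma lincombs_sum: "(\<And>i. i \<in> A \<Longrightarrow> f i \<in> lincombs S) \<Longrightarrow> sum f A \<in> lincombs S"
proof (induction A rule: infinite_finite_induct)
  case (insert i A)
  then show ?case using lincombs_lin[of "f i" S "sum f A" 1 1] by (simp add: j_1)
qed (auto intro!: exI[of _ "\<lambda>_. 0"])

lemma lincombs_gen:
  assumes "finite S" "s \<in> S" shows "j k * s \<in> lincombs S"
proof -
  have "(\<Sum>x\<in>S. j (if x = s then k else 0) * x) = (\<Sum>x\<in>S. if x = s then j k * x else 0)"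
    by (intro sum.cong) auto
  also have "\<dots> = j k * s" using assms by simp
  finally have "j k * s = (\<Sum>x\<in>S. j (if x = s then k else 0) * x)" ..
  then show ?thesis by (intro CollectI exI conjI TrueI)
qed

text \<open>By induction on \<open>S\<close>: a vector outside the span of \<open>S\<close> stays at bounded distance from that span,
  since the span is complete.\<close>

lemma coefficients_bounded:
  assumes "finite S"
  shows "\<exists>C. \<forall>x\<in>lincombs S. \<forall>d. val_ge v x d \<longrightarrow>
      (\<exists>a. x = (\<Sum>s\<in>S. j (a s) * s) \<and> (\<forall>s\<in>S. val_ge v (j (a s)) (d - C)))"
  using assms
proof (induction S)
  case empty
  show ?case by auto
next
  case (insert b S)
  define V where "V = lincombs S"
  note V_lin = lincombs_lin[of _ S, folded V_def]
  have V_diff: "x - y \<in> V" if "x \<in> V" "y \<in> V" for x y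
    using V_lin[OF that, of 1 "-1"] by (simp add: j_1 j_uminus)
  have V_scale: "j k * x \<in> V" if "x \<in> V" for x k
    using V_lin[OF that that, of k 0] by simp
  obtain C where C: "\<And>x d. x \<in> V \<Longrightarrow> val_ge v x d \<Longrightarrow>
      \<exists>a. x = (\<Sum>s\<in>S. j (a s) * s) \<and> (\<forall>s\<in>S. val_ge v (j (a s)) (d - C))"
    using insert.IH unfolding V_def by blast
  have sum_insert: "(\<Sum>s\<in>insert b S. j (a s) * s) = j (a b) * b + (\<Sum>s\<in>S. j (a s) * s)" for a
    using insert by simp
  have ext: "\<exists>a'. j k * b + (\<Sum>s\<in>S. j (a s) * s) = (\<Sum>s\<in>insert b S. j (a' s) * s) \<and>
      a' b = k \<and> (\<forall>s\<in>S. a' s = a s)" for a k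
  proof -
    have "(\<Sum>s\<in>S. j (if s = b then k else a s) * s) = (\<Sum>s\<in>S. j (a s) * s)"
      using insert.hyps by (intro sum.cong) auto
    then show ?thesis unfolding sum_insert
      using insert.hyps by (intro exI[of _ "\<lambda>s. if s = b then k else a s"]) auto
  qed
  have decompose: "\<exists>k y. y \<in> V \<and> x = j k * b + y"
    if "x \<in> lincombs (insert b S)" for x
    using that unfolding V_def sum_insert by blast
  show ?case
  proof (cases "b \<in> V")
    case True
    show ?thesis
    proof (intro exI[of _ C] ballI allI impI)
      fix x d assume x: "x \<in> lincombs (insert b S)" "val_ge v x d"
      obtain k y where y: "y \<in> V" "x = j k * b + y" using decompose[OF x(1)] by blast
      have "x \<in> V" using V_lin[OF True y(1), of k 1] y(2) by (simp add: j_1)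
      then obtain a where a: "x = (\<Sum>s\<in>S. j (a s) * s)" "\<forall>s\<in>S. val_ge v (j (a s)) (d - C)"
        using C x(2) by blast
      then show "\<exists>a. x = (\<Sum>s\<in>insert b S. j (a s) * s) \<and>
          (\<forall>s\<in>insert b S. val_ge v (j (a s)) (d - C))"
        using ext[of 0 a] by auto
    qed
  next
    case False
    \<comment> \<open>Otherwise points \<open>Y n\<close> of \<open>V\<close> converge to
      \<open>b\<close>. By the induction hypothesis their successive differences have small
      coefficients, so the coefficients of \<open>Y n\<close> can be chosen to be Cauchy, and their
      limits place \<open>b\<close> in \<open>V\<close>.\<close>
    have "\<exists>D. \<forall>y\<in>V. \<not> val_ge v (b - y) D"
    proof (rule ccontr)
      assume "\<nexists>D. \<forall>y\<in>V. \<not> val_ge v (b - y) D"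
      then have "\<forall>n::nat. \<exists>y\<in>V. val_ge v (b - y) (of_nat n)" by blast
      then obtain Y where Y: "\<And>n::nat. Y n \<in> V" "\<And>n. val_ge v (b - Y n) (of_nat n)" by metis
      have "\<exists>a. Y (Suc n) - Y n = (\<Sum>s\<in>S. j (a s) * s) \<and>
          (\<forall>s\<in>S. val_ge v (j (a s)) (of_nat n - C))" for n
      proof (rule C)
        show "Y (Suc n) - Y n \<in> V" using Y(1) by (intro V_diff)
        have "val_ge v (b - Y (Suc n)) (of_nat n)" using Y(2)[of "Suc n"] by (rule val_ge_mono) simp
        then show "val_ge v (Y (Suc n) - Y n) (of_nat n)"
          using val_ge_diff_trans Y(2)[of n] val_ge_minus_commute by blast
      qed
      then obtain a where a: "\<And>n. Y (Suc n) - Y n = (\<Sum>s\<in>S. j (a n s) * s)"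
        "\<And>n s. s \<in> S \<Longrightarrow> val_ge v (j (a n s)) (of_nat n - C)" by metis
      obtain a0 where a0: "Y 0 = (\<Sum>s\<in>S. j (a0 s) * s)" using Y(1)[of 0] unfolding V_def by blast
      define P where "P = (\<lambda>s n. a0 s + (\<Sum>i<n. a i s))"
      have YP: "Y n = (\<Sum>s\<in>S. j (P s n) * s)" for n
      proof (induction n)
        case (Suc n)
        have "Y (Suc n) = (\<Sum>s\<in>S. j (P s n) * s) + (\<Sum>s\<in>S. j (a n s) * s)"
          by (metis Suc a(1) add.commute diff_add_cancel)
        also have "\<dots> = (\<Sum>s\<in>S. j (P s (Suc n)) * s)"
          unfolding sum.distrib[symmetric] by (intro sum.cong) (auto simp: P_def j_add algebra_simps)
        finally show ?case .
      qed (simp add: P_def a0)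
      interpret w: valued_field w using w by unfold_locales
      have P_diff: "val_ge w (P s m - P s n) ((of_nat n - C) / c)" if "s \<in> S" "m \<ge> n" for s m n
        using that(2)
      proof (induction m rule: dec_induct)
        case (step m)
        have "val_ge w (a m s) ((of_nat m - C) / c)" using a(2)[OF that(1)] by (simp add: val_ge_j)
        then have "val_ge w (a m s) ((of_nat n - C) / c)"
          by (rule w.val_ge_mono) (use step c in \<open>auto simp: divide_simps\<close>)
        from w.val_ge_add[OF step.IH this] show ?case by (simp add: P_def algebra_simps)
      qed simp
      have large: "\<exists>n0. \<forall>n\<ge>n0. (of_nat n - C) / c \<ge> N" for N
      proof -
        obtain n0 where "of_nat n0 > N * c + C" using reals_Archimedean2 by blast
        then have "\<forall>n\<ge>n0. (of_nat n - C) / c \<ge> N"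
          using c by (auto simp: field_simps)
        then show ?thesis by blast
      qed
      have "\<exists>x. \<forall>N. \<exists>n0. \<forall>n\<ge>n0. val_ge w (P s n - x) N" if s: "s \<in> S" for s
      proof -
        have "\<exists>n0. \<forall>m\<ge>n0. \<forall>n\<ge>n0. val_ge w (P s m - P s n) N" for N
        proof -
          obtain n0 where n0: "\<forall>n\<ge>n0. (of_nat n - C) / c \<ge> N" using large by blast
          have "val_ge w (P s m - P s n) N" if "m \<ge> n0" "n \<ge> n0" for m n
          proof (cases "m \<ge> n")
            case True
            then show ?thesis using P_diff[OF s True] n0 that w.val_ge_mono by blast
          next
            case False
            then show ?thesis
              using P_diff[OF s, of m n] n0 that w.val_ge_mono w.val_ge_minus_commute
              by (meson nle_le)
          qed
          then show ?thesis by blast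
        qed
        then show ?thesis using complete unfolding val_complete_def by blast
      qed
      then obtain x where x: "\<And>s N. s \<in> S \<Longrightarrow> \<exists>n0. \<forall>n\<ge>n0. val_ge w (P s n - x s) N" by metis
      define z where "z = (\<Sum>s\<in>S. j (x s) * s)"
      have "val_ge v (b - z) N" for N
      proof -
        have "\<forall>s\<in>S. \<exists>n0. \<forall>n\<ge>n0. val_ge v (j (P s n - x s) * s) N"
        proof
          fix s assume s: "s \<in> S"
          show "\<exists>n0. \<forall>n\<ge>n0. val_ge v (j (P s n - x s) * s) N"
          proof (cases "s = 0")
            case False
            then show ?thesis using x[OF s, of "(N - v s) / c"]
              by (simp add: val_ge_mult_unit mult.commute[of _ s] val_ge_j)
          qed simp
        qed
        then obtain n0 where n0: "\<And>s n. s \<in> S \<Longrightarrow> n \<ge> n0 s \<Longrightarrow> val_ge v (j (P s n - x s) * s) N"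
          by metis
        \<comment> \<open>Beyond \<open>N\<close>, the difference \<open>b - Y n\<close> is small;
          beyond each \<open>n0 s\<close>, so is every summand of \<open>Y n - z\<close>.\<close>
        define n where "n = Max (insert (nat \<lceil>N\<rceil>) (n0 ` S))"
        have n: "n \<ge> nat \<lceil>N\<rceil>" "\<And>s. s \<in> S \<Longrightarrow> n \<ge> n0 s"
          unfolding n_def using insert.hyps by auto
        have "val_ge v (\<Sum>s\<in>S. j (P s n - x s) * s) N"
          using n0 n(2) by (intro val_ge_sum) auto
        also have "(\<Sum>s\<in>S. j (P s n - x s) * s) = Y n - z"
          unfolding YP z_def sum_subtractf[symmetric]
          by (intro sum.cong) (auto simp: j_diff algebra_simps)
        finally have 1: "val_ge v (Y n - z) N" .
        have "of_nat n \<ge> N" using n(1) by linarith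
        then have "val_ge v (b - Y n) N" using Y(2)[of n] val_ge_mono by blast
        with 1 show ?thesis using val_ge_diff_trans by blast
      qed
      \<comment> \<open>No value exceeds itself by one, so only the convention at 0 is left.\<close>
      from this[of "v (b - z) + 1"] have "b = z" by (auto simp: val_ge_def)
      then show False using False unfolding V_def z_def by blast
    qed
    then obtain D where D: "\<And>y. y \<in> V \<Longrightarrow> \<not> val_ge v (b - y) D" by blast
    have b0: "b \<noteq> 0" using False V_scale[of _ 0] C unfolding V_def
      by (metis (mono_tags, lifting) V_def V_diff diff_self mem_Collect_eq)
    \<comment> \<open>The loss that covers both terms of y = x - j k * b: bounding the coefficient
      \<open>k\<close> costs \<open>D\<close>, and multiplication by \<open>b\<close> gives back
      \<open>v b\<close>.\<close>
    define D' where "D' = max 0 (D - v b)"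
    show ?thesis
    proof (intro exI[of _ "max D (C + D')"] ballI allI impI)
      fix x d assume x: "x \<in> lincombs (insert b S)" "val_ge v x d"
      obtain k y where y: "y \<in> V" "x = j k * b + y" using decompose[OF x(1)] by blast
      have k: "val_ge v (j k) (d - D)"
      proof (cases "k = 0")
        case False
        then have jk: "j k \<noteq> 0" by simp
        \<comment> \<open>Dividing by \<open>j k\<close> turns \<open>x\<close> into
          \<open>b\<close> minus an element of \<open>V\<close>, which cannot have value
          \<open>D\<close> or more.\<close>
        have "x = j k * (b - j (- inverse k) * y)"
          using jk by (simp add: y(2) j_uminus j_inverse algebra_simps)
        then have "val_ge v (b - j (- inverse k) * y) (d - v (j k))"
          using val_ge_mult_unit[OF jk] x(2) by simp
        moreover have "\<not> val_ge v (b - j (- inverse k) * y) D" using D V_scale y(1) by blast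
        ultimately have "d - v (j k) < D" using val_ge_mono linorder_not_less by blast
        then show ?thesis by (simp add: val_ge_def)
      qed simp
      have "val_ge v y (d - D')"
      proof -
        have "val_ge v (j k * b) (d - D + v b)"
          using b0 by (intro val_ge_mult k) (simp add: val_ge_def)
        then have "val_ge v (j k * b) (d - D')" by (rule val_ge_mono) (simp add: D'_def)
        moreover have "val_ge v x (d - D')" using x(2) by (rule val_ge_mono) (simp add: D'_def)
        ultimately show ?thesis using val_ge_diff[of x _ "j k * b"] y(2) by simp
      qed
      then obtain a where a: "y = (\<Sum>s\<in>S. j (a s) * s)" "\<forall>s\<in>S. val_ge v (j (a s)) (d - D' - C)"
        using C y(1) by blast
      obtain a' where a': "x = (\<Sum>s\<in>insert b S. j (a' s) * s)" "a' b = k" "\<forall>s\<in>S. a' s = a s"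
        using ext[of k a] y(2) a(1) by blast
      show "\<exists>a. x = (\<Sum>s\<in>insert b S. j (a s) * s) \<and>
          (\<forall>s\<in>insert b S. val_ge v (j (a s)) (d - max D (C + D')))"
      proof (intro exI[of _ a'] conjI ballI)
        fix s assume "s \<in> insert b S"
        then show "val_ge v (j (a' s)) (d - max D (C + D'))"
        proof
          assume "s = b"
          then show ?thesis using a'(2) val_ge_mono[OF k, of "d - max D (C + D')"] by simp
        next
          assume "s \<in> S"
          then show ?thesis
            using a'(3) a(2) val_ge_mono[of "j (a s)" "d - D' - C" "d - max D (C + D')"] by simp
        qed
      qed (use a'(1) in simp)
    qed
  qed
qed

text \<open>The values of \<open>\<sigma> x\<close> and \<open>x\<close> differ by a bounded amount, hence not at all: apply this to
  the powers of \<open>x\<close>.\<close>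

lemma embedding_val_ge:
  fixes \<sigma> :: "'a \<Rightarrow> 'a"
  assumes "finite S" and x: "x \<noteq> 0" "\<sigma> x \<noteq> 0"
    and powers: "\<And>n. x ^ n \<in> lincombs S"
    and \<sigma>_pow: "\<And>n. \<sigma> (x ^ n) = \<sigma> x ^ n"
    and \<sigma>_lin: "\<And>a. \<sigma> (\<Sum>s\<in>S. j (a s) * s) = (\<Sum>s\<in>S. j (a s) * \<sigma> s)"
  shows "v (\<sigma> x) \<ge> v x"
proof -
  obtain C where C: "\<forall>y\<in>lincombs S. \<forall>d. val_ge v y d \<longrightarrow>
      (\<exists>a. y = (\<Sum>s\<in>S. j (a s) * s) \<and> (\<forall>s\<in>S. val_ge v (j (a s)) (d - C)))"
    using coefficients_bounded[OF assms(1)] by blast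
  \<comment> \<open>A lower bound for the values of all \<open>\<sigma> s\<close>; the inserted 0
    covers an empty \<open>S\<close>.\<close>
  define B where "B = Min (insert 0 ((\<lambda>s. v (\<sigma> s)) ` S))"
  have bound: "of_nat n * v (\<sigma> x) \<ge> of_nat n * v x + (B - C)" for n
  proof -
    have "val_ge v (x ^ n) (of_nat n * v x)" using x by (simp add: val_ge_def v_power)
    then obtain a where a: "x ^ n = (\<Sum>s\<in>S. j (a s) * s)"
      "\<And>s. s \<in> S \<Longrightarrow> val_ge v (j (a s)) (of_nat n * v x - C)"
      using C powers by blast
    have "val_ge v (\<Sum>s\<in>S. j (a s) * \<sigma> s) (of_nat n * v x - C + B)"
    proof (intro val_ge_sum val_ge_mult a(2))
      fix s assume "s \<in> S"
      then show "val_ge v (\<sigma> s) B" unfolding B_def val_ge_def using assms(1) by simp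
    qed
    then have "val_ge v (\<sigma> x ^ n) (of_nat n * v x - C + B)"
      using \<sigma>_lin[of a] a(1) \<sigma>_pow[of n] by simp
    then show ?thesis using x by (simp add: val_ge_def v_power algebra_simps)
  qed
  show ?thesis
  proof (rule ccontr)
    assume "\<not> v x \<le> v (\<sigma> x)"
    then have pos: "v x - v (\<sigma> x) > 0" by simp
    obtain n where "of_nat n * (v x - v (\<sigma> x)) > C - B" using ex_less_of_nat_mult[OF pos] by blast
    with bound[of n] show False by (simp add: algebra_simps)
  qed
qed

end

subsection \<open>Polynomials over the base field evaluated in the algebraic closure\<close>

definition ev :: "'k::field poly \<Rightarrow> 'k alg_closure \<Rightarrow> 'k alg_closure" where
  "ev p x = poly (map_poly to_ac p) x"

lemma map_poly_to_ac_add: "map_poly to_ac (p + q) = map_poly to_ac p + map_poly to_ac q"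
  by (intro poly_eqI) (simp add: coeff_map_poly)

lemma map_poly_to_ac_mult: "map_poly to_ac (p * q) = map_poly to_ac p * map_poly to_ac q"
  by (intro poly_eqI) (simp add: coeff_map_poly coeff_mult to_ac_sum)

lemma map_poly_to_ac_pderiv: "map_poly to_ac (pderiv p) = pderiv (map_poly to_ac p)"
  by (intro poly_eqI) (simp add: coeff_map_poly coeff_pderiv)

lemma ev_simps [simp]:
  "ev 0 x = 0" "ev 1 x = 1" "ev (p + q) x = ev p x + ev q x" "ev (p * q) x = ev p x * ev q x"
  "ev [:k:] x = to_ac k" "ev (pCons k p) x = to_ac k + x * ev p x"
  "ev (smult k p) x = to_ac k * ev p x"
  unfolding ev_def
  by (simp_all add: map_poly_to_ac_add map_poly_to_ac_mult map_poly_pCons map_poly_smult)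

lemma ev_uminus [simp]: "ev (- p) x = - ev p x"
  using ev_simps(3)[of p "- p" x] by (simp del: ev_simps(3) add: eq_neg_iff_add_eq_0 add.commute)

lemma ev_diff [simp]: "ev (p - q) x = ev p x - ev q x"
  using ev_simps(3)[of p "- q" x] by (simp del: ev_simps(3))

lemma ev_monom [simp]: "ev (Polynomial.monom k n) x = to_ac k * x ^ n"
  unfolding ev_def by (simp add: map_poly_monom poly_monom)

lemma ev_pcompose [simp]: "ev (pcompose p q) x = ev p (ev q x)"
  by (induction p) (simp_all add: pcompose_pCons)

lemma ev_altdef: "ev p x = (\<Sum>i\<le>Polynomial.degree p. to_ac (Polynomial.coeff p i) * x ^ i)"
  unfolding ev_def poly_altdef by (simp add: degree_map_poly coeff_map_poly)

text \<open>A generator of the annihilator ideal, unique up to a unit. It is not made monic, since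
  only divisibility and degree matter.\<close>

definition is_minpoly :: "'k::field poly \<Rightarrow> 'k alg_closure \<Rightarrow> bool" where
  "is_minpoly m x \<longleftrightarrow> m \<noteq> 0 \<and> (\<forall>q. ev q x = 0 \<longleftrightarrow> m dvd q)"

lemma is_minpoly_ev: "is_minpoly m x \<Longrightarrow> ev m x = 0"
  unfolding is_minpoly_def by simp

lemma minpoly_exists: "\<exists>m. is_minpoly m x"
proof -
  obtain p where p: "p \<noteq> 0" "ev p x = 0" using alg_closure_algebraic[of x] unfolding ev_def by metis
  obtain m where m: "m \<noteq> 0" "ev m x = 0"
    and least: "\<And>q. q \<noteq> 0 \<Longrightarrow> ev q x = 0 \<Longrightarrow> Polynomial.degree m \<le> Polynomial.degree q"
    using ex_has_least_nat[of "\<lambda>q. q \<noteq> 0 \<and> ev q x = 0" p Polynomial.degree] p by blast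
  have "m dvd q" if q: "ev q x = 0" for q
  proof -
    have "ev q x = ev (q div m) x * ev m x + ev (q mod m) x"
      by (metis div_mult_mod_eq ev_simps(3,4))
    then have "ev (q mod m) x = 0" using q m(2) by simp
    then have "q mod m = 0" using least[of "q mod m"] degree_mod_less[OF m(1), of q] by force
    then show ?thesis by (simp add: dvd_eq_mod_eq_0)
  qed
  then have "is_minpoly m x" unfolding is_minpoly_def using m by auto
  then show ?thesis ..
qed

text \<open>Irreducibility in disguise: the minimal polynomial of \<open>y\<close> divides
  \<open>m\<close>, with cofactor \<open>h\<close>, and one of the two factors vanishes at
  \<open>x\<close>. If it were \<open>h\<close>, then \<open>m\<close> would divide \<open>h\<close>
  and the other factor would be a unit, although it vanishes at \<open>y\<close>.\<close>

lemma is_minpoly_conjugate: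
  assumes m: "is_minpoly m x" and y: "ev m y = 0"
  shows "is_minpoly m y"
proof -
  obtain m' where m': "is_minpoly m' y" using minpoly_exists by blast
  then obtain h where h: "m = m' * h" using y unfolding is_minpoly_def by blast
  have "ev m' x = 0 \<or> ev h x = 0" using is_minpoly_ev[OF m] by (simp add: h)
  then have "m dvd m'"
  proof
    assume "ev h x = 0"
    then obtain k where "h = m * k" using m unfolding is_minpoly_def by blast
    then have "m * (m' * k) = m * 1" using h by (metis mult.left_commute mult_1_right)
    then have "m' * k = 1" using m unfolding is_minpoly_def by (metis mult_left_cancel)
    then have "ev m' y * ev k y = 1" by (metis ev_simps(2,4))
    then show ?thesis using is_minpoly_ev[OF m'] by simp
  qed (use m in \<open>simp add: is_minpoly_def\<close>)
  then show ?thesis using m m' h unfolding is_minpoly_def by (metis dvd_trans dvd_triv_left)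
qed

text \<open>In characteristic 0 the derivative of the nonconstant \<open>m\<close> is nonzero of
  smaller degree, so \<open>m\<close>, which is the minimal polynomial of \<open>y\<close> as well,
  cannot divide it.\<close>

lemma is_minpoly_separable:
  fixes x :: "'k::field_char_0 alg_closure"
  assumes m: "is_minpoly m x" and y: "ev m y = 0"
  shows "ev (pderiv m) y \<noteq> 0"
proof
  assume "ev (pderiv m) y = 0"
  then have dvd: "m dvd pderiv m"
    using is_minpoly_conjugate[OF m y] unfolding is_minpoly_def by blast
  have deg: "Polynomial.degree m \<noteq> 0"
  proof
    assume "Polynomial.degree m = 0"
    then obtain k where "m = [:k:]" using degree_eq_zeroE by blast
    then show False using m is_minpoly_ev[OF m] unfolding is_minpoly_def by auto
  qed
  then have "pderiv m \<noteq> 0" by (simp add: pderiv_eq_0_iff)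
  then have "Polynomial.degree m \<le> Polynomial.degree (pderiv m)" using dvd dvd_imp_degree_le by blast
  then show False using deg by (simp add: degree_pderiv)
qed

text \<open>One linear factor is split off at a time; simplicity keeps the removed root from being a
  root of the cofactor.\<close>

lemma card_roots_eq_degree:
  fixes P :: "'a::alg_closed_field poly"
  assumes "\<And>x. poly P x = 0 \<Longrightarrow> poly (pderiv P) x \<noteq> 0"
  shows "card {x. poly P x = 0} = Polynomial.degree P"
  using assms
proof (induction "Polynomial.degree P" arbitrary: P)
  case 0
  then obtain k where k: "P = [:k:]" using degree_eq_zeroE by metis
  with 0 have "k \<noteq> 0" by auto
  then show ?case using k by simp
next
  case (Suc n)
  then obtain a where a: "poly P a = 0" using alg_closed_imp_poly_has_root[of P] by auto
  then obtain Q where Q: "P = [:- a, 1:] * Q" by (meson dvdE poly_eq_0_iff_dvd)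
  have Q0: "Q \<noteq> 0" using Suc.hyps(2) Q by auto
  have deg: "Polynomial.degree P = Suc (Polynomial.degree Q)"
    unfolding Q using Q0 by (subst degree_mult_eq) auto
  have der: "poly (pderiv P) x = poly Q x + (x - a) * poly (pderiv Q) x" for x
    unfolding Q pderiv_mult by (simp add: pderiv_pCons algebra_simps)
  have Qa: "poly Q a \<noteq> 0" using Suc.prems[OF a] der[of a] by simp
  have "card {x. poly Q x = 0} = Polynomial.degree Q"
  proof (rule Suc.hyps(1))
    show "n = Polynomial.degree Q" using Suc.hyps(2) deg by simp
    show "poly (pderiv Q) x \<noteq> 0" if "poly Q x = 0" for x
      using Suc.prems[of x] der[of x] that by (auto simp: Q)
  qed
  moreover have "{x. poly P x = 0} = insert a {x. poly Q x = 0}" by (auto simp: Q)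
  ultimately show ?case using Qa deg poly_roots_finite[OF Q0] by simp
qed

lemma card_conjugates:
  fixes x :: "'k::field_char_0 alg_closure"
  assumes "is_minpoly m x"
  shows "card {y. ev m y = 0} = Polynomial.degree m"
  using card_roots_eq_degree[of "map_poly to_ac m"] is_minpoly_separable[OF assms]
  unfolding ev_def map_poly_to_ac_pderiv by (simp add: degree_map_poly)

subsection \<open>Simple extensions and primitive elements\<close>

text \<open>K[x], which is already the field K(x) because \<open>x\<close> is algebraic.\<close>

definition simple_ext :: "'k::field alg_closure \<Rightarrow> 'k alg_closure set" where
  "simple_ext x = range (\<lambda>p. ev p x)"

lemma ev_in_simple_ext: "ev p x \<in> simple_ext x"
  unfolding simple_ext_def by blast

lemma gen_in_simple_ext: "x \<in> simple_ext x"
  using ev_in_simple_ext[of "[:0, 1:]" x] by simp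

lemma to_ac_in_simple_ext: "to_ac k \<in> simple_ext x"
  using ev_in_simple_ext[of "[:k:]" x] by simp

text \<open>Inverses are read off the minimal polynomial k + X q of \<open>y\<close>: minimality
  makes its constant term nonzero, and y q(y) = -k.\<close>

lemma field_set_simple_ext: "field_set (simple_ext x)"
proof
  show "0 \<in> simple_ext x" "1 \<in> simple_ext x"
    using to_ac_in_simple_ext[of 0] to_ac_in_simple_ext[of 1] by auto
  fix y assume "y \<in> simple_ext x"
  then obtain p where y: "y = ev p x" unfolding simple_ext_def by blast
  show "- y \<in> simple_ext x" using ev_in_simple_ext[of "- p" x] y by simp
  show "inverse y \<in> simple_ext x"
  proof (cases "y = 0")
    case False
    obtain m where m: "is_minpoly m y" using minpoly_exists by blast
    obtain k q where mq: "m = pCons k q" by (metis pCons_cases)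
    have "k \<noteq> 0"
    proof
      assume "k = 0"
      then have "ev q y = 0" using is_minpoly_ev[OF m] False mq by simp
      then have "m dvd q" using m unfolding is_minpoly_def by blast
      moreover have "q \<noteq> 0" using m \<open>k = 0\<close> unfolding is_minpoly_def mq by auto
      ultimately have "Polynomial.degree m \<le> Polynomial.degree q" using dvd_imp_degree_le by blast
      then show False using \<open>q \<noteq> 0\<close> by (simp add: mq)
    qed
    have "y * ev q y = - to_ac k" using is_minpoly_ev[OF m] unfolding mq by (simp add: eq_neg_iff_add_eq_0 add.commute)
    then have "inverse y = - (inverse (to_ac k) * ev q y)"
      using False \<open>k \<noteq> 0\<close> by (simp add: field_simps)
    also have "\<dots> = ev (pcompose (Polynomial.smult (- inverse k) q) p) x" by (simp add: y)
    finally show ?thesis using ev_in_simple_ext by metis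
  qed (use \<open>0 \<in> simple_ext x\<close> in simp)
  fix z assume "z \<in> simple_ext x"
  then obtain q where z: "z = ev q x" unfolding simple_ext_def by blast
  show "y + z \<in> simple_ext x" using ev_in_simple_ext[of "p + q" x] y z by simp
  show "y * z \<in> simple_ext x" using ev_in_simple_ext[of "p * q" x] y z by simp
qed

lemma simple_ext_least:
  assumes "field_set E" "range to_ac \<subseteq> E" "x \<in> E"
  shows "simple_ext x \<subseteq> E"
proof -
  interpret field_set E by fact
  show ?thesis unfolding simple_ext_def ev_altdef using assms(2,3) by (auto intro!: closed)
qed

text \<open>A nonzero annihilator of least degree divides all others. Division proceeds one leading
  term at a time, so that every remainder visibly keeps its coefficients in
  \<open>L\<close>.\<close>

lemma (in field_set) minpoly_over_subfield:
  assumes "g \<noteq> 0" "\<And>i. Polynomial.coeff g i \<in> L" "poly g b = 0"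
  obtains h where "h \<noteq> 0" "\<And>i. Polynomial.coeff h i \<in> L" "poly h b = 0"
    "\<And>q. (\<And>i. Polynomial.coeff q i \<in> L) \<Longrightarrow> poly q b = 0 \<Longrightarrow> h dvd q"
proof -
  let ?P = "\<lambda>q. q \<noteq> 0 \<and> (\<forall>i. Polynomial.coeff q i \<in> L) \<and> poly q b = 0"
  obtain h where h: "?P h" and least: "\<And>q. ?P q \<Longrightarrow> Polynomial.degree h \<le> Polynomial.degree q"
    using ex_has_least_nat[of ?P g Polynomial.degree] assms by blast
  have "h dvd q" if "\<And>i. Polynomial.coeff q i \<in> L" "poly q b = 0" for q
    using that
  proof (induction "Polynomial.degree q" arbitrary: q rule: less_induct)
    case less
    show ?case
    proof (cases "q = 0")
      case False
      then have le: "Polynomial.degree h \<le> Polynomial.degree q" using least less.prems by blast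
      define c where "c = Polynomial.lead_coeff q / Polynomial.lead_coeff h"
      define r where "r = Polynomial.monom c (Polynomial.degree q - Polynomial.degree h)"
      have c: "c \<in> L" "c \<noteq> 0" unfolding c_def using less.prems(1) h False by (auto intro: closed)
      have "h dvd q - r * h"
      proof (cases "Polynomial.degree q = 0")
        \<comment> \<open>The degree cannot drop here, but a constant that vanishes at
          \<open>b\<close> is zero.\<close>
        case True
        then have "q = 0" using less.prems(2) by (metis degree_0_id poly_const_conv poly_0 pCons_0_0)
        with False show ?thesis by simp
      next
        case dq: False
        have deg_rh: "Polynomial.degree (r * h) = Polynomial.degree q"
          unfolding r_def using c h le by (subst degree_mult_eq) (auto simp: degree_monom_eq)
        have "Polynomial.lead_coeff r = c" unfolding r_def using c(2) by (simp add: degree_monom_eq)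
        then have "Polynomial.lead_coeff (r * h) = Polynomial.lead_coeff q"
          unfolding lead_coeff_mult using h by (simp add: c_def)
        then have coeff0: "Polynomial.coeff (q - r * h) (Polynomial.degree q) = 0" using deg_rh by simp
        have "Polynomial.degree (q - r * h) < Polynomial.degree q"
        proof (rule degree_lessI)
          show "\<forall>k\<ge>Polynomial.degree q. Polynomial.coeff (q - r * h) k = 0"
            using coeff0 deg_rh by (metis coeff_diff coeff_eq_0 diff_zero le_neq_implies_less)
        qed (use dq in simp)
        moreover have "Polynomial.coeff (q - r * h) i \<in> L" for i
          using less.prems(1) h c(1) by (auto simp: r_def coeff_monom_mult intro!: closed)
        moreover have "poly (q - r * h) b = 0" using less.prems(2) h by simp
        ultimately show ?thesis by (rule less.hyps)
      qed
      then show ?thesis by (metis diff_add_cancel dvd_add dvd_triv_right)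
    qed simp
  qed
  then show ?thesis using that[of h] h by blast
qed

lemma (in field_set) coeff_pcompose_in:
  assumes "\<And>i. Polynomial.coeff p i \<in> L" "\<And>i. Polynomial.coeff q i \<in> L"
  shows "Polynomial.coeff (pcompose p q) i \<in> L"
  using assms(1)
proof (induction p arbitrary: i)
  case (pCons a p)
  have a: "a \<in> L" using pCons.prems[of 0] by simp
  have "Polynomial.coeff p i \<in> L" for i using pCons.prems[of "Suc i"] by simp
  then have IH: "\<And>i. Polynomial.coeff (pcompose p q) i \<in> L" using pCons.IH by blast
  have "Polynomial.coeff [:a:] i \<in> L" using a zero_in by (cases i) auto
  then show ?case using IH assms(2) by (auto simp: pcompose_pCons coeff_mult simp del: coeff_pCons_0 intro!: closed)
qed (simp add: zero_in)

text \<open>With t = a + n b, the minimal polynomial \<open>h\<close> of \<open>b\<close> over K(t)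
  divides both \<open>g\<close> and f(t - n X). For all but finitely many \<open>n\<close> these
  have only the root \<open>b\<close> in common, and \<open>b\<close> is a simple root of
  \<open>g\<close>, so \<open>h\<close> is linear and its coefficients give
  \<open>b\<close>.\<close>

lemma primitive_element_two:
  fixes a b :: "'k::field_char_0 alg_closure"
  shows "\<exists>n::nat. a \<in> simple_ext (a + of_nat n * b) \<and> b \<in> simple_ext (a + of_nat n * b)"
proof -
  obtain f where f: "is_minpoly f a" using minpoly_exists by blast
  obtain g where g: "is_minpoly g b" using minpoly_exists by blast
  let ?f = "map_poly to_ac f" and ?g = "map_poly to_ac g"
  have fg0: "?f \<noteq> 0" "?g \<noteq> 0"
    using f g unfolding is_minpoly_def by (simp_all add: map_poly_eq_0_iff)
  \<comment> \<open>The finitely many \<open>n\<close> to avoid: those for which t - n y is a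
    conjugate \<open>x\<close> of \<open>a\<close>, with \<open>y\<close> a conjugate of
    \<open>b\<close> other than \<open>b\<close>. The pairs with y = b only add the value 0.\<close>
  define B where "B = (\<lambda>(x, y). (x - a) / (b - y)) ` ({x. poly ?f x = 0} \<times> {y. poly ?g y = 0})"
  have "finite B" unfolding B_def using fg0 poly_roots_finite by blast
  then have "finite (of_nat -` B :: nat set)" by (intro finite_vimageI) (auto simp: inj_on_def)
  then obtain n :: nat where n: "of_nat n \<notin> B" using ex_new_if_finite[of "of_nat -` B :: nat set"] by auto
  define t where "t = a + of_nat n * b"
  interpret E: field_set "simple_ext t" by (rule field_set_simple_ext)
  have coeffs: "Polynomial.coeff (map_poly to_ac p) i \<in> simple_ext t" for p :: "'k poly" and i
    by (simp add: coeff_map_poly to_ac_in_simple_ext)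
  obtain h where h: "h \<noteq> 0" "\<And>i. Polynomial.coeff h i \<in> simple_ext t" "poly h b = 0"
    "\<And>q. (\<And>i. Polynomial.coeff q i \<in> simple_ext t) \<Longrightarrow> poly q b = 0 \<Longrightarrow> h dvd q"
    using E.minpoly_over_subfield[of ?g b] fg0 coeffs is_minpoly_ev[OF g] unfolding ev_def by metis
  have hg: "h dvd ?g" using h(4)[of ?g] coeffs is_minpoly_ev[OF g] unfolding ev_def by blast
  have hf: "h dvd pcompose ?f [:t, - of_nat n:]"
  proof (rule h(4))
    have "Polynomial.coeff [:t, - of_nat n:] i \<in> simple_ext t" for i
      by (auto simp: coeff_pCons gen_in_simple_ext split: nat.split intro!: E.closed)
    then show "Polynomial.coeff (pcompose ?f [:t, - of_nat n:]) i \<in> simple_ext t" for i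
      using coeffs by (rule E.coeff_pcompose_in[rotated])
    show "poly (pcompose ?f [:t, - of_nat n:]) b = 0"
      using is_minpoly_ev[OF f] by (simp add: poly_pcompose t_def ev_def algebra_simps)
  qed
  have root: "y = b" if y: "poly h y = 0" for y
  proof (rule ccontr)
    assume "y \<noteq> b"
    have "poly ?g y = 0" using hg y by (metis dvdE mult_zero_left poly_mult)
    moreover have "poly (pcompose ?f [:t, - of_nat n:]) y = 0"
      using hf y by (metis dvdE mult_zero_left poly_mult)
    then have "poly ?f (t - of_nat n * y) = 0" by (simp add: poly_pcompose mult.commute)
    ultimately have "((t - of_nat n * y) - a) / (b - y) \<in> B"
      unfolding B_def by (intro image_eqI[of _ _ "(t - of_nat n * y, y)"]) auto
    moreover have "((t - of_nat n * y) - a) / (b - y) = of_nat n"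
      using \<open>y \<noteq> b\<close> by (simp add: t_def divide_simps) (simp add: algebra_simps)
    ultimately show False using n by simp
  qed
  obtain h1 where h1: "h = [:- b, 1:] * h1" using h(3) by (meson dvdE poly_eq_0_iff_dvd)
  have "Polynomial.degree h1 = 0"
  proof (rule ccontr)
    assume "Polynomial.degree h1 \<noteq> 0"
    then obtain y where "poly h1 y = 0" using alg_closed_imp_poly_has_root by auto
    then have "poly h1 b = 0" using root[of y] h1 by simp
    then obtain h2 where "h1 = [:- b, 1:] * h2" by (meson dvdE poly_eq_0_iff_dvd)
    then obtain u where "?g = [:- b, 1:] * ([:- b, 1:] * u)" using hg h1 by (metis dvdE mult.assoc)
    then have "poly (pderiv ?g) b = 0" by (simp only: pderiv_mult) simp
    then show False
      using is_minpoly_separable[OF g is_minpoly_ev[OF g]] by (simp add: ev_def map_poly_to_ac_pderiv)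
  qed
  then obtain c where c: "h1 = [:c:]" using degree_eq_zeroE by blast
  have c0: "c \<noteq> 0" using h(1) h1 c by auto
  have "c \<in> simple_ext t" using h(2)[of 1] by (simp add: h1 c)
  moreover have "- (b * c) \<in> simple_ext t" using h(2)[of 0] by (simp add: h1 c mult.commute)
  ultimately have "- (- (b * c)) / c \<in> simple_ext t" by (metis E.divide_in E.uminus_in)
  then have b: "b \<in> simple_ext t" using c0 by simp
  have "t - of_nat n * b \<in> simple_ext t" using b gen_in_simple_ext[of t] by (simp add: E.closed)
  then have "a \<in> simple_ext t" by (simp add: t_def)
  with b show ?thesis unfolding t_def by blast
qed

lemma primitive_element:
  fixes S :: "'k::field_char_0 alg_closure set"
  assumes "finite S" "field_set E" "S \<subseteq> E"
  shows "\<exists>t\<in>E. S \<subseteq> simple_ext t"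
  using assms(1,3)
proof (induction S)
  case empty
  show ?case using field_set.zero_in[OF assms(2)] by blast
next
  case (insert b S)
  then obtain a where a: "a \<in> E" "S \<subseteq> simple_ext a" by blast
  obtain n :: nat where n: "a \<in> simple_ext (a + of_nat n * b)" "b \<in> simple_ext (a + of_nat n * b)"
    using primitive_element_two by blast
  have "simple_ext a \<subseteq> simple_ext (a + of_nat n * b)"
    using n(1) by (intro simple_ext_least field_set_simple_ext) (auto intro: to_ac_in_simple_ext)
  moreover have "a + of_nat n * b \<in> E"
    using a(1) insert.prems field_set.closed[OF assms(2)] by simp
  ultimately show ?case using a(2) n(2) by blast
qed

subsection \<open>The Galois group of the root field\<close>

lemma ring_of_type_algebra_inverse:
  fixes h :: "'a::field" assumes "h \<noteq> 0"
  shows "inv\<^bsub>ring_of_type_algebra\<^esub> h = inverse h"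
proof -
  interpret field "ring_of_type_algebra :: 'a ring" by (rule field_from_type_algebra)
  show ?thesis
    using assms by (intro comm_inv_char) (auto simp: ring_of_type_algebra_def)
qed

lemma ring_of_type_algebra_uminus:
  fixes h :: "'a::field"
  shows "\<ominus>\<^bsub>ring_of_type_algebra\<^esub> h = - h"
proof -
  interpret field "ring_of_type_algebra :: 'a ring" by (rule field_from_type_algebra)
  show ?thesis by (rule minus_equality) (auto simp: ring_of_type_algebra_def)
qed

lemma field_set_generate_field:
  "field_set (generate_field (ring_of_type_algebra :: 'a::field ring) H)"
proof -
  let ?R = "ring_of_type_algebra :: 'a ring"
  have one: "1 \<in> generate_field ?R H"
    using generate_field.one[of ?R H] by (simp add: ring_of_type_algebra_def)
  have um: "x \<in> generate_field ?R H \<Longrightarrow> - x \<in> generate_field ?R H" for x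
    using generate_field.a_inv[of x ?R H] by (simp add: ring_of_type_algebra_uminus)
  have add: "x \<in> generate_field ?R H \<Longrightarrow> y \<in> generate_field ?R H \<Longrightarrow> x + y \<in> generate_field ?R H" for x y
    using generate_field.eng_add[of x ?R H y] by (simp add: ring_of_type_algebra_def)
  have zero: "0 \<in> generate_field ?R H" using add[OF one um[OF one]] by simp
  show ?thesis
  proof
    fix x assume x: "x \<in> generate_field ?R H"
    then show "inverse x \<in> generate_field ?R H"
      using generate_field.m_inv[of x ?R H] zero
      by (cases "x = 0") (auto simp: ring_of_type_algebra_inverse, simp add: ring_of_type_algebra_def)
    fix y assume "y \<in> generate_field ?R H"
    then show "x * y \<in> generate_field ?R H"
      using x generate_field.eng_mult[of x ?R H y] by (simp add: ring_of_type_algebra_def)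
  qed (auto intro: one um add zero)
qed

lemma generate_field_least:
  assumes "field_set E" "H \<subseteq> E"
  shows "generate_field (ring_of_type_algebra :: 'a::field ring) H \<subseteq> E"
proof
  interpret field_set E by fact
  fix x assume "x \<in> generate_field (ring_of_type_algebra :: 'a ring) H"
  then show "x \<in> E"
  proof (induction rule: generate_field.induct)
    case (m_inv h)
    then show ?case
      by (cases "h = 0") (auto simp: ring_of_type_algebra_inverse closed, auto simp: ring_of_type_algebra_def)
  qed (use assms(2) in \<open>auto simp: ring_of_type_algebra_uminus intro: closed\<close>,
      auto simp: ring_of_type_algebra_def intro: closed)
qed

lemma field_set_root_field: "field_set (root_field f)"
  unfolding root_field_def by (rule field_set_generate_field)

lemma to_ac_in_root_field: "range to_ac \<subseteq> root_field f"
  unfolding root_field_def by (auto intro: generate_field.incl)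

lemma roots_in_root_field: "ac_roots f \<subseteq> root_field f"
  unfolding root_field_def by (auto intro: generate_field.incl)

lemma root_field_least:
  "field_set E \<Longrightarrow> range to_ac \<subseteq> E \<Longrightarrow> ac_roots f \<subseteq> E \<Longrightarrow> root_field f \<subseteq> E"
  unfolding root_field_def by (rule generate_field_least) auto

lemma ac_roots_ev: "ac_roots f = {x. ev f x = 0}"
  unfolding ac_roots_def ev_def ..

lemma finite_ac_roots: "f \<noteq> 0 \<Longrightarrow> finite (ac_roots f)"
  unfolding ac_roots_def by (intro poly_roots_finite) (simp add: map_poly_eq_0_iff)

lemma root_field_simple:
  fixes f :: "'k::field_char_0 poly"
  assumes "f \<noteq> 0"
  obtains t where "root_field f = simple_ext t"
proof -
  obtain t where t: "t \<in> root_field f" "ac_roots f \<subseteq> simple_ext t"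
    using primitive_element[OF finite_ac_roots[OF assms] field_set_root_field roots_in_root_field]
    by blast
  have "simple_ext t \<subseteq> root_field f"
    by (intro simple_ext_least field_set_root_field to_ac_in_root_field t(1))
  moreover have "root_field f \<subseteq> simple_ext t"
    using t(2) by (intro root_field_least field_set_simple_ext) (auto intro: to_ac_in_simple_ext)
  ultimately show ?thesis using that by blast
qed

lemma galois_group_carrier:
  "\<sigma> \<in> carrier (galois_group K L) \<longleftrightarrow> \<sigma> \<in> Bij L \<and>
     (\<forall>x\<in>L. \<forall>y\<in>L. \<sigma> (x + y) = \<sigma> x + \<sigma> y \<and> \<sigma> (x * y) = \<sigma> x * \<sigma> y) \<and> (\<forall>x\<in>K. \<sigma> x = x)"
  unfolding galois_group_def by simp

lemma galois_group_one: "\<one>\<^bsub>galois_group K L\<^esub> = (\<lambda>x\<in>L. x)"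
  unfolding galois_group_def BijGroup_def by simp

lemma galois_group_mult:
  "\<sigma> \<in> Bij L \<Longrightarrow> \<tau> \<in> Bij L \<Longrightarrow> \<sigma> \<otimes>\<^bsub>galois_group K L\<^esub> \<tau> = compose L \<sigma> \<tau>"
  unfolding galois_group_def BijGroup_def by simp

lemma (in field_set) group_galois_group:
  assumes "K \<subseteq> L"
  shows "group (galois_group K L)"
proof -
  interpret B: group "BijGroup L" by (rule group_BijGroup)
  let ?C = "carrier (galois_group K L)"
  have "subgroup ?C (BijGroup L)"
  proof (rule B.subgroupI)
    show "?C \<subseteq> carrier (BijGroup L)" by (auto simp: galois_group_carrier BijGroup_def)
    have "(\<lambda>x\<in>L. x) \<in> ?C" using assms by (auto simp: galois_group_carrier id_Bij closed)
    then show "?C \<noteq> {}" by blast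
    fix \<sigma> assume s: "\<sigma> \<in> ?C"
    then have sB: "\<sigma> \<in> Bij L" by (simp add: galois_group_carrier)
    have maps: "\<sigma> x \<in> L" if "x \<in> L" for x using sB that Bij_imp_funcset by blast
    have inv: "inv_into L \<sigma> (\<sigma> x) = x" if "x \<in> L" for x
      using sB that by (auto simp: Bij_def bij_betw_def)
    have inv': "\<sigma> (inv_into L \<sigma> x) = x" "inv_into L \<sigma> x \<in> L" if "x \<in> L" for x
      using sB that by (auto simp: Bij_def bij_betw_def f_inv_into_f inv_into_into)
    have "inv_into L \<sigma> (x + y) = inv_into L \<sigma> x + inv_into L \<sigma> y"
         "inv_into L \<sigma> (x * y) = inv_into L \<sigma> x * inv_into L \<sigma> y" if "x \<in> L" "y \<in> L" for x y
    proof -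
      have "\<sigma> (inv_into L \<sigma> x + inv_into L \<sigma> y) = x + y"
        "\<sigma> (inv_into L \<sigma> x * inv_into L \<sigma> y) = x * y"
        using s that inv' by (auto simp: galois_group_carrier)
      then show "inv_into L \<sigma> (x + y) = inv_into L \<sigma> x + inv_into L \<sigma> y"
         "inv_into L \<sigma> (x * y) = inv_into L \<sigma> x * inv_into L \<sigma> y"
        using inv inv'(2) that closed by metis+
    qed
    moreover have "inv_into L \<sigma> x = x" if "x \<in> K" for x
      using s that inv[of x] assms by (auto simp: galois_group_carrier)
    ultimately show "inv\<^bsub>BijGroup L\<^esub> \<sigma> \<in> ?C"
      using assms sB closed by (auto simp: inv_BijGroup galois_group_carrier restrict_inv_into_Bij subset_iff)
    fix \<tau> assume t: "\<tau> \<in> ?C"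
    then have tB: "\<tau> \<in> Bij L" by (simp add: galois_group_carrier)
    have maps': "\<tau> x \<in> L" if "x \<in> L" for x using tB that Bij_imp_funcset by blast
    show "\<sigma> \<otimes>\<^bsub>BijGroup L\<^esub> \<tau> \<in> ?C"
      using s t sB tB assms maps' closed
      by (auto simp: BijGroup_def galois_group_carrier compose_Bij compose_eq subset_iff)
  qed
  from B.subgroup_imp_group[OF this] show ?thesis by (simp add: galois_group_def)
qed

lemma galois_ev:
  assumes "\<sigma> \<in> carrier (galois_group (range to_ac) L)" "field_set L" "range to_ac \<subseteq> L" "x \<in> L"
  shows "\<sigma> (ev p x) = ev p (\<sigma> x)"
proof (induction p)
  case 0
  have "\<sigma> (to_ac 0) = to_ac 0" using assms(1) unfolding galois_group_carrier by blast
  then show ?case by simp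
next
  case (pCons k p)
  have "ev p x \<in> L" using simple_ext_least[OF assms(2-4)] ev_in_simple_ext by blast
  moreover have "x * ev p x \<in> L" using assms(2,4) calculation field_set.mult_in by blast
  moreover have "to_ac k \<in> L" using assms(3) by blast
  moreover have "\<sigma> (to_ac k) = to_ac k" using assms(1) unfolding galois_group_carrier by blast
  ultimately show ?case using assms(1,4) pCons.IH unfolding galois_group_carrier by simp
qed

lemma galois_roots:
  assumes "f \<noteq> 0" "\<sigma> \<in> carrier (galois_group (range to_ac) (root_field f))"
  shows "\<sigma> ` ac_roots f = ac_roots f"
proof (rule card_subset_eq)
  show "finite (ac_roots f)" using assms(1) by (rule finite_ac_roots)
  show "\<sigma> ` ac_roots f \<subseteq> ac_roots f"
  proof safe
    fix r assume r: "r \<in> ac_roots f"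
    then have "r \<in> root_field f" using roots_in_root_field by blast
    then have "ev f (\<sigma> r) = \<sigma> (ev f r)"
      using galois_ev[OF assms(2) field_set_root_field to_ac_in_root_field] by simp
    also have "\<dots> = \<sigma> (to_ac 0)" using r by (simp add: ac_roots_ev)
    also have "\<dots> = 0" using assms(2) unfolding galois_group_carrier by (metis rangeI to_ac_0)
    finally show "\<sigma> r \<in> ac_roots f" by (simp add: ac_roots_ev)
  qed
  have "inj_on \<sigma> (root_field f)"
    using assms(2) unfolding galois_group_carrier Bij_def by (auto simp: bij_betw_def)
  then show "card (\<sigma> ` ac_roots f) = card (ac_roots f)"
    using card_image[OF inj_on_subset[OF _ roots_in_root_field]] by blast
qed

text \<open>An element of the group is determined by its value at a primitive element, and this
  value is one of the finitely many roots of the minimal polynomial.\<close>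

lemma finite_galois_group:
  fixes f :: "'k::field_char_0 poly"
  assumes "f \<noteq> 0"
  shows "finite (carrier (galois_group (range to_ac) (root_field f)))"
proof -
  let ?L = "root_field f" and ?G = "carrier (galois_group (range to_ac) (root_field f))"
  obtain t where t: "?L = simple_ext t" using root_field_simple[OF assms] .
  obtain m where m: "is_minpoly m t" using minpoly_exists by blast
  have tL: "t \<in> ?L" unfolding t by (rule gen_in_simple_ext)
  note ev = galois_ev[OF _ field_set_root_field to_ac_in_root_field tL]
  have "(\<lambda>\<sigma>. \<sigma> t) ` ?G \<subseteq> {y. ev m y = 0}"
  proof safe
    fix \<sigma> assume s: "\<sigma> \<in> ?G"
    have "ev m (\<sigma> t) = \<sigma> (to_ac 0)" using ev[OF s, of m] is_minpoly_ev[OF m] by simp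
    then show "ev m (\<sigma> t) = 0" using s unfolding galois_group_carrier by (metis rangeI to_ac_0)
  qed
  moreover have "finite {y. ev m y = 0}"
    using finite_ac_roots[of m] m unfolding ac_roots_ev is_minpoly_def by blast
  ultimately have "finite ((\<lambda>\<sigma>. \<sigma> t) ` ?G)" using finite_subset by blast
  moreover have "inj_on (\<lambda>\<sigma>. \<sigma> t) ?G"
  proof (rule inj_onI)
    fix \<sigma> \<tau> assume st: "\<sigma> \<in> ?G" "\<tau> \<in> ?G" "\<sigma> t = \<tau> t"
    show "\<sigma> = \<tau>"
    proof (rule extensionalityI)
      show "\<sigma> \<in> extensional ?L" "\<tau> \<in> extensional ?L" using st unfolding galois_group_carrier Bij_def by auto
      fix x assume "x \<in> ?L"
      then obtain p where "x = ev p t" unfolding t simple_ext_def by blast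
      then show "\<sigma> x = \<tau> x" by (simp add: ev[OF st(1)] ev[OF st(2)] st(3))
    qed
  qed
  ultimately show ?thesis using finite_imageD by blast
qed

text \<open>Sending p(t) to p(t') is well defined and injective because \<open>t\<close> and
  \<open>t'\<close> have the same minimal polynomial. Normality makes it an automorphism of the root
  field: it permutes the roots of \<open>f\<close>, hence maps the field that they generate onto
  itself.\<close>

lemma galois_conjugate:
  fixes f :: "'k::field_char_0 poly"
  assumes f: "f \<noteq> 0" and t: "root_field f = simple_ext t" and m: "is_minpoly m t" and t': "ev m t' = 0"
  obtains \<sigma> where "\<sigma> \<in> carrier (galois_group (range to_ac) (root_field f))"
    "\<And>p. \<sigma> (ev p t) = ev p t'"
proof -
  let ?L = "root_field f"
  interpret L: field_set ?L by (rule field_set_root_field)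
  have m': "is_minpoly m t'" using is_minpoly_conjugate[OF m t'] .
  have eq_iff: "ev p t = ev q t \<longleftrightarrow> ev p t' = ev q t'" for p q
  proof -
    have "ev (p - q) t = 0 \<longleftrightarrow> ev (p - q) t' = 0" using m m' unfolding is_minpoly_def by blast
    then show ?thesis by simp
  qed
  \<comment> \<open>Any choice of polynomial gives the same value by \<open>eq_iff\<close>; the
    restriction makes the map extensional, as \<open>Bij\<close> demands.\<close>
  define \<sigma> where "\<sigma> = (\<lambda>x\<in>?L. ev (SOME p. ev p t = x) t')"
  have \<sigma>: "\<sigma> (ev p t) = ev p t'" for p
  proof -
    have "ev (SOME q. ev q t = ev p t) t = ev p t" by (rule someI_ex) blast
    then show ?thesis unfolding \<sigma>_def using eq_iff by (simp add: t ev_in_simple_ext)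
  qed
  have hom: "\<sigma> (x + y) = \<sigma> x + \<sigma> y \<and> \<sigma> (x * y) = \<sigma> x * \<sigma> y" if xy: "x \<in> ?L" "y \<in> ?L" for x y
  proof -
    obtain p q where "x = ev p t" "y = ev q t" using xy unfolding t simple_ext_def by blast
    then show ?thesis using \<sigma>[of p] \<sigma>[of q] \<sigma>[of "p + q"] \<sigma>[of "p * q"] by simp
  qed
  have K: "\<sigma> (to_ac k) = to_ac k" for k using \<sigma>[of "[:k:]"] by simp
  have um: "\<sigma> (- x) = - \<sigma> x" if "x \<in> ?L" for x
    using hom[of "- 1" x] that K[of "-1"] L.uminus_in[OF L.one_in] by simp
  have iv: "\<sigma> (inverse x) = inverse (\<sigma> x)" if "x \<in> ?L" for x
  proof (cases "x = 0")
    case False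
    then have "\<sigma> x * \<sigma> (inverse x) = 1" using hom[of x "inverse x"] that K[of 1] L.closed by simp
    then show ?thesis by (metis inverse_unique)
  qed (use K[of 0] in simp)
  have inj: "inj_on \<sigma> ?L"
  proof (rule inj_onI)
    fix x y assume xy: "x \<in> ?L" "y \<in> ?L" "\<sigma> x = \<sigma> y"
    obtain p q where "x = ev p t" "y = ev q t" using xy unfolding t simple_ext_def by blast
    then show "x = y" using \<sigma> eq_iff xy(3) by auto
  qed
  have roots_sub: "\<sigma> ` ac_roots f \<subseteq> ac_roots f"
  proof safe
    fix r assume r: "r \<in> ac_roots f"
    then obtain g where g: "r = ev g t" using roots_in_root_field[of f] unfolding t simple_ext_def by blast
    then have "ev (pcompose f g) t = ev 0 t" using r by (simp add: ac_roots_ev)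
    then have "ev (pcompose f g) t' = ev 0 t'" using eq_iff by blast
    then show "\<sigma> r \<in> ac_roots f" using \<sigma>[of g] g by (simp add: ac_roots_ev)
  qed
  have "\<sigma> ` ac_roots f = ac_roots f"
    using finite_ac_roots[OF f] roots_sub inj inj_on_subset[OF inj roots_in_root_field]
    by (simp add: card_image card_subset_eq)
  moreover have image: "\<sigma> ` ?L = simple_ext t'"
  proof -
    have "\<sigma> ` ?L = (\<lambda>p. \<sigma> (ev p t)) ` UNIV" unfolding t simple_ext_def by (simp add: image_image)
    then show ?thesis unfolding simple_ext_def by (simp add: \<sigma>)
  qed
  ultimately have "ac_roots f \<subseteq> simple_ext t'" using roots_in_root_field by blast
  then have sup: "?L \<subseteq> simple_ext t'"
    by (intro root_field_least field_set_simple_ext) (auto intro: to_ac_in_simple_ext)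
  \<comment> \<open>The part of \<open>?L\<close> that is mapped into \<open>?L\<close> is a
    subfield with all roots of \<open>f\<close>, hence everything. So the image lies in
    \<open>?L\<close>, and \<open>sup\<close> gives the other inclusion.\<close>
  have "?L \<subseteq> {x \<in> ?L. \<sigma> x \<in> ?L}"
  proof (rule root_field_least)
    show "field_set {x \<in> ?L. \<sigma> x \<in> ?L}"
      by unfold_locales (use hom um iv K[of 0] K[of 1] in \<open>auto simp: L.closed\<close>)
    show "range to_ac \<subseteq> {x \<in> ?L. \<sigma> x \<in> ?L}" using K to_ac_in_root_field by auto
    show "ac_roots f \<subseteq> {x \<in> ?L. \<sigma> x \<in> ?L}" using roots_sub roots_in_root_field by blast
  qed
  then have "\<sigma> ` ?L = ?L" using image sup by blast
  then have "\<sigma> \<in> Bij ?L" using inj unfolding Bij_def bij_betw_def by (simp add: \<sigma>_def)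
  then have "\<sigma> \<in> carrier (galois_group (range to_ac) ?L)"
    using hom K unfolding galois_group_carrier by blast
  then show ?thesis using \<sigma> that by blast
qed

text \<open>Writing a fixed element as \<open>p(t)\<close> with \<open>deg p < deg m\<close>, the polynomial \<open>p - p(t)\<close> vanishes at
  the \<open>deg m\<close> conjugates of the primitive element \<open>t\<close>.\<close>

lemma galois_fixed_field:
  fixes f :: "'k::field_char_0 poly"
  assumes f: "f \<noteq> 0" and x: "x \<in> root_field f"
    and fixed: "\<And>\<sigma>. \<sigma> \<in> carrier (galois_group (range to_ac) (root_field f)) \<Longrightarrow> \<sigma> x = x"
  shows "x \<in> range to_ac"
proof -
  obtain t where t: "root_field f = simple_ext t" using root_field_simple[OF f] .
  obtain m where m: "is_minpoly m t" using minpoly_exists by blast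
  obtain q where q: "x = ev q t" using x unfolding t simple_ext_def by blast
  define p where "p = q mod m"
  have "ev q t = ev (q div m) t * ev m t + ev p t"
    unfolding p_def by (metis div_mult_mod_eq ev_simps(3,4))
  then have p: "x = ev p t" using q is_minpoly_ev[OF m] by simp
  define P where "P = map_poly to_ac p - [:x:]"
  have "{y. ev m y = 0} \<subseteq> {y. poly P y = 0}"
  proof safe
    fix t' assume "ev m t' = 0"
    then obtain \<sigma> where \<sigma>: "\<sigma> \<in> carrier (galois_group (range to_ac) (root_field f))"
      "\<And>p. \<sigma> (ev p t) = ev p t'"
      using galois_conjugate[OF f t m] by blast
    then have "ev p t' = x" using fixed[OF \<sigma>(1)] p by metis
    then show "poly P t' = 0" unfolding P_def ev_def by simp
  qed
  have m0: "m \<noteq> 0" using m unfolding is_minpoly_def by blast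
  have "P = 0"
  proof (rule ccontr)
    assume "P \<noteq> 0"
    have "Polynomial.degree m \<le> card {y. poly P y = 0}"
      unfolding card_conjugates[OF m, symmetric]
      using \<open>{y. ev m y = 0} \<subseteq> {y. poly P y = 0}\<close> poly_roots_finite[OF \<open>P \<noteq> 0\<close>] by (rule card_mono[rotated])
    also have "\<dots> \<le> Polynomial.degree P" using \<open>P \<noteq> 0\<close> by (rule card_poly_roots_bound)
    also have "\<dots> \<le> Polynomial.degree p"
      unfolding P_def by (rule degree_diff_le) (simp_all add: degree_map_poly)
    finally have "Polynomial.degree m \<le> Polynomial.degree p" .
    then have "p = 0" using degree_mod_less[OF m0, of q] unfolding p_def by auto
    then have "P = 0" using p unfolding P_def by simp
    then show False using \<open>P \<noteq> 0\<close> by simp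
  qed
  then have "Polynomial.coeff (map_poly to_ac p) 0 = x" unfolding P_def by simp
  then show ?thesis by (auto simp: coeff_map_poly)
qed

subsection \<open>Local fields\<close>

lemma galois_field_endo:
  assumes "field_set L" "range to_ac \<subseteq> L" "\<sigma> \<in> carrier (galois_group (range to_ac) L)"
  shows "field_endo L \<sigma>"
proof -
  interpret field_set L by fact
  show ?thesis
  proof
    show "\<sigma> x \<in> L" if "x \<in> L" for x
      using assms(3) that Bij_imp_funcset unfolding galois_group_carrier by blast
    show "\<sigma> 1 = 1" using assms(3) unfolding galois_group_carrier by (metis rangeI to_ac_1)
  qed (use assms(3) in \<open>auto simp: galois_group_carrier\<close>)
qed

lemma (in field_set) galois_group_mult_apply:
  assumes "\<sigma> \<in> carrier (galois_group K L)" "\<tau> \<in> carrier (galois_group K L)" "x \<in> L"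
  shows "(\<sigma> \<otimes>\<^bsub>galois_group K L\<^esub> \<tau>) x = \<sigma> (\<tau> x)"
  using assms by (simp add: galois_group_carrier galois_group_mult compose_eq)

locale local_field =
  fixes p :: nat and w :: "'q::field_char_0 \<Rightarrow> rat" and \<iota> :: "'q \<Rightarrow> 'k::field_char_0"
    and v :: "'k alg_closure \<Rightarrow> rat" and f :: "'k poly"
  assumes p: "prime p" and Qp: "is_Qp p w" and ext: "finite_field_extension \<iota>"
    and norm_val: "normalised_valuation w \<iota> v" and f0: "f \<noteq> 0"
begin

definition K where "K = range (to_ac :: 'k \<Rightarrow> 'k alg_closure)"
definition L where "L = root_field f"
definition G where "G = galois_group K L"
definition I where "I = inertia_group v K L"

sublocale valued_field v
  using norm_val unfolding normalised_valuation_def by unfold_locales blast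

sublocale L: field_set L
  unfolding L_def by (rule field_set_root_field)

lemma K_L: "K \<subseteq> L"
  unfolding K_def L_def by (rule to_ac_in_root_field)

sublocale G: group G
  unfolding G_def by (rule L.group_galois_group[OF K_L])

lemma endo: "\<sigma> \<in> carrier G \<Longrightarrow> field_endo L \<sigma>"
  using galois_field_endo L.field_set_axioms K_L unfolding G_def K_def by blast

lemma G_mult: "\<sigma> \<in> carrier G \<Longrightarrow> \<tau> \<in> carrier G \<Longrightarrow> x \<in> L \<Longrightarrow> (\<sigma> \<otimes>\<^bsub>G\<^esub> \<tau>) x = \<sigma> (\<tau> x)"
  unfolding G_def by (rule L.galois_group_mult_apply)

lemma G_one: "x \<in> L \<Longrightarrow> \<one>\<^bsub>G\<^esub> x = x"
  unfolding G_def by (simp add: galois_group_one)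

lemma G_fixes: "\<sigma> \<in> carrier G \<Longrightarrow> x \<in> K \<Longrightarrow> \<sigma> x = x"
  unfolding G_def galois_group_carrier by blast

lemma finite_G: "finite (carrier G)"
  unfolding G_def K_def L_def using f0 by (rule finite_galois_group)

lemma v_K: "x \<in> K \<Longrightarrow> x \<noteq> 0 \<Longrightarrow> v x \<in> \<int>"
  using norm_val unfolding normalised_valuation_def K_def by auto

lemma v_K_surj: "\<exists>x\<in>K. x \<noteq> 0 \<and> v x = of_int k"
proof -
  have "of_int k \<in> (\<lambda>x. v (to_ac x)) ` (UNIV - {0})"
    using norm_val unfolding normalised_valuation_def by simp
  then show ?thesis unfolding K_def by auto
qed

lemma \<iota>_hom: "\<iota> (x + y) = \<iota> x + \<iota> y" "\<iota> (x * y) = \<iota> x * \<iota> y" "\<iota> 1 = 1"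
proof -
  have h: "\<iota> \<in> ring_hom ring_of_type_algebra ring_of_type_algebra"
    using ext unfolding finite_field_extension_def by blast
  show "\<iota> (x + y) = \<iota> x + \<iota> y" "\<iota> (x * y) = \<iota> x * \<iota> y" "\<iota> 1 = 1"
    using ring_hom_add[OF h, of x y] ring_hom_mult[OF h, of x y] ring_hom_one[OF h]
    by (simp_all add: ring_of_type_algebra_def)
qed

lemma scale: "\<exists>c>0. \<forall>x. x \<noteq> 0 \<longrightarrow> v (to_ac (\<iota> x)) = c * w x"
  using norm_val unfolding normalised_valuation_def by blast

text \<open>On the rationals \<open>v\<close> is a multiple of the p-adic valuation. Tameness enters
  the proof in this form: the order of inertia has value 0, so dividing by it preserves
  values.\<close>

lemma v_of_nat_prime_to_p:
  assumes "\<not> p dvd n" shows "v (of_nat n) = 0"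
proof -
  obtain c where c: "\<And>x. x \<noteq> 0 \<Longrightarrow> v (to_ac (\<iota> x)) = c * w x" using scale by blast
  have n: "n \<noteq> 0" using assms by (intro notI) simp
  have "\<iota> 0 = 0" by (metis \<iota>_hom(1) add_0 add_cancel_right_right)
  then have "\<iota> (of_nat n) = of_nat n" for n by (induction n) (auto simp: \<iota>_hom)
  then have "v (of_nat n) = c * w (of_rat (of_nat n))" using c[of "of_nat n"] n by simp
  also have "w (of_rat (of_nat n)) = of_int (padic_val_rat p (of_nat n))"
    using Qp n unfolding is_Qp_def by (metis of_nat_eq_0_iff)
  also have "quotient_of (of_nat n) = (int n, 1)" using quotient_of_int[of "int n"] by simp
  then have "padic_val_rat p (of_nat n) = 0"
    unfolding padic_val_rat_def using assms p
    by (simp add: not_dvd_imp_multiplicity_0 multiplicity_one)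
  finally show ?thesis by simp
qed

text \<open>K(x) has finite dimension over the p-adic field, so all powers of \<open>x\<close> lie
  in one finite-dimensional span and can be compared with their images.\<close>

lemma v_galois_le:
  assumes s: "\<sigma> \<in> carrier G" and x: "x \<in> L" "x \<noteq> 0"
  shows "v x \<le> v (\<sigma> x)"
proof -
  obtain c where c: "c > 0" "\<And>x. x \<noteq> 0 \<Longrightarrow> v (to_ac (\<iota> x)) = c * w x" using scale by blast
  interpret complete_base v w "\<lambda>x. to_ac (\<iota> x)" c
    using Qp c by unfold_locales (auto simp: \<iota>_hom is_Qp_def val_complete_def)
  interpret \<sigma>: field_endo L \<sigma> using endo[OF s] .
  obtain B where B: "finite B" "\<And>x. \<exists>a. x = (\<Sum>b\<in>B. \<iota> (a b) * b)"
    using ext unfolding finite_field_extension_def by blast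
  obtain m where m: "is_minpoly m x" using minpoly_exists by blast
  then have m0: "m \<noteq> 0" by (simp add: is_minpoly_def)
  \<comment> \<open>Products of elements spanning K over the base with powers of \<open>x\<close>;
    they span K(x) over the base.\<close>
  define S where "S = (\<lambda>(b, i). to_ac b * x ^ i) ` (B \<times> {..Polynomial.degree m})"
  have fin: "finite S" unfolding S_def using B(1) by blast
  have K_in: "to_ac k \<in> L" for k using K_L unfolding K_def by blast
  have S_L: "S \<subseteq> L" unfolding S_def using x(1) K_in by (auto intro!: L.closed)
  show ?thesis
  proof (rule embedding_val_ge[OF fin x(2)])
    show "\<sigma> x \<noteq> 0" using \<sigma>.nonzero x by blast
    show "\<sigma> (x ^ n) = \<sigma> x ^ n" for n using \<sigma>.power x(1) .
    show "\<sigma> (\<Sum>s\<in>S. to_ac (\<iota> (a s)) * s) = (\<Sum>s\<in>S. to_ac (\<iota> (a s)) * \<sigma> s)" for a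
    proof -
      have "\<sigma> (\<Sum>s\<in>S. to_ac (\<iota> (a s)) * s) = (\<Sum>s\<in>S. \<sigma> (to_ac (\<iota> (a s)) * s))"
        using S_L K_in by (intro \<sigma>.sum) (auto intro: L.closed)
      also have "\<dots> = (\<Sum>s\<in>S. to_ac (\<iota> (a s)) * \<sigma> s)"
        using S_L K_in G_fixes[OF s] by (intro sum.cong) (auto simp: \<sigma>.mult K_def)
      finally show ?thesis .
    qed
    show "x ^ n \<in> lincombs S" for n
    proof -
      define r where "r = Polynomial.monom 1 n mod m"
      have "ev (Polynomial.monom 1 n) x = ev (Polynomial.monom 1 n div m) x * ev m x + ev r x"
        unfolding r_def by (metis div_mult_mod_eq ev_simps(3,4))
      then have "x ^ n = ev r x" using is_minpoly_ev[OF m] by simp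
      also have "\<dots> = (\<Sum>i\<le>Polynomial.degree r. to_ac (Polynomial.coeff r i) * x ^ i)"
        by (rule ev_altdef)
      also have "\<dots> \<in> lincombs S"
      proof (rule lincombs_sum)
        fix i assume i: "i \<in> {..Polynomial.degree r}"
        have "Polynomial.degree r \<le> Polynomial.degree m"
          using degree_mod_less[OF m0, of "Polynomial.monom 1 n"] unfolding r_def by auto
        then have i': "i \<le> Polynomial.degree m" using i by simp
        obtain a where "Polynomial.coeff r i = (\<Sum>b\<in>B. \<iota> (a b) * b)" using B(2) by blast
        then have "to_ac (Polynomial.coeff r i) * x ^ i = (\<Sum>b\<in>B. to_ac (\<iota> (a b)) * (to_ac b * x ^ i))"
          by (simp add: to_ac_sum sum_distrib_right mult.assoc)
        also have "\<dots> \<in> lincombs S"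
          using i' by (intro lincombs_sum lincombs_gen[OF fin]) (auto simp: S_def)
        finally show "to_ac (Polynomial.coeff r i) * x ^ i \<in> lincombs S" .
      qed
      finally show ?thesis .
    qed
  qed
qed

text \<open>The inequality is applied to \<sigma> and to its inverse.\<close>

lemma v_galois:
  assumes s: "\<sigma> \<in> carrier G" and x: "x \<in> L" "x \<noteq> 0"
  shows "v (\<sigma> x) = v x"
proof -
  interpret \<sigma>: field_endo L \<sigma> using endo[OF s] .
  have "v (\<sigma> x) \<le> v ((inv\<^bsub>G\<^esub> \<sigma>) (\<sigma> x))"
    using s x \<sigma>.maps \<sigma>.nonzero by (intro v_galois_le) auto
  also have "(inv\<^bsub>G\<^esub> \<sigma>) (\<sigma> x) = x"
    using G_mult[of "inv\<^bsub>G\<^esub> \<sigma>" \<sigma> x] s x(1) G_one by simp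
  finally show ?thesis using v_galois_le[OF s x] by simp
qed

section \<open>The inertia subgroup and its fixed field\<close>

lemma carrier_I:
  "carrier I = {\<sigma> \<in> carrier G. \<forall>x\<in>L. integral x \<longrightarrow> infinitesimal (\<sigma> x - x)}"
  unfolding I_def inertia_group_def G_def by simp

lemma I_simps: "\<sigma> \<otimes>\<^bsub>I\<^esub> \<tau> = \<sigma> \<otimes>\<^bsub>G\<^esub> \<tau>" "\<one>\<^bsub>I\<^esub> = \<one>\<^bsub>G\<^esub>"
  unfolding I_def inertia_group_def G_def by simp_all

lemma integral_galois: "\<sigma> \<in> carrier G \<Longrightarrow> x \<in> L \<Longrightarrow> integral x \<Longrightarrow> integral (\<sigma> x)"
  using v_galois[of \<sigma> x] field_endo.zero[OF endo] unfolding val_ge_def by (cases "x = 0") auto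

lemma subgroup_I: "subgroup (carrier I) G"
proof (rule G.subgroupI)
  show "carrier I \<subseteq> carrier G" unfolding carrier_I by blast
  have "\<one>\<^bsub>G\<^esub> \<in> carrier I" unfolding carrier_I by (simp add: G_one)
  then show "carrier I \<noteq> {}" by blast
  fix \<sigma> assume s: "\<sigma> \<in> carrier I"
  then have sG: "\<sigma> \<in> carrier G" unfolding carrier_I by blast
  show "inv\<^bsub>G\<^esub> \<sigma> \<in> carrier I"
    unfolding carrier_I
  proof (intro CollectI conjI ballI impI)
    fix x assume x: "x \<in> L" "integral x"
    let ?y = "(inv\<^bsub>G\<^esub> \<sigma>) x"
    have "?y \<in> L" using field_endo.maps[OF endo] sG x by simp
    moreover have "integral ?y" using integral_galois sG x by simp
    ultimately have "infinitesimal (\<sigma> ?y - ?y)" using s unfolding carrier_I by blast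
    moreover have "\<sigma> ?y = x" using G_mult[of \<sigma> "inv\<^bsub>G\<^esub> \<sigma>" x] sG x(1) G_one by simp
    ultimately show "infinitesimal (?y - x)" using val_gt_minus_commute by simp
  qed (use sG in simp)
  fix \<tau> assume t: "\<tau> \<in> carrier I"
  then have tG: "\<tau> \<in> carrier G" unfolding carrier_I by blast
  show "\<sigma> \<otimes>\<^bsub>G\<^esub> \<tau> \<in> carrier I"
    unfolding carrier_I
  proof (intro CollectI conjI ballI impI)
    fix x assume x: "x \<in> L" "integral x"
    have "\<tau> x \<in> L" "integral (\<tau> x)" using field_endo.maps[OF endo] integral_galois tG x by auto
    then have "infinitesimal (\<sigma> (\<tau> x) - \<tau> x)" using s unfolding carrier_I by blast
    moreover have "infinitesimal (\<tau> x - x)" using t x unfolding carrier_I by blast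
    ultimately show "infinitesimal ((\<sigma> \<otimes>\<^bsub>G\<^esub> \<tau>) x - x)"
      using val_gt_diff_trans G_mult[OF sG tG x(1)] by simp
  qed (use sG tG in simp)
qed

lemma group_I: "group I"
proof -
  have "I = G\<lparr>carrier := carrier I\<rparr>" unfolding I_def inertia_group_def G_def by simp
  then show ?thesis using G.subgroup_imp_group[OF subgroup_I] by simp
qed

text \<open>The trace from \<open>L\<close> to \<open>K\<close> of \<open>N u\<close> has the same value as \<open>N\<close> for a suitable integral \<open>u\<close>,
  by independence of the characters \<open>u \<mapsto> \<sigma> u\<close> modulo the maximal ideal: those congruent to the
  identity form \<open>I\<close>, and contribute \<open>|I|\<close>, which is a unit.\<close>

lemma inertia_fixed_field_unramified:
  assumes tame: "\<not> p dvd card (carrier I)"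
    and N: "N \<in> L" "N \<noteq> 0" "\<And>\<sigma>. \<sigma> \<in> carrier I \<Longrightarrow> \<sigma> N = N"
  shows "v N \<in> \<int>"
proof -
  let ?U = "{u \<in> L. integral u}"
  have int: "integral (\<sigma> N / N)" if "\<sigma> \<in> carrier G" for \<sigma>
    using v_galois[OF that N(1,2)] field_endo.nonzero[OF endo[OF that] N(1,2)] N(2)
    by (simp add: val_ge_def v_divide)
  have "\<exists>u\<in>?U. \<not> infinitesimal (\<Sum>\<sigma>\<in>carrier G. \<sigma> N / N * \<sigma> u)"
  proof (rule ccontr)
    assume neg: "\<not> (\<exists>u\<in>?U. \<not> infinitesimal (\<Sum>\<sigma>\<in>carrier G. \<sigma> N / N * \<sigma> u))"
    let ?C = "{\<sigma> \<in> carrier G. \<forall>u\<in>?U. infinitesimal (\<sigma> u - \<one>\<^bsub>G\<^esub> u)}"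
    have "infinitesimal (\<Sum>\<sigma>\<in>?C. \<sigma> N / N)"
    proof (rule dedekind_independence[where U = ?U and \<chi> = "\<lambda>\<sigma>. \<sigma>"])
      show "infinitesimal (\<Sum>\<sigma>\<in>carrier G. \<sigma> N / N * \<sigma> u)" if "u \<in> ?U" for u using neg that by blast
      show "integral (\<sigma> u)" if "\<sigma> \<in> carrier G" "u \<in> ?U" for \<sigma> u
        using that integral_galois by blast
      show "\<sigma> (x * y) = \<sigma> x * \<sigma> y" if "\<sigma> \<in> carrier G" "x \<in> ?U" "y \<in> ?U" for \<sigma> x y
        using that field_endo.mult[OF endo] by blast
      show "\<sigma> 1 = 1" if "\<sigma> \<in> carrier G" for \<sigma> using field_endo.one[OF endo[OF that]] .
      show "x * y \<in> ?U" if "x \<in> ?U" "y \<in> ?U" for x y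
        using that L.mult_in integral_mult by blast
    qed (use finite_G int L.one_in in simp_all)
    also have "?C = carrier I" unfolding carrier_I using G_one by auto
    also have "(\<Sum>\<sigma>\<in>carrier I. \<sigma> N / N) = (\<Sum>\<sigma>\<in>carrier I. 1)"
      using N by (intro sum.cong) auto
    also have "\<dots> = of_nat (card (carrier I))" by simp
    finally have "infinitesimal (of_nat (card (carrier I)))" .
    moreover have "card (carrier I) \<noteq> 0" using tame by (intro notI) simp
    ultimately show False using v_of_nat_prime_to_p[OF tame] unfolding val_gt_def by auto
  qed
  then obtain u where u: "u \<in> L" "integral u"
    "\<not> infinitesimal (\<Sum>\<sigma>\<in>carrier G. \<sigma> N / N * \<sigma> u)" by blast
  define S where "S = (\<Sum>\<sigma>\<in>carrier G. \<sigma> N / N * \<sigma> u)"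
  have "integral S" unfolding S_def using int integral_galois u by (intro val_ge_sum integral_mult) auto
  then have S: "S \<noteq> 0" "v S = 0" using u(3) unfolding S_def[symmetric] val_ge_def val_gt_def by auto
  define T where "T = (\<Sum>\<sigma>\<in>carrier G. \<sigma> (N * u))"
  have NS: "N * S = T"
    unfolding S_def T_def sum_distrib_left using N u
    by (intro sum.cong) (auto simp: field_endo.mult[OF endo])
  have Nu: "N * u \<in> L" using N u L.closed by simp
  have "T \<in> L" unfolding T_def using Nu field_endo.maps[OF endo] by (intro L.closed) auto
  have "\<tau> T = T" if t: "\<tau> \<in> carrier G" for \<tau>
  proof -
    interpret \<tau>: field_endo L \<tau> using endo[OF t] .
    have "\<tau> T = (\<Sum>\<sigma>\<in>carrier G. \<tau> (\<sigma> (N * u)))"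
      unfolding T_def using Nu field_endo.maps[OF endo] by (intro \<tau>.sum) auto
    also have "\<dots> = (\<Sum>\<sigma>\<in>carrier G. (\<tau> \<otimes>\<^bsub>G\<^esub> \<sigma>) (N * u))"
      using t Nu by (intro sum.cong) (auto simp: G_mult)
    also have "\<dots> = (\<Sum>\<sigma>\<in>carrier G. \<sigma> (N * u))"
      using t by (intro sum.reindex_bij_betw[of "\<lambda>\<sigma>. \<tau> \<otimes>\<^bsub>G\<^esub> \<sigma>" "carrier G" "carrier G" "\<lambda>\<sigma>. \<sigma> (N * u)"])
        (auto simp: bij_betw_def G.inj_on_cmult G.surj_const_mult)
    finally show ?thesis unfolding T_def .
  qed
  then have "T \<in> K"
    using galois_fixed_field[OF f0] \<open>T \<in> L\<close> unfolding G_def K_def L_def by blast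
  moreover have "T \<noteq> 0" using NS N(2) S(1) by auto
  ultimately have "v T \<in> \<int>" using v_K by blast
  then show ?thesis using NS v_mult[OF N(2) S(1)] S(2) by simp
qed

end

subsection \<open>The tame character\<close>

lemma denom_pos: "denom q > 0"
  unfolding denom_def using quotient_of_denom_pos' by simp

text \<open>With q = a/b in lowest terms, \<open>b\<close> divides n a iff it divides n. Later
  divisibility between denominators is tested in this way.\<close>

lemma denom_dvd_iff: "denom q dvd n \<longleftrightarrow> of_nat n * q \<in> \<int>"
proof -
  obtain a b where ab: "quotient_of q = (a, b)" by fastforce
  have b: "b > 0" "coprime a b" using ab quotient_of_denom_pos quotient_of_coprime by blast+
  have q: "q = of_int a / of_int b" using quotient_of_div[OF ab] .
  have "denom q dvd n \<longleftrightarrow> b dvd int n" unfolding denom_def using ab b(1)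
    by (simp add: nat_dvd_iff)
  also have "\<dots> \<longleftrightarrow> b dvd int n * a" using b(2) by (simp add: coprime_commute coprime_dvd_mult_left_iff)
  also have "\<dots> \<longleftrightarrow> of_nat n * q \<in> \<int>"
  proof
    assume "b dvd int n * a"
    then obtain k where k: "int n * a = b * k" by blast
    have "of_nat n * q = of_int (int n * a) / of_int b" by (simp add: q)
    also have "\<dots> = of_int k" using b(1) by (simp add: k)
    finally show "of_nat n * q \<in> \<int>" by simp
  next
    assume "of_nat n * q \<in> \<int>"
    then obtain k where "of_nat n * q = of_int k" by (auto elim: Ints_cases)
    then have "(of_int (int n * a) :: rat) = of_int (b * k)" using b(1) by (simp add: q field_simps)
    then have "int n * a = b * k" by (simp only: of_int_eq_iff)
    then show "b dvd int n * a" by simp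
  qed
  finally show ?thesis .
qed

lemma denom_1 [simp]: "denom 1 = 1"
  unfolding denom_def by simp

text \<open>The fibres of \<open>f\<close> on \<open>H\<close> are the left cosets of
  \<open>S\<close>. In the applications \<open>f\<close> is an orbit map on elements, an orbit map
  on sets, or the residue class of the tame character.\<close>

lemma (in group) card_fibres:
  assumes fin: "finite H" and H: "subgroup H G" and S: "S \<subseteq> H"
    and eq: "\<And>g h. g \<in> H \<Longrightarrow> h \<in> H \<Longrightarrow> f g = f h \<longleftrightarrow> inv g \<otimes> h \<in> S"
  shows "card H = card (f ` H) * card S"
proof -
  interpret H: subgroup H G by fact
  have "card {h \<in> H. f h = y} = card S" if y: "y \<in> f ` H" for y
  proof -
    obtain g where g: "g \<in> H" "y = f g" using y by blast
    have "{h \<in> H. f h = f g} = (\<lambda>s. g \<otimes> s) ` S"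
    proof (intro equalityI subsetI)
      fix h assume "h \<in> {h \<in> H. f h = f g}"
      then have h: "h \<in> H" "f g = f h" by auto
      then have "inv g \<otimes> h \<in> S" using eq[OF g(1) h(1)] by blast
      moreover have "h = g \<otimes> (inv g \<otimes> h)" using g(1) h(1) by (simp add: m_assoc[symmetric])
      ultimately show "h \<in> (\<lambda>s. g \<otimes> s) ` S" by (rule image_eqI[rotated])
    next
      fix h assume "h \<in> (\<lambda>s. g \<otimes> s) ` S"
      then obtain s where s: "s \<in> S" "h = g \<otimes> s" by blast
      then have sH: "s \<in> H" using S by blast
      then have gs: "g \<otimes> s \<in> H" using g(1) by simp
      have "inv g \<otimes> (g \<otimes> s) = s" using g(1) sH by (simp add: m_assoc[symmetric])
      then have "f g = f (g \<otimes> s)" using eq[OF g(1) gs] s(1) by argo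
      then show "h \<in> {h \<in> H. f h = f g}" using gs s(2) by simp
    qed
    moreover have "inj_on (\<lambda>s. g \<otimes> s) S" using S g(1) H.subset by (intro inj_on_subset[OF inj_on_cmult]) auto
    ultimately show ?thesis by (simp add: card_image g(2))
  qed
  then have "(\<Sum>y\<in>f ` H. card {h \<in> H. f h = y}) = (\<Sum>y\<in>f ` H. card S)" by (intro sum.cong) auto
  then show ?thesis using sum.image_gen[OF fin, of "\<lambda>_. 1::nat" f] by simp
qed

context valued_field
begin

lemma v_prod: "finite A \<Longrightarrow> (\<And>i. i \<in> A \<Longrightarrow> f i \<noteq> 0) \<Longrightarrow> v (prod f A) = (\<Sum>i\<in>A. v (f i))"
  by (induction A rule: finite_induct) (auto simp: v_mult)

text \<open>For integral elements this is equality in the residue field.\<close>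

definition cong :: "'a \<Rightarrow> 'a \<Rightarrow> bool" (infix \<open>\<approx>\<close> 50) where
  "a \<approx> b \<longleftrightarrow> infinitesimal (a - b)"

lemma cong_refl [simp]: "a \<approx> a" unfolding cong_def by simp

lemma cong_sym: "a \<approx> b \<Longrightarrow> b \<approx> a" unfolding cong_def using val_gt_minus_commute by blast

lemma cong_trans [trans]: "a \<approx> b \<Longrightarrow> b \<approx> c \<Longrightarrow> a \<approx> c"
  unfolding cong_def by (rule val_gt_diff_trans)

text \<open>From a b - a' b' = a (b - b') + (a - a') b', which explains why integrality is asked of
  \<open>a\<close> and \<open>b'\<close>.\<close>

lemma cong_mult:
  assumes "a \<approx> a'" "b \<approx> b'" "integral a" "integral b'"
  shows "a * b \<approx> a' * b'"
proof -
  have "infinitesimal (a * (b - b') + (a - a') * b')"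
    using assms val_gt_mult_right[of a 0 "b - b'" 0] val_gt_mult_left[of "a - a'" 0 b' 0]
    unfolding cong_def by (intro val_gt_add) auto
  then show ?thesis unfolding cong_def by (simp add: algebra_simps)
qed

lemma cong_power: "a \<approx> b \<Longrightarrow> integral a \<Longrightarrow> integral b \<Longrightarrow> a ^ n \<approx> b ^ n"
  by (induction n) (simp_all add: cong_mult integral_power)

lemma cong_1_cancel:
  assumes "a * b \<approx> 1" "b \<approx> 1" "integral a" "integral b"
  shows "a \<approx> 1"
proof -
  have "a * b \<approx> a * 1" using assms by (intro cong_mult) auto
  then have "a \<approx> a * b" using cong_sym by simp
  then show ?thesis using assms(1) by (rule cong_trans)
qed

end

text \<open>What the argument takes from local fields and inertia. \<open>fixed_surj\<close> and
  \<open>unramified\<close> together say that the field fixed by \<open>I\<close> has value group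
  \<int>.\<close>

locale tame_inertia = valued_field v + field_set L for v :: "'a::field \<Rightarrow> rat" and L :: "'a set" +
  fixes I :: "('a \<Rightarrow> 'a) monoid"
  assumes group: "group I" and finite_I: "finite (carrier I)"
    and endo: "\<sigma> \<in> carrier I \<Longrightarrow> field_endo L \<sigma>"
    and I_mult: "\<sigma> \<in> carrier I \<Longrightarrow> \<tau> \<in> carrier I \<Longrightarrow> x \<in> L \<Longrightarrow> (\<sigma> \<otimes>\<^bsub>I\<^esub> \<tau>) x = \<sigma> (\<tau> x)"
    and I_one: "x \<in> L \<Longrightarrow> \<one>\<^bsub>I\<^esub> x = x"
    and I_ext: "\<sigma> \<in> carrier I \<Longrightarrow> \<tau> \<in> carrier I \<Longrightarrow> (\<And>x. x \<in> L \<Longrightarrow> \<sigma> x = \<tau> x) \<Longrightarrow> \<sigma> = \<tau>"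
    and inertia: "\<sigma> \<in> carrier I \<Longrightarrow> x \<in> L \<Longrightarrow> integral x \<Longrightarrow> infinitesimal (\<sigma> x - x)"
    and v_I: "\<sigma> \<in> carrier I \<Longrightarrow> x \<in> L \<Longrightarrow> x \<noteq> 0 \<Longrightarrow> v (\<sigma> x) = v x"
    and fixed_surj: "\<exists>x\<in>L. x \<noteq> 0 \<and> v x = of_int k \<and> (\<forall>\<sigma>\<in>carrier I. \<sigma> x = x)"
    and tame: "of_nat (card (carrier I)) \<noteq> (0::'a)" "v (of_nat (card (carrier I))) = 0"
    and unramified: "x \<in> L \<Longrightarrow> x \<noteq> 0 \<Longrightarrow> (\<And>\<sigma>. \<sigma> \<in> carrier I \<Longrightarrow> \<sigma> x = x) \<Longrightarrow> v x \<in> \<int>"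
begin

sublocale I: group I by (rule group)

abbreviation e :: nat where "e \<equiv> card (carrier I)"

lemma e_pos: "e > 0"
  using finite_I I.one_closed by (auto simp: card_gt_0_iff)

lemma maps: "\<sigma> \<in> carrier I \<Longrightarrow> x \<in> L \<Longrightarrow> \<sigma> x \<in> L"
  using field_endo.maps[OF endo] .

lemma nonzero: "\<sigma> \<in> carrier I \<Longrightarrow> x \<in> L \<Longrightarrow> x \<noteq> 0 \<Longrightarrow> \<sigma> x \<noteq> 0"
  using field_endo.nonzero[OF endo] .

lemma inv_apply: "\<sigma> \<in> carrier I \<Longrightarrow> x \<in> L \<Longrightarrow> (inv\<^bsub>I\<^esub> \<sigma>) (\<sigma> x) = x"
  "\<sigma> \<in> carrier I \<Longrightarrow> x \<in> L \<Longrightarrow> \<sigma> ((inv\<^bsub>I\<^esub> \<sigma>) x) = x"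
  using I_mult[of "inv\<^bsub>I\<^esub> \<sigma>" \<sigma> x] I_mult[of \<sigma> "inv\<^bsub>I\<^esub> \<sigma>" x] I_one by auto

lemma eq_iff_inv:
  assumes "\<sigma> \<in> carrier I" "\<tau> \<in> carrier I" "x \<in> L"
  shows "\<sigma> x = \<tau> x \<longleftrightarrow> (inv\<^bsub>I\<^esub> \<sigma> \<otimes>\<^bsub>I\<^esub> \<tau>) x = x"
proof -
  have "(inv\<^bsub>I\<^esub> \<sigma> \<otimes>\<^bsub>I\<^esub> \<tau>) x = (inv\<^bsub>I\<^esub> \<sigma>) (\<tau> x)" using assms by (simp add: I_mult)
  moreover have "\<sigma> ((inv\<^bsub>I\<^esub> \<sigma>) (\<tau> x)) = \<tau> x" "(inv\<^bsub>I\<^esub> \<sigma>) (\<sigma> x) = x"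
    using assms by (simp_all add: inv_apply maps)
  ultimately show ?thesis by auto
qed

lemma finite_subgroup: "subgroup H I \<Longrightarrow> finite H"
  using finite_subset[OF subgroup.subset finite_I] .

lemma card_subgroup_pos: "subgroup H I \<Longrightarrow> card H > 0"
  using finite_subgroup[of H] subgroup.one_closed[of H I] by (auto simp: card_gt_0_iff)

lemma card_subgroup_dvd:
  assumes "subgroup H I" "subgroup H' I" "H' \<subseteq> H" shows "card H' dvd card H"
proof -
  interpret H: group "I\<lparr>carrier := H\<rparr>" using I.subgroup_imp_group[OF assms(1)] .
  have "card (rcosets\<^bsub>I\<lparr>carrier := H\<rparr>\<^esub> H') * card H' = card H"
    using H.lagrange[OF I.subgroup_incl[OF assms(2,1,3)]] by (simp add: Coset.order_def)
  from this[symmetric] show ?thesis by simp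
qed

lemma index: "subgroup H I \<Longrightarrow> card (rcosets\<^bsub>I\<^esub> H) * card H = e"
  using I.lagrange unfolding Coset.order_def by blast

text \<open>The order of \<open>H\<close> divides that of \<open>I\<close>. Natural numbers have
  nonnegative values, and here two of them add up to 0. Averages over \<open>H\<close> therefore
  lose no value.\<close>

lemma tame_subgroup:
  assumes "subgroup H I"
  shows "of_nat (card H) \<noteq> (0::'a)" "v (of_nat (card H)) = 0"
proof -
  obtain k where k: "e = k * card H" using index[OF assms] by metis
  have eq: "(of_nat e :: 'a) = of_nat k * of_nat (card H)" by (simp add: k)
  then show nz: "of_nat (card H) \<noteq> (0::'a)" using tame(1) by auto
  have k0: "of_nat k \<noteq> (0::'a)" using eq tame(1) by auto
  have "v (of_nat k) \<ge> 0" "v (of_nat (card H)) \<ge> 0"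
    using integral_of_nat[of k] integral_of_nat[of "card H"] nz k0 unfolding val_ge_def by auto
  then show "v (of_nat (card H)) = 0" using v_mult[OF k0 nz] tame(2) eq by simp
qed

section \<open>The value group of L and the tame character\<close>

definition \<Gamma> :: "rat set" where "\<Gamma> = v ` (L - {0})"

lemma \<Gamma>I: "x \<in> L \<Longrightarrow> x \<noteq> 0 \<Longrightarrow> v x \<in> \<Gamma>" unfolding \<Gamma>_def by blast

lemma \<Gamma>E: assumes "d \<in> \<Gamma>" obtains x where "x \<in> L" "x \<noteq> 0" "v x = d"
  using assms unfolding \<Gamma>_def by blast

lemma \<Gamma>_add: "d \<in> \<Gamma> \<Longrightarrow> d' \<in> \<Gamma> \<Longrightarrow> d + d' \<in> \<Gamma>"
proof -
  assume "d \<in> \<Gamma>" "d' \<in> \<Gamma>"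
  then obtain x y where x: "x \<in> L" "x \<noteq> 0" "v x = d" and y: "y \<in> L" "y \<noteq> 0" "v y = d'"
    unfolding \<Gamma>_def by blast
  then show ?thesis using \<Gamma>I[of "x * y"] by (simp add: mult_in v_mult)
qed

lemma \<Gamma>_uminus: "d \<in> \<Gamma> \<Longrightarrow> - d \<in> \<Gamma>"
proof -
  assume "d \<in> \<Gamma>"
  then obtain x where x: "x \<in> L" "x \<noteq> 0" "v x = d" by (rule \<Gamma>E)
  then show ?thesis using \<Gamma>I[of "inverse x"] by (simp add: inverse_in v_inverse)
qed

lemma \<Gamma>_int: "of_int k \<in> \<Gamma>"
  using fixed_surj[of k] unfolding \<Gamma>_def by force

lemma \<Gamma>_nat_mult: "d \<in> \<Gamma> \<Longrightarrow> of_nat n * d \<in> \<Gamma>"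
proof (induction n)
  case 0
  show ?case using \<Gamma>_int[of 0] by simp
next
  case (Suc n)
  then show ?case using \<Gamma>_add[of "of_nat n * d" d] by (simp add: algebra_simps)
qed

text \<open>The tame character: the class of \<open>\<sigma> x / x\<close> modulo the maximal ideal depends only on \<open>\<sigma>\<close> and
  \<open>v x\<close>, because \<open>\<sigma>\<close> acts trivially on the residue classes of units.\<close>

definition \<theta> :: "('a \<Rightarrow> 'a) \<Rightarrow> rat \<Rightarrow> 'a" where
  "\<theta> \<sigma> d = (let x = SOME x. x \<in> L \<and> x \<noteq> 0 \<and> v x = d in \<sigma> x / x)"

lemma quotient_integral:
  assumes "\<sigma> \<in> carrier I" "x \<in> L" "x \<noteq> 0" shows "integral (\<sigma> x / x)"
  using assms v_I[OF assms] nonzero[OF assms] unfolding val_ge_def by (simp add: v_divide)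

lemma quotient_cong:
  assumes s: "\<sigma> \<in> carrier I" and x: "x \<in> L" "x \<noteq> 0" and y: "y \<in> L" "y \<noteq> 0" and "v x = v y"
  shows "\<sigma> x / x \<approx> \<sigma> y / y"
proof -
  interpret \<sigma>: field_endo L \<sigma> using endo[OF s] .
  define u where "u = x / y"
  have u: "u \<in> L" "u \<noteq> 0" "v u = 0" unfolding u_def using x y assms(6) by (auto simp: v_divide divide_in)
  have "infinitesimal (\<sigma> u - u)" using inertia[OF s u(1)] u(3) by (simp add: val_ge_def)
  then have "infinitesimal (u * (\<sigma> u / u - 1))" using u(2) by (simp add: algebra_simps)
  then have "\<sigma> u / u \<approx> 1" using u unfolding cong_def by (simp add: val_gt_mult_unit)
  then have "\<sigma> u / u * (\<sigma> y / y) \<approx> 1 * (\<sigma> y / y)"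
    using u y s by (intro cong_mult quotient_integral) auto
  moreover have "\<sigma> u / u * (\<sigma> y / y) = \<sigma> x / x"
    unfolding u_def using x y \<sigma>.nonzero[OF y] by (simp add: \<sigma>.divide field_simps)
  ultimately show ?thesis by simp
qed

lemma \<theta>_cong:
  assumes "\<sigma> \<in> carrier I" "x \<in> L" "x \<noteq> 0" "v x = d"
  shows "\<theta> \<sigma> d \<approx> \<sigma> x / x"
proof -
  let ?P = "\<lambda>y. y \<in> L \<and> y \<noteq> 0 \<and> v y = d"
  have "?P (SOME y. ?P y)" using someI[of ?P x] assms by blast
  then show ?thesis unfolding \<theta>_def Let_def using assms by (intro quotient_cong) auto
qed

lemma \<theta>_integral:
  assumes "\<sigma> \<in> carrier I" "d \<in> \<Gamma>" shows "integral (\<theta> \<sigma> d)"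
proof -
  let ?P = "\<lambda>y. y \<in> L \<and> y \<noteq> 0 \<and> v y = d"
  obtain x where "?P x" using \<Gamma>E[OF assms(2)] by blast
  then have "?P (SOME y. ?P y)" by (rule someI)
  then show ?thesis unfolding \<theta>_def Let_def using assms by (intro quotient_integral) auto
qed

text \<open>Triviality of the character becomes a bound on a displacement, free of the choice in
  \<open>\<theta>\<close>; this links the character to the motion of roots.\<close>

lemma \<theta>_cong_1_iff:
  assumes "\<sigma> \<in> carrier I" "x \<in> L" "x \<noteq> 0" "v x = d"
  shows "\<theta> \<sigma> d \<approx> 1 \<longleftrightarrow> val_gt v (\<sigma> x - x) d"
proof -
  have "\<theta> \<sigma> d \<approx> 1 \<longleftrightarrow> \<sigma> x / x \<approx> 1" using \<theta>_cong[OF assms] cong_trans cong_sym by blast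
  also have "\<dots> \<longleftrightarrow> infinitesimal (\<sigma> x / x - 1)" unfolding cong_def ..
  also have "\<dots> \<longleftrightarrow> val_gt v (x * (\<sigma> x / x - 1)) d" using assms by (simp add: val_gt_mult_unit)
  also have "x * (\<sigma> x / x - 1) = \<sigma> x - x" using assms(3) by (simp add: algebra_simps)
  finally show ?thesis .
qed

lemma \<theta>_add:
  assumes s: "\<sigma> \<in> carrier I" and d: "d \<in> \<Gamma>" "d' \<in> \<Gamma>"
  shows "\<theta> \<sigma> (d + d') \<approx> \<theta> \<sigma> d * \<theta> \<sigma> d'"
proof -
  interpret \<sigma>: field_endo L \<sigma> using endo[OF s] .
  obtain x where x: "x \<in> L" "x \<noteq> 0" "v x = d" using \<Gamma>E[OF d(1)] .
  obtain y where y: "y \<in> L" "y \<noteq> 0" "v y = d'" using \<Gamma>E[OF d(2)] .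
  have "\<theta> \<sigma> (d + d') \<approx> \<sigma> (x * y) / (x * y)" using s x y by (intro \<theta>_cong) (auto simp: v_mult mult_in)
  also have "\<sigma> (x * y) / (x * y) = (\<sigma> x / x) * (\<sigma> y / y)" using x y by (simp add: \<sigma>.mult)
  also have "\<dots> \<approx> \<theta> \<sigma> d * \<theta> \<sigma> d'"
    using s x y d by (intro cong_mult cong_sym[OF \<theta>_cong] quotient_integral \<theta>_integral) auto
  finally show ?thesis .
qed

text \<open>\<sigma> (\<tau> x) / x splits as \<sigma> (\<tau> x) / \<tau> x times \<tau> x / x, and
  \<tau> x has the same value as \<open>x\<close>, so both quotients represent the character at
  \<open>d\<close>.\<close>

lemma \<theta>_comp:
  assumes s: "\<sigma> \<in> carrier I" "\<tau> \<in> carrier I" and d: "d \<in> \<Gamma>"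
  shows "\<theta> (\<sigma> \<otimes>\<^bsub>I\<^esub> \<tau>) d \<approx> \<theta> \<sigma> d * \<theta> \<tau> d"
proof -
  obtain x where x: "x \<in> L" "x \<noteq> 0" "v x = d" using \<Gamma>E[OF d] .
  have t: "\<tau> x \<in> L" "\<tau> x \<noteq> 0" "v (\<tau> x) = d" 
    using maps[OF s(2) x(1)] nonzero[OF s(2) x(1,2)] v_I[OF s(2) x(1,2)] x(3) by simp_all
  have "\<theta> (\<sigma> \<otimes>\<^bsub>I\<^esub> \<tau>) d \<approx> (\<sigma> \<otimes>\<^bsub>I\<^esub> \<tau>) x / x" using s x by (intro \<theta>_cong) auto
  also have "(\<sigma> \<otimes>\<^bsub>I\<^esub> \<tau>) x / x = (\<sigma> (\<tau> x) / \<tau> x) * (\<tau> x / x)" using I_mult[OF s x(1)] t(2) by simp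
  also have "\<dots> \<approx> \<theta> \<sigma> d * \<theta> \<tau> d"
    using s x t d by (intro cong_mult cong_sym[OF \<theta>_cong] quotient_integral \<theta>_integral) auto
  finally show ?thesis .
qed

text \<open>Integers are values of elements fixed by \<open>I\<close>, for which the quotient is
  1.\<close>

lemma \<theta>_int: assumes "\<sigma> \<in> carrier I" shows "\<theta> \<sigma> (of_int k) \<approx> 1"
proof -
  obtain x where x: "x \<in> L" "x \<noteq> 0" "v x = of_int k" "\<forall>\<sigma>\<in>carrier I. \<sigma> x = x"
    using fixed_surj[of k] by blast
  then have "\<sigma> x / x = 1" using assms by simp
  then show ?thesis using \<theta>_cong[OF assms x(1-3)] by metis
qed

lemma \<theta>_one: assumes "d \<in> \<Gamma>" shows "\<theta> \<one>\<^bsub>I\<^esub> d \<approx> 1"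
proof -
  obtain x where x: "x \<in> L" "x \<noteq> 0" "v x = d" using \<Gamma>E[OF assms] .
  then show ?thesis using \<theta>_cong[OF I.one_closed x] I_one by simp
qed

lemma \<theta>_nat_mult:
  assumes "\<sigma> \<in> carrier I" "d \<in> \<Gamma>" shows "\<theta> \<sigma> (of_nat n * d) \<approx> \<theta> \<sigma> d ^ n"
proof (induction n)
  case 0
  show ?case using \<theta>_int[OF assms(1), of 0] by simp
next
  case (Suc n)
  have "\<theta> \<sigma> (of_nat (Suc n) * d) = \<theta> \<sigma> (d + of_nat n * d)" by (simp add: algebra_simps)
  also have "\<dots> \<approx> \<theta> \<sigma> d * \<theta> \<sigma> (of_nat n * d)" using assms by (intro \<theta>_add \<Gamma>_nat_mult)
  also have "\<dots> \<approx> \<theta> \<sigma> d * \<theta> \<sigma> d ^ n"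
    using Suc assms by (intro cong_mult \<theta>_integral integral_power cong_refl)
  finally show ?case by simp
qed

lemma \<theta>_pow:
  assumes "\<sigma> \<in> carrier I" "d \<in> \<Gamma>" shows "\<theta> (\<sigma> [^]\<^bsub>I\<^esub> (n::nat)) d \<approx> \<theta> \<sigma> d ^ n"
proof (induction n)
  case 0
  show ?case using \<theta>_one[OF assms(2)] by simp
next
  case (Suc n)
  have "\<theta> (\<sigma> [^]\<^bsub>I\<^esub> Suc n) d \<approx> \<theta> (\<sigma> [^]\<^bsub>I\<^esub> n) d * \<theta> \<sigma> d"
    using assms by (simp add: \<theta>_comp)
  also have "\<dots> \<approx> \<theta> \<sigma> d ^ n * \<theta> \<sigma> d"
    using Suc assms by (intro cong_mult \<theta>_integral cong_refl) auto
  finally show ?case by (simp add: mult.commute)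
qed

lemma \<theta>_uminus_trivial:
  assumes "\<sigma> \<in> carrier I" "d \<in> \<Gamma>" "\<theta> \<sigma> d \<approx> 1"
  shows "\<theta> \<sigma> (- d) \<approx> 1"
proof (rule cong_1_cancel[of _ "\<theta> \<sigma> d"])
  have "\<theta> \<sigma> (- d + d) \<approx> \<theta> \<sigma> (- d) * \<theta> \<sigma> d" using assms by (intro \<theta>_add \<Gamma>_uminus)
  moreover have "\<theta> \<sigma> (- d + d) \<approx> 1" using \<theta>_int[OF assms(1), of 0] by simp
  ultimately show "\<theta> \<sigma> (- d) * \<theta> \<sigma> d \<approx> 1" using cong_trans[OF cong_sym] by blast
qed (use assms in \<open>simp_all add: \<theta>_integral \<Gamma>_uminus\<close>)

lemma \<theta>_int_mult_trivial:
  assumes "\<sigma> \<in> carrier I" "d \<in> \<Gamma>" "\<theta> \<sigma> d \<approx> 1"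
  shows "\<theta> \<sigma> (of_int k * d) \<approx> 1"
proof -
  have nat: "\<theta> \<sigma> (of_nat n * d) \<approx> 1" for n
  proof -
    have "\<theta> \<sigma> (of_nat n * d) \<approx> \<theta> \<sigma> d ^ n" using assms by (intro \<theta>_nat_mult)
    also have "\<dots> \<approx> 1 ^ n" using assms by (intro cong_power \<theta>_integral) auto
    finally show ?thesis by simp
  qed
  show ?thesis
  proof (cases k)
    case (nonneg n)
    then show ?thesis using nat[of n] by simp
  next
    case (neg n)
    have eq: "of_int k * d = - (of_nat (Suc n) * d)" by (simp add: neg algebra_simps)
    show ?thesis unfolding eq using assms nat by (intro \<theta>_uminus_trivial \<Gamma>_nat_mult)
  qed
qed

definition kernel :: "('a \<Rightarrow> 'a) set \<Rightarrow> rat \<Rightarrow> ('a \<Rightarrow> 'a) set" where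
  "kernel H d = {\<sigma> \<in> H. \<theta> \<sigma> d \<approx> 1}"

lemma \<theta>_cong_iff:
  assumes "\<sigma> \<in> carrier I" "\<tau> \<in> carrier I" "d \<in> \<Gamma>"
  shows "\<theta> \<sigma> d \<approx> \<theta> \<tau> d \<longleftrightarrow> \<theta> (inv\<^bsub>I\<^esub> \<sigma> \<otimes>\<^bsub>I\<^esub> \<tau>) d \<approx> 1"
proof -
  have "\<theta> (inv\<^bsub>I\<^esub> \<sigma> \<otimes>\<^bsub>I\<^esub> \<sigma>) d \<approx> \<theta> (inv\<^bsub>I\<^esub> \<sigma>) d * \<theta> \<sigma> d"
    using assms by (intro \<theta>_comp) auto
  then have inv: "\<theta> (inv\<^bsub>I\<^esub> \<sigma>) d * \<theta> \<sigma> d \<approx> 1"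
    using assms(1) by (intro cong_trans[OF cong_sym \<theta>_one[OF assms(3)]]) simp
  have comp: "\<theta> (inv\<^bsub>I\<^esub> \<sigma> \<otimes>\<^bsub>I\<^esub> \<tau>) d \<approx> \<theta> (inv\<^bsub>I\<^esub> \<sigma>) d * \<theta> \<tau> d"
    using assms by (intro \<theta>_comp) auto
  have int: "integral (\<theta> (inv\<^bsub>I\<^esub> \<sigma>) d)" "integral (\<theta> \<sigma> d)" "integral (\<theta> \<tau> d)"
    using assms by (auto intro: \<theta>_integral)
  show ?thesis
  proof
    assume "\<theta> \<sigma> d \<approx> \<theta> \<tau> d"
    then have "\<theta> (inv\<^bsub>I\<^esub> \<sigma>) d * \<theta> \<sigma> d \<approx> \<theta> (inv\<^bsub>I\<^esub> \<sigma>) d * \<theta> \<tau> d"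
      using int by (intro cong_mult) auto
    then show "\<theta> (inv\<^bsub>I\<^esub> \<sigma> \<otimes>\<^bsub>I\<^esub> \<tau>) d \<approx> 1"
      using cong_trans[OF comp cong_trans[OF cong_sym inv]] by blast
  next
    assume "\<theta> (inv\<^bsub>I\<^esub> \<sigma> \<otimes>\<^bsub>I\<^esub> \<tau>) d \<approx> 1"
    then have "\<theta> (inv\<^bsub>I\<^esub> \<sigma>) d * \<theta> \<tau> d \<approx> 1" using cong_trans[OF cong_sym[OF comp]] by blast
    then have 1: "\<theta> \<sigma> d * (\<theta> (inv\<^bsub>I\<^esub> \<sigma>) d * \<theta> \<tau> d) \<approx> \<theta> \<sigma> d * 1" using int by (intro cong_mult) auto
    have "(\<theta> (inv\<^bsub>I\<^esub> \<sigma>) d * \<theta> \<sigma> d) * \<theta> \<tau> d \<approx> 1 * \<theta> \<tau> d"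
      using int inv by (intro cong_mult integral_mult) auto
    then have "\<theta> \<sigma> d * (\<theta> (inv\<^bsub>I\<^esub> \<sigma>) d * \<theta> \<tau> d) \<approx> \<theta> \<tau> d" by (simp add: ac_simps)
    then show "\<theta> \<sigma> d \<approx> \<theta> \<tau> d" using cong_trans[OF cong_sym[OF 1]] by simp
  qed
qed

lemma subgroup_kernel:
  assumes H: "subgroup H I" and d: "d \<in> \<Gamma>"
  shows "subgroup (kernel H d) I"
proof (rule I.subgroupI)
  interpret H: subgroup H I by fact
  show "kernel H d \<subseteq> carrier I" unfolding kernel_def by auto
  have "\<one>\<^bsub>I\<^esub> \<in> kernel H d" unfolding kernel_def using \<theta>_one[OF d] by simp
  then show "kernel H d \<noteq> {}" by blast
  fix \<sigma> assume s: "\<sigma> \<in> kernel H d"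
  then have sH: "\<sigma> \<in> H" "\<theta> \<sigma> d \<approx> 1" unfolding kernel_def by auto
  have "\<theta> \<sigma> d \<approx> \<theta> \<one>\<^bsub>I\<^esub> d" using cong_trans[OF sH(2) cong_sym[OF \<theta>_one[OF d]]] .
  then show "inv\<^bsub>I\<^esub> \<sigma> \<in> kernel H d"
    unfolding kernel_def using \<theta>_cong_iff[of \<sigma> "\<one>\<^bsub>I\<^esub>" d] d sH(1) by simp
  fix \<tau> assume t: "\<tau> \<in> kernel H d"
  have "\<theta> (\<sigma> \<otimes>\<^bsub>I\<^esub> \<tau>) d \<approx> \<theta> \<sigma> d * \<theta> \<tau> d" using s t d unfolding kernel_def by (intro \<theta>_comp) auto
  also have "\<dots> \<approx> 1 * 1" using s t d unfolding kernel_def by (intro cong_mult \<theta>_integral) auto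
  finally show "\<sigma> \<otimes>\<^bsub>I\<^esub> \<tau> \<in> kernel H d" using s t unfolding kernel_def by auto
qed

section \<open>Averages and norms over subgroups\<close>

lemma trace_invariant:
  assumes H: "subgroup H I" and x: "x \<in> L" and \<tau>: "\<tau> \<in> H"
  shows "\<tau> (\<Sum>\<sigma>\<in>H. \<sigma> x) = (\<Sum>\<sigma>\<in>H. \<sigma> x)"
proof -
  interpret H: subgroup H I by fact
  interpret HG: group "I\<lparr>carrier := H\<rparr>" using I.subgroup_imp_group[OF H] .
  interpret \<tau>: field_endo L \<tau> using endo \<tau> by simp
  have "\<tau> (\<Sum>\<sigma>\<in>H. \<sigma> x) = (\<Sum>\<sigma>\<in>H. \<tau> (\<sigma> x))" using x maps by (intro \<tau>.sum) auto
  also have "\<dots> = (\<Sum>\<sigma>\<in>H. (\<tau> \<otimes>\<^bsub>I\<^esub> \<sigma>) x)" using x \<tau> by (intro sum.cong) (auto simp: I_mult)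
  also have "\<dots> = (\<Sum>\<sigma>\<in>H. \<sigma> x)"
    using \<tau> HG.inj_on_cmult[of \<tau>] HG.surj_const_mult[of \<tau>]
    by (intro sum.reindex_bij_betw[of "\<lambda>\<sigma>. \<tau> \<otimes>\<^bsub>I\<^esub> \<sigma>" H H "\<lambda>\<sigma>. \<sigma> x"]) (auto simp: bij_betw_def)
  finally show ?thesis .
qed

text \<open>The sum of the images of \<open>x\<close> under \<open>H\<close> differs from |H| x by
  terms of value above \<open>v x\<close>. As |H| is a unit, the sum is nonzero and has the value of
  \<open>x\<close>.\<close>

lemma fixed_representative:
  assumes H: "subgroup H I" and x: "x \<in> L" "x \<noteq> 0"
    and small: "\<And>\<sigma>. \<sigma> \<in> H \<Longrightarrow> val_gt v (\<sigma> x - x) (v x)"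
  obtains y where "y \<in> L" "y \<noteq> 0" "v y = v x" "\<And>\<sigma>. \<sigma> \<in> H \<Longrightarrow> \<sigma> y = y"
proof -
  interpret H: subgroup H I by fact
  define y where "y = (\<Sum>\<sigma>\<in>H. \<sigma> x)"
  have "val_gt v (\<Sum>\<sigma>\<in>H. \<sigma> x - x) (v x)" using small by (intro val_gt_sum)
  then have small: "val_gt v (y - of_nat (card H) * x) (v x)" unfolding y_def by (simp add: sum_subtractf)
  have hx: "of_nat (card H) * x \<noteq> 0" "v (of_nat (card H) * x) = v x"
    using tame_subgroup[OF H] x by (auto simp: v_mult)
  have "y \<noteq> 0" "v y = v x" using v_eq_of_val_gt_diff[OF hx(1), of y] small hx(2) by auto
  moreover have "y \<in> L" unfolding y_def using maps x(1) by (intro sum_in) auto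
  moreover have "\<sigma> y = y" if "\<sigma> \<in> H" for \<sigma> unfolding y_def using trace_invariant[OF H x(1) that] .
  ultimately show ?thesis using that by blast
qed

text \<open>A suitable power of the product of the conjugates of \<open>x\<close> is its norm from the field fixed
  by \<open>H\<close> to the field fixed by \<open>I\<close>.\<close>

lemma norm_value:
  assumes H: "subgroup H I" and x: "x \<in> L" "x \<noteq> 0" and fixed: "\<And>\<sigma>. \<sigma> \<in> H \<Longrightarrow> \<sigma> x = x"
  shows "of_nat (e div card H) * v x \<in> \<int>"
proof -
  define S where "S = {\<sigma> \<in> carrier I. \<sigma> x = x}"
  have S: "subgroup S I"
  proof (rule I.subgroupI)
    show "S \<subseteq> carrier I" "S \<noteq> {}" unfolding S_def using I_one[OF x(1)] by blast+
    show "inv\<^bsub>I\<^esub> \<sigma> \<in> S" if "\<sigma> \<in> S" for \<sigma>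
      using that inv_apply(1)[of \<sigma> x] x unfolding S_def by auto
    show "\<sigma> \<otimes>\<^bsub>I\<^esub> \<tau> \<in> S" if "\<sigma> \<in> S" "\<tau> \<in> S" for \<sigma> \<tau>
      using that x I_mult unfolding S_def by auto
  qed
  \<comment> \<open>The stabiliser \<open>S\<close> may exceed \<open>H\<close>: the product over
    the distinct conjugates has [I : S] factors, and its power with exponent k = [S : H] has [I : H]
    of them.\<close>
  have "H \<subseteq> S" using fixed subgroup.subset[OF H] unfolding S_def by blast
  then obtain k where k: "card S = card H * k" using card_subgroup_dvd[OF S H] by blast
  define Y where "Y = (\<lambda>\<sigma>. \<sigma> x) ` carrier I"
  have card: "e = card Y * card S"
    unfolding Y_def
  proof (rule I.card_fibres[OF finite_I I.subgroup_self])
    show "S \<subseteq> carrier I" unfolding S_def by blast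
    show "\<sigma> x = \<tau> x \<longleftrightarrow> inv\<^bsub>I\<^esub> \<sigma> \<otimes>\<^bsub>I\<^esub> \<tau> \<in> S" if "\<sigma> \<in> carrier I" "\<tau> \<in> carrier I" for \<sigma> \<tau>
      using eq_iff_inv[OF that x(1)] that unfolding S_def by simp
  qed
  have Y: "finite Y" "Y \<subseteq> L" "0 \<notin> Y" "\<And>y. y \<in> Y \<Longrightarrow> v y = v x"
    unfolding Y_def using finite_I maps nonzero v_I x by auto
  define P where "P = (\<Prod>y\<in>Y. y)"
  have P: "P \<in> L" "P \<noteq> 0" unfolding P_def using Y by (auto intro!: prod_in)
  have vP: "v P = of_nat (card Y) * v x" unfolding P_def using Y v_prod[of Y "\<lambda>y. y"] by auto
  have inv: "\<tau> P = P" if t: "\<tau> \<in> carrier I" for \<tau>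
  proof -
    interpret \<tau>: field_endo L \<tau> using endo[OF t] .
    have "\<tau> ` Y = (\<lambda>\<sigma>. (\<tau> \<otimes>\<^bsub>I\<^esub> \<sigma>) x) ` carrier I"
      unfolding Y_def image_image using x t by (intro image_cong) (auto simp: I_mult)
    also have "\<dots> = (\<lambda>\<sigma>. \<sigma> x) ` ((\<lambda>\<sigma>. \<tau> \<otimes>\<^bsub>I\<^esub> \<sigma>) ` carrier I)" by (simp add: image_image)
    also have "\<dots> = Y" unfolding Y_def using I.surj_const_mult[OF t] by simp
    finally have im: "\<tau> ` Y = Y" .
    have inj: "inj_on \<tau> Y" using inv_apply(1)[OF t] Y(2) by (metis inj_on_def subsetD)
    have "\<tau> P = (\<Prod>y\<in>Y. \<tau> y)" unfolding P_def using Y(2) by (intro \<tau>.prod) auto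
    also have "\<dots> = P" unfolding P_def using prod.reindex[OF inj, of "\<lambda>y. y"] im by simp
    finally show ?thesis .
  qed
  have "\<tau> (P ^ k) = P ^ k" if "\<tau> \<in> carrier I" for \<tau>
    by (simp add: field_endo.power[OF endo[OF that] P(1)] inv[OF that])
  then have "v (P ^ k) \<in> \<int>" using P by (intro unramified) (auto intro: power_in)
  moreover have "v (P ^ k) = of_nat (k * card Y) * v x" using P(2) vP by (simp add: v_power)
  moreover have "e div card H = k * card Y" using card k card_subgroup_pos[OF H] by simp
  ultimately show ?thesis by simp
qed

lemma trivial_subgroup: "subgroup {\<one>\<^bsub>I\<^esub>} I"
  by (rule I.triv_subgroup)

lemma e_mult_int: assumes "d \<in> \<Gamma>" shows "of_nat e * d \<in> \<int>"
proof -
  obtain x where x: "x \<in> L" "x \<noteq> 0" "v x = d" using \<Gamma>E[OF assms] .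
  then show ?thesis using norm_value[OF trivial_subgroup x(1,2)] I_one by simp
qed

text \<open>The number \<open>n\<close> of residue classes taken by \<theta>(d) on \<open>H\<close>
  is the index of the kernel. It is at most \<open>b\<close>, as by \<open>triv\<close> the classes
  are roots of X^b - 1. It is a multiple of \<open>b\<close>, as the kernel fixes some element of
  value \<open>d\<close>, whose norm has the value n [I : H] d, an integer. Triviality of \<theta>(b
  d) is a hypothesis because at first it is known only for the whole group.\<close>

lemma card_kernel_aux:
  assumes H: "subgroup H I" and d: "d \<in> \<Gamma>" and b: "b = denom (of_nat (e div card H) * d)"
    and triv: "\<And>\<sigma>. \<sigma> \<in> H \<Longrightarrow> \<theta> \<sigma> (of_nat b * d) \<approx> 1"
  shows "card H = b * card (kernel H d)"
proof -
  interpret H: subgroup H I by fact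
  have b_pos: "b > 0" unfolding b by (rule denom_pos)
  \<comment> \<open>The residue class as a set, so that classes can be counted by
    \<open>card\<close>.\<close>
  define cls where "cls = (\<lambda>a. {y. y \<approx> a})"
  have cls: "cls a = cls a' \<longleftrightarrow> a \<approx> a'" for a a'
    unfolding cls_def set_eq_iff mem_Collect_eq
    by (meson cong_refl cong_sym cong_trans)
  define n where "n = card ((\<lambda>\<sigma>. cls (\<theta> \<sigma> d)) ` H)"
  have n: "card H = n * card (kernel H d)"
    unfolding n_def
  proof (rule I.card_fibres[OF finite_subgroup[OF H] H])
    show "kernel H d \<subseteq> H" unfolding kernel_def by blast
    show "cls (\<theta> \<sigma> d) = cls (\<theta> \<tau> d) \<longleftrightarrow> inv\<^bsub>I\<^esub> \<sigma> \<otimes>\<^bsub>I\<^esub> \<tau> \<in> kernel H d" if "\<sigma> \<in> H" "\<tau> \<in> H" for \<sigma> \<tau>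
      using that d \<theta>_cong_iff[of \<sigma> \<tau> d] unfolding cls kernel_def by auto
  qed
  have n_pos: "n > 0" using n card_subgroup_pos[OF H] by (intro Nat.gr0I) auto
  have "n \<le> b"
  proof -
    \<comment> \<open>\<open>A\<close> picks one value of the character from each class that
      occurs.\<close>
    obtain A where A: "A \<subseteq> (\<lambda>\<sigma>. \<theta> \<sigma> d) ` H" "inj_on cls A" "cls ` ((\<lambda>\<sigma>. \<theta> \<sigma> d) ` H) = cls ` A"
      using subset_image_inj[of "cls ` ((\<lambda>\<sigma>. \<theta> \<sigma> d) ` H)" cls "(\<lambda>\<sigma>. \<theta> \<sigma> d) ` H"] by auto
    have "n = card A" unfolding n_def using A(3) card_image[OF A(2)] by (simp add: image_image)
    also have "card A \<le> b"
    \<comment> \<open>The coefficients of X^b - 1; \<open>b_pos\<close> keeps the two nonzero ones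
      apart.\<close>
    proof (rule card_roots_mod_infinitesimal_le[where c = "\<lambda>i. if i = b then 1 else if i = 0 then - 1 else 0"])
      show "finite A" using A(1) finite_subgroup[OF H] finite_surj by blast
      show int: "integral a" if "a \<in> A" for a using that A(1) \<theta>_integral[OF _ d] by auto
      show "a = a'" if "a \<in> A" "a' \<in> A" "infinitesimal (a - a')" for a a'
        using that A(2) cls unfolding cong_def[symmetric] by (metis inj_onD)
      show "infinitesimal (\<Sum>i\<le>b. (if i = b then 1 else if i = 0 then - 1 else 0) * a ^ i)"
        if a: "a \<in> A" for a
      proof -
        obtain \<sigma> where s: "\<sigma> \<in> H" "a = \<theta> \<sigma> d" using a A(1) by blast
        have "(\<Sum>i\<le>b. (if i = b then 1 else if i = 0 then - 1 else 0) * a ^ i)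
            = (\<Sum>i\<le>b. (if i = b then a ^ i else 0) - (if i = 0 then a ^ i else 0))"
          using b_pos by (intro sum.cong) auto
        also have "\<dots> = a ^ b - 1" by (simp add: sum_subtractf)
        finally have eq: "(\<Sum>i\<le>b. (if i = b then 1 else if i = 0 then - 1 else 0) * a ^ i) = a ^ b - 1" .
        have "a ^ b \<approx> 1"
          unfolding s(2) using cong_trans[OF cong_sym[OF \<theta>_nat_mult[OF H.mem_carrier[OF s(1)] d]] triv[OF s(1)]] .
        then show ?thesis unfolding eq cong_def .
      qed
    qed auto
    finally show ?thesis .
  qed
  moreover have "b dvd n"
  proof -
    obtain x where x: "x \<in> L" "x \<noteq> 0" "v x = d" using \<Gamma>E[OF d] .
    have ker: "subgroup (kernel H d) I" using subgroup_kernel[OF H d] .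
    obtain y where y: "y \<in> L" "y \<noteq> 0" "v y = v x" "\<And>\<sigma>. \<sigma> \<in> kernel H d \<Longrightarrow> \<sigma> y = y"
    proof (rule fixed_representative[OF ker x(1,2)])
      show "val_gt v (\<sigma> x - x) (v x)" if "\<sigma> \<in> kernel H d" for \<sigma>
        using that \<theta>_cong_1_iff[OF _ x(1,2)] x(3) unfolding kernel_def by auto
    qed blast
    have "of_nat (e div card (kernel H d)) * v y \<in> \<int>"
      using y by (intro norm_value[OF ker]) auto
    then have "of_nat (e div card (kernel H d)) * d \<in> \<int>" using y(3) x(3) by simp
    moreover have "e div card (kernel H d) = n * (e div card H)"
    proof -
      obtain k where k: "e = k * card H" using index[OF H] by metis
      then have "e = (n * k) * card (kernel H d)" using n by simp
      then have "e div card (kernel H d) = n * k"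
        using card_subgroup_pos[OF ker] by (metis less_not_refl nonzero_mult_div_cancel_right)
      then show ?thesis using k card_subgroup_pos[OF H] by simp
    qed
    ultimately have "of_nat n * (of_nat (e div card H) * d) \<in> \<int>" by (simp add: mult.assoc)
    then show ?thesis unfolding b denom_dvd_iff .
  qed
  ultimately have "n = b" using n_pos dvd_imp_le by fastforce
  then show ?thesis using n by simp
qed

text \<open>Otherwise the telescoping sum of \<open>\<sigma>\<^sup>i (\<sigma> x - x)\<close> over \<open>i < e\<close>, which vanishes, would be
  congruent to \<open>e (\<sigma> x - x)\<close>.\<close>

lemma \<theta>_displacement:
  assumes s: "\<sigma> \<in> carrier I" and x: "x \<in> L" "\<sigma> x \<noteq> x"
  shows "\<not> \<theta> \<sigma> (v (\<sigma> x - x)) \<approx> 1"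
proof
  interpret \<sigma>: field_endo L \<sigma> using endo[OF s] .
  define y where "y = \<sigma> x - x"
  define d where "d = v y"
  assume "\<theta> \<sigma> (v (\<sigma> x - x)) \<approx> 1"
  then have triv: "\<theta> \<sigma> d \<approx> 1" unfolding d_def y_def .
  have y: "y \<in> L" "y \<noteq> 0" unfolding y_def using x maps[OF s] by (auto intro: diff_in)
  have d: "d \<in> \<Gamma>" unfolding d_def using y by (rule \<Gamma>I)
  have pow: "(\<sigma> [^]\<^bsub>I\<^esub> i) \<in> carrier I" for i :: nat using s by simp
  have small: "val_gt v ((\<sigma> [^]\<^bsub>I\<^esub> i) y - y) d" for i :: nat
  proof -
    have "\<theta> (\<sigma> [^]\<^bsub>I\<^esub> i) d \<approx> \<theta> \<sigma> d ^ i" using s d by (rule \<theta>_pow)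
    also have "\<dots> \<approx> 1 ^ i" using triv s d by (intro cong_power \<theta>_integral) auto
    finally show ?thesis using \<theta>_cong_1_iff[OF pow y] d_def by simp
  qed
  have step: "(\<sigma> [^]\<^bsub>I\<^esub> i) y = (\<sigma> [^]\<^bsub>I\<^esub> Suc i) x - (\<sigma> [^]\<^bsub>I\<^esub> i) x" for i :: nat
  proof -
    interpret \<tau>: field_endo L "\<sigma> [^]\<^bsub>I\<^esub> i" using endo[OF pow] .
    show ?thesis unfolding y_def using s x maps[OF s] by (simp add: \<tau>.diff I_mult[OF pow])
  qed
  have "(\<Sum>i<e. (\<sigma> [^]\<^bsub>I\<^esub> i) y) = (\<sigma> [^]\<^bsub>I\<^esub> e) x - (\<sigma> [^]\<^bsub>I\<^esub> (0::nat)) x"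
    unfolding step by (rule sum_lessThan_telescope)
  also have "\<dots> = 0" using I.pow_order_eq_1[OF s] unfolding Coset.order_def by simp
  finally have sum0: "(\<Sum>i<e. (\<sigma> [^]\<^bsub>I\<^esub> i) y) = 0" .
  have "val_gt v (\<Sum>i<e. (\<sigma> [^]\<^bsub>I\<^esub> i) y - y) d" using small by (intro val_gt_sum)
  then have "val_gt v (of_nat e * y) d" using sum0 by (simp add: sum_subtractf)
  then show False using tame y unfolding d_def by (simp add: val_gt_mult_unit) (simp add: val_gt_def)
qed

text \<open>The value group lies in (1/e) \<int>, hence is generated by d0 = k/e for the least
  possible \<open>k\<close>. An element on which \<theta>(d0) is trivial has trivial character
  everywhere, so it displaces nothing and is the identity. Counting for the whole group then gives e
  = denom d0, which forces k = 1.\<close>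

lemma inverse_e_in_\<Gamma>: "1 / of_nat e \<in> \<Gamma>"
proof -
  have e0: "(of_nat e :: rat) \<noteq> 0" using e_pos by simp
  define k where "k = (LEAST k. k > 0 \<and> of_nat k / of_nat e \<in> \<Gamma>)"
  have "e > 0 \<and> of_nat e / of_nat e \<in> \<Gamma>" using e_pos \<Gamma>_int[of 1] by simp
  then have k: "k > 0" "of_nat k / of_nat e \<in> \<Gamma>"
    unfolding k_def using LeastI[of "\<lambda>k. k > 0 \<and> of_nat k / of_nat e \<in> \<Gamma>"] by blast+
  have least: "l \<ge> k" if "l > 0" "of_nat l / of_nat e \<in> \<Gamma>" for l
    unfolding k_def using that by (intro Least_le) blast
  define d0 :: rat where "d0 = of_nat k / of_nat e"
  have d0: "d0 \<in> \<Gamma>" "d0 > 0" using k e_pos unfolding d0_def by auto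
  \<comment> \<open>Euclidean division by \<open>k\<close>: the remainder yields a value r/e below
    \<open>d0\<close>, so \<open>r\<close> is 0.\<close>
  have mult: "\<exists>m. d = of_int m * d0" if d: "d \<in> \<Gamma>" for d
  proof -
    obtain z where z: "of_nat e * d = of_int z" using e_mult_int[OF d] by (auto elim: Ints_cases)
    define q where "q = z div int k"
    define r where "r = z mod int k"
    have r: "0 \<le> r" "r < int k" unfolding r_def using k(1) by auto
    have zq: "z = int k * q + r" unfolding q_def r_def by simp
    have int_mult: "of_int q * d0 \<in> \<Gamma>"
    proof (cases q)
      case (nonneg n)
      then show ?thesis using \<Gamma>_nat_mult[OF d0(1), of n] by simp
    next
      case (neg n)
      have eq: "of_int q * d0 = - (of_nat (Suc n) * d0)" by (simp add: neg algebra_simps)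
      show ?thesis unfolding eq using d0(1) by (intro \<Gamma>_uminus \<Gamma>_nat_mult)
    qed
    have "of_nat (nat r) / of_nat e = d + - (of_int q * d0)"
    proof -
      have "d = of_int z / of_nat e" using z e0 by (simp add: field_simps)
      then have "d + - (of_int q * d0) = (of_int z - of_int q * of_nat k) / of_nat e"
        unfolding d0_def by (simp add: diff_divide_distrib)
      also have "(of_int z - of_int q * of_nat k :: rat) = of_int r" by (simp add: zq algebra_simps)
      finally show ?thesis using r(1) by simp
    qed
    then have "of_nat (nat r) / of_nat e \<in> \<Gamma>" using \<Gamma>_add[OF d \<Gamma>_uminus[OF int_mult]] by simp
    then have "r = 0" using least[of "nat r"] r by (cases "r = 0") auto
    then have "of_nat e * d = of_int q * of_nat k" using z zq by (simp add: mult.commute)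
    then have "d = of_int q * d0" unfolding d0_def using e0 by (simp add: field_simps)
    then show ?thesis ..
  qed
  have "kernel (carrier I) d0 = {\<one>\<^bsub>I\<^esub>}"
  proof
    show "kernel (carrier I) d0 \<subseteq> {\<one>\<^bsub>I\<^esub>}"
    proof
      fix \<sigma> assume "\<sigma> \<in> kernel (carrier I) d0"
      then have s: "\<sigma> \<in> carrier I" "\<theta> \<sigma> d0 \<approx> 1" unfolding kernel_def by auto
      have "\<sigma> x = \<one>\<^bsub>I\<^esub> x" if x: "x \<in> L" for x
      proof (rule ccontr)
        assume "\<sigma> x \<noteq> \<one>\<^bsub>I\<^esub> x"
        then have ne: "\<sigma> x \<noteq> x" using I_one x by simp
        then have "v (\<sigma> x - x) \<in> \<Gamma>" using x maps[OF s(1)] by (intro \<Gamma>I) (auto intro: diff_in)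
        then obtain m where "v (\<sigma> x - x) = of_int m * d0" using mult by blast
        then have "\<theta> \<sigma> (v (\<sigma> x - x)) \<approx> 1" using \<theta>_int_mult_trivial[OF s(1) d0(1) s(2)] by simp
        then show False using \<theta>_displacement[OF s(1) x ne] by blast
      qed
      then show "\<sigma> \<in> {\<one>\<^bsub>I\<^esub>}" using I_ext[OF s(1) I.one_closed] by blast
    qed
    show "{\<one>\<^bsub>I\<^esub>} \<subseteq> kernel (carrier I) d0" unfolding kernel_def using \<theta>_one[OF d0(1)] by simp
  qed
  moreover have "e = denom d0 * card (kernel (carrier I) d0)"
  proof (rule card_kernel_aux[OF I.subgroup_self d0(1)])
    show "denom d0 = denom (of_nat (e div e) * d0)" using e_pos by simp
    have "of_nat (denom d0) * d0 \<in> \<int>" using denom_dvd_iff[of d0 "denom d0"] by simp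
    then obtain z where "of_nat (denom d0) * d0 = of_int z" by (auto elim: Ints_cases)
    then show "\<theta> \<sigma> (of_nat (denom d0) * d0) \<approx> 1" if "\<sigma> \<in> carrier I" for \<sigma> using \<theta>_int[OF that] by simp
  qed
  ultimately have e: "e = denom d0" by simp
  \<comment> \<open>The integer 1 is a value, hence equals m d0. Then e = denom d0 divides m, so k =
    e d0 \<le> m d0 = 1.\<close>
  obtain m where m: "1 = of_int m * d0" using mult[of 1] \<Gamma>_int[of 1] by auto
  then have "m > 0" using d0(2) by (metis zero_less_mult_pos2 zero_less_one of_int_0_less_iff)
  then have "of_nat (nat m) * d0 \<in> \<int>" using m by simp
  then have "e dvd nat m" unfolding e denom_dvd_iff .
  then have "e \<le> nat m" using \<open>m > 0\<close> by (intro dvd_imp_le) auto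
  then have "of_nat e \<le> (of_int m :: rat)" using \<open>m > 0\<close> by (metis nat_0_le of_int_of_nat_eq of_nat_le_iff order.strict_implies_order)
  then have "of_nat e * d0 \<le> 1" using m d0(2) by (metis mult_right_mono order.strict_implies_order)
  then have "(of_nat k :: rat) \<le> 1" unfolding d0_def using e0 by simp
  then have "k = 1" using k(1) by simp
  then show ?thesis using d0(1) unfolding d0_def by simp
qed

text \<open>By Lagrange the power of \<sigma> with exponent |H| is the identity, so \<theta>(|H|/e)
  is trivial at \<sigma>. Integrality of [I : H] d makes \<open>d\<close> an integer multiple of
  |H|/e.\<close>

lemma \<theta>_trivial_subgroup:
  assumes H: "subgroup H I" and s: "\<sigma> \<in> H" and d: "d \<in> \<Gamma>" and int: "of_nat (e div card H) * d \<in> \<int>"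
  shows "\<theta> \<sigma> d \<approx> 1"
proof -
  interpret H: subgroup H I by fact
  interpret HG: group "I\<lparr>carrier := H\<rparr>" using I.subgroup_imp_group[OF H] .
  let ?d = "of_nat (card H) * (1 / of_nat e) :: rat"
  have sI: "\<sigma> \<in> carrier I" using s by simp
  have "\<sigma> [^]\<^bsub>I\<^esub> card H = \<one>\<^bsub>I\<^esub>"
    using HG.pow_order_eq_1[of \<sigma>] s I.nat_pow_consistent[of \<sigma> "card H" H] by (simp add: Coset.order_def)
  then have "\<theta> \<sigma> (1 / of_nat e) ^ card H \<approx> 1"
    using cong_trans[OF cong_sym[OF \<theta>_pow[OF sI inverse_e_in_\<Gamma>, of "card H"]]] \<theta>_one[OF inverse_e_in_\<Gamma>]
    by simp
  then have triv: "\<theta> \<sigma> ?d \<approx> 1" 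
    by (rule cong_trans[OF \<theta>_nat_mult[OF sI inverse_e_in_\<Gamma>]])
  obtain k where k: "e = k * card H" using index[OF H] by metis
  then have "e div card H = k" using card_subgroup_pos[OF H] by simp
  then obtain z where z: "of_nat k * d = of_int z" using int by (auto elim: Ints_cases)
  have "(of_nat k :: rat) \<noteq> 0" "(of_nat (card H) :: rat) \<noteq> 0" using k e_pos by auto
  then have "of_int z * ?d = d" unfolding z[symmetric] k by (simp add: field_simps)
  then show ?thesis using \<theta>_int_mult_trivial[OF sI \<Gamma>_nat_mult[OF inverse_e_in_\<Gamma>] triv, of z] by simp
qed

text \<open>The triviality that the count asks for now holds for every subgroup, because [I : H]
  times \<open>?b * d\<close> is an integer.\<close>

lemma card_kernel:
  assumes H: "subgroup H I" and d: "d \<in> \<Gamma>"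
  shows "card H = denom (of_nat (e div card H) * d) * card (kernel H d)"
proof (rule card_kernel_aux[OF H d refl])
  let ?b = "denom (of_nat (e div card H) * d)"
  have "of_nat ?b * (of_nat (e div card H) * d) \<in> \<int>"
    using denom_dvd_iff[of "of_nat (e div card H) * d" ?b] by simp
  then have "of_nat (e div card H) * (of_nat ?b * d) \<in> \<int>" by (simp add: ac_simps)
  then show "\<theta> \<sigma> (of_nat ?b * d) \<approx> 1" if "\<sigma> \<in> H" for \<sigma>
    using \<theta>_trivial_subgroup[OF H that \<Gamma>_nat_mult[OF d]] by blast
qed

end

subsection \<open>Clusters\<close>

text \<open>n m q is an integer exactly when denom q divides n m, so the left side is the least
  multiple of \<open>n\<close> that denom q divides. This turns the product of an index and an orbit
  length into an lcm.\<close>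

lemma mult_denom_eq_lcm:
  assumes "n > 0"
  shows "n * denom (of_nat n * q) = lcm (denom q) n"
proof (rule dvd_antisym)
  have "denom (of_nat n * q) dvd denom (of_nat n * q)" by simp
  then have "of_nat (n * denom (of_nat n * q)) * q \<in> \<int>" unfolding denom_dvd_iff by (simp add: ac_simps)
  then have "denom q dvd n * denom (of_nat n * q)" unfolding denom_dvd_iff .
  then show "lcm (denom q) n dvd n * denom (of_nat n * q)" by simp
  obtain k where k: "lcm (denom q) n = n * k" using dvd_lcm2 by blast
  have "denom q dvd n * k" unfolding k[symmetric] by simp
  then have "of_nat k * (of_nat n * q) \<in> \<int>" unfolding denom_dvd_iff by (simp add: ac_simps)
  then have "denom (of_nat n * q) dvd k" unfolding denom_dvd_iff .
  then show "n * denom (of_nat n * q) dvd lcm (denom q) n" unfolding k by simp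
qed

locale tame_clusters = tame_inertia v L I for v :: "'a::field \<Rightarrow> rat" and L I +
  fixes R :: "'a set"
  assumes finite_R: "finite R" and R_L: "R \<subseteq> L"
    and I_R: "\<sigma> \<in> carrier I \<Longrightarrow> \<sigma> ` R = R"
    and faithful: "\<sigma> \<in> carrier I \<Longrightarrow> (\<And>r. r \<in> R \<Longrightarrow> \<sigma> r = r) \<Longrightarrow> \<sigma> = \<one>\<^bsub>I\<^esub>"
begin

text \<open>Discs centred at roots are enough, since a cluster is cut out by a disc around any of
  its roots. The open discs, taken at the depth of a proper cluster, turn out to give its
  children.\<close>

definition closed_cl :: "'a \<Rightarrow> rat \<Rightarrow> 'a set" where "closed_cl r d = {x \<in> R. val_ge v (x - r) d}"
definition open_cl :: "'a \<Rightarrow> rat \<Rightarrow> 'a set" where "open_cl r d = {x \<in> R. val_gt v (x - r) d}"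

lemma cluster_subset: "cluster v R s \<Longrightarrow> s \<subseteq> R" "cluster v R s \<Longrightarrow> finite s" "cluster v R s \<Longrightarrow> s \<noteq> {}"
  unfolding cluster_def using finite_R by (auto intro: finite_subset)

lemma cluster_closed_cl: "r \<in> R \<Longrightarrow> cluster v R (closed_cl r d)"
  unfolding cluster_def closed_cl_def disc_def by (auto intro!: exI[of _ r] exI[of _ d])

text \<open>Every point of an ultrametric disc is a centre.\<close>

lemma clusterE:
  assumes "cluster v R s" "r \<in> s" obtains d where "s = closed_cl r d"
proof -
  obtain z d where s: "s = disc v z d \<inter> R" using assms(1) unfolding cluster_def by blast
  then have rz: "val_ge v (r - z) d" using assms(2) unfolding disc_def by simp
  have "val_ge v (x - z) d \<longleftrightarrow> val_ge v (x - r) d" for x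
    using val_ge_diff_trans[of x r d z] val_ge_diff_trans[of x z d r] rz val_ge_minus_commute by blast
  then have "s = closed_cl r d" unfolding s closed_cl_def disc_def by auto
  then show ?thesis using that by blast
qed

text \<open>Around a common root both are discs, compared by their radii.\<close>

lemma clusters_nested:
  assumes "cluster v R s" "cluster v R t" "r \<in> s" "r \<in> t"
  shows "s \<subseteq> t \<or> t \<subseteq> s"
proof -
  obtain d where d: "s = closed_cl r d" using clusterE[OF assms(1,3)] .
  obtain d' where d': "t = closed_cl r d'" using clusterE[OF assms(2,4)] .
  show ?thesis unfolding d d' closed_cl_def using val_ge_mono[of _ d d'] val_ge_mono[of _ d' d]
    by (cases "d \<le> d'") auto
qed

lemma val_I:
  assumes "\<sigma> \<in> carrier I" "x \<in> L"
  shows "val_ge v (\<sigma> x) d \<longleftrightarrow> val_ge v x d" "val_gt v (\<sigma> x) d \<longleftrightarrow> val_gt v x d"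
  using v_I[OF assms] nonzero[OF assms] field_endo.zero[OF endo[OF assms(1)]]
  unfolding val_ge_def val_gt_def by (cases "x = 0"; simp)+

lemma image_cl:
  assumes s: "\<sigma> \<in> carrier I" and r: "r \<in> L"
  shows "\<sigma> ` closed_cl r d = closed_cl (\<sigma> r) d" "\<sigma> ` open_cl r d = open_cl (\<sigma> r) d"
proof -
  have eq: "\<sigma> x - \<sigma> r = \<sigma> (x - r)" if "x \<in> R" for x
    using field_endo.diff[OF endo[OF s]] that r R_L by auto
  have in_L: "x - r \<in> L" if "x \<in> R" for x using that r R_L diff_in by blast
  have ge: "val_ge v (\<sigma> x - \<sigma> r) d \<longleftrightarrow> val_ge v (x - r) d"
    and gt: "val_gt v (\<sigma> x - \<sigma> r) d \<longleftrightarrow> val_gt v (x - r) d" if "x \<in> R" for x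
    using val_I[OF s in_L[OF that]] eq[OF that] by simp_all
  have img: "\<sigma> ` {x \<in> R. P x} = {x \<in> R. Q x}" if "\<And>x. x \<in> R \<Longrightarrow> Q (\<sigma> x) \<longleftrightarrow> P x" for P Q
  proof -
    have "{x \<in> R. Q x} = {x \<in> \<sigma> ` R. Q x}" using I_R[OF s] by simp
    also have "\<dots> = \<sigma> ` {x \<in> R. P x}" using that by auto
    finally show ?thesis by simp
  qed
  show "\<sigma> ` closed_cl r d = closed_cl (\<sigma> r) d" unfolding closed_cl_def using ge by (rule img)
  show "\<sigma> ` open_cl r d = open_cl (\<sigma> r) d" unfolding open_cl_def using gt by (rule img)
qed

lemma cluster_image:
  assumes "\<sigma> \<in> carrier I" "cluster v R s" shows "cluster v R (\<sigma> ` s)"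
proof -
  obtain r where r: "r \<in> s" using cluster_subset(3)[OF assms(2)] by blast
  then have rR: "r \<in> R" using cluster_subset(1)[OF assms(2)] by blast
  obtain d where "s = closed_cl r d" using clusterE[OF assms(2) r] .
  moreover have "\<sigma> r \<in> R" using I_R[OF assms(1)] rR by blast
  ultimately show ?thesis using image_cl(1)[OF assms(1)] rR R_L cluster_closed_cl by (metis subsetD)
qed

lemma depth_props:
  assumes "proper_cluster v R s"
  shows "\<And>r r'. r \<in> s \<Longrightarrow> r' \<in> s \<Longrightarrow> val_ge v (r - r') (depth v s)"
    and "\<exists>r\<in>s. \<exists>r'\<in>s. r \<noteq> r' \<and> v (r - r') = depth v s"
    and "depth v s \<in> \<Gamma>"
    and "\<And>r. r \<in> s \<Longrightarrow> s = closed_cl r (depth v s)"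
proof -
  have cl: "cluster v R s" and card: "card s > 1" using assms unfolding proper_cluster_def by auto
  let ?D = "{v (r - r') | r r'. r \<in> s \<and> r' \<in> s \<and> r \<noteq> r'}"
  have "?D \<subseteq> (\<lambda>(r, r'). v (r - r')) ` (s \<times> s)" by auto
  then have fin: "finite ?D" by (rule finite_subset) (simp add: cluster_subset(2)[OF cl])
  obtain a b where "a \<in> s" "b \<in> s" "a \<noteq> b"
    using card card_le_Suc0_iff_eq[OF cluster_subset(2)[OF cl]] by (metis One_nat_def not_le)
  then have "?D \<noteq> {}" by blast
  then have min: "depth v s \<in> ?D" unfolding depth_def using Min_in[OF fin] by blast
  show ge: "val_ge v (r - r') (depth v s)" if "r \<in> s" "r' \<in> s" for r r'
    using that Min_le[OF fin, of "v (r - r')"] unfolding depth_def val_ge_def by auto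
  obtain r r' where rr: "r \<in> s" "r' \<in> s" "r \<noteq> r'" "v (r - r') = depth v s"
    using min unfolding mem_Collect_eq by metis
  then show "\<exists>r\<in>s. \<exists>r'\<in>s. r \<noteq> r' \<and> v (r - r') = depth v s" by blast
  have "r - r' \<in> L" using rr cluster_subset(1)[OF cl] R_L diff_in by blast
  then show "depth v s \<in> \<Gamma>" using \<Gamma>I[of "r - r'"] rr by simp
  show "s = closed_cl q (depth v s)" if q: "q \<in> s" for q
  proof
    show "s \<subseteq> closed_cl q (depth v s)" unfolding closed_cl_def using ge q cluster_subset(1)[OF cl] by blast
    \<comment> \<open>A disc that cuts out \<open>s\<close> has radius at most the depth, since it
      holds a pair whose difference has that value.\<close>
    obtain d where d: "s = closed_cl q d" using clusterE[OF cl q] .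
    have "val_ge v (r - r') d"
      using rr d val_ge_diff_trans[of r q d r'] val_ge_minus_commute unfolding closed_cl_def by blast
    then have "d \<le> depth v s" using rr by (simp add: val_ge_def)
    then show "closed_cl q (depth v s) \<subseteq> s" unfolding d closed_cl_def using val_ge_mono d by blast
  qed
qed

text \<open>Only finitely many values occur, so an open disc meets \<open>R\<close> in the same
  roots as a closed one of slightly larger radius parameter.\<close>

lemma cluster_open_cl:
  assumes r: "r \<in> R" shows "\<exists>d'>d. open_cl r d = closed_cl r d'"
proof -
  \<comment> \<open>\<open>d + 1\<close> keeps the set nonempty when the open disc contains no root
    but \<open>r\<close>; otherwise it can only lower the minimum, which stays above
    \<open>d\<close>.\<close>
  let ?S = "insert (d + 1) ((\<lambda>x. v (x - r)) ` (open_cl r d - {r}))"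
  have fin: "finite ?S" unfolding open_cl_def using finite_R by simp
  define d' where "d' = Min ?S"
  have "d' \<in> ?S" unfolding d'_def using Min_in[OF fin] by blast
  then have "d' > d" unfolding open_cl_def val_gt_def by auto
  moreover have "val_gt v (x - r) d \<longleftrightarrow> val_ge v (x - r) d'" if "x \<in> R" for x
  proof
    assume gt: "val_gt v (x - r) d"
    show "val_ge v (x - r) d'"
    proof (cases "x = r")
      case False
      then have "v (x - r) \<in> ?S" using gt that unfolding open_cl_def by blast
      then show ?thesis unfolding d'_def val_ge_def using Min_le[OF fin] by blast
    qed simp
  next
    assume "val_ge v (x - r) d'"
    then show "val_gt v (x - r) d" using \<open>d' > d\<close> unfolding val_ge_def val_gt_def by auto
  qed
  then have "open_cl r d = closed_cl r d'" unfolding open_cl_def closed_cl_def by blast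
  ultimately show ?thesis by blast
qed

text \<open>A cluster that contains \<open>r\<close> is a disc around \<open>r\<close>: with
  parameter up to the depth it contains \<open>s\<close>, beyond the depth it lies in the open disc.
  The open disc omits a root of \<open>s\<close>, as two roots whose difference has value exactly
  the depth cannot both lie in it.\<close>

lemma child_open_cl:
  assumes s: "proper_cluster v R s" and r: "r \<in> s"
  shows "child v R s (open_cl r (depth v s))"
proof -
  let ?d = "depth v s"
  have cl: "cluster v R s" using s unfolding proper_cluster_def by blast
  have rR: "r \<in> R" using cluster_subset(1)[OF cl] r by blast
  have s_eq: "s = closed_cl r ?d" using depth_props(4)[OF s r] .
  obtain d' where d': "d' > ?d" "open_cl r ?d = closed_cl r d'" using cluster_open_cl[OF rR] by blast
  have 1: "cluster v R (open_cl r ?d)" unfolding d'(2) using cluster_closed_cl[OF rR] .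
  obtain a b where ab: "a \<in> s" "b \<in> s" "a \<noteq> b" "v (a - b) = ?d" using depth_props(2)[OF s] by blast
  have "\<not> (a \<in> open_cl r ?d \<and> b \<in> open_cl r ?d)"
  proof
    assume "a \<in> open_cl r ?d \<and> b \<in> open_cl r ?d"
    then have "val_gt v (a - b) ?d"
      using val_gt_diff_trans[of a r ?d b] val_gt_minus_commute[of b r] unfolding open_cl_def by blast
    then show False using ab by (simp add: val_gt_def)
  qed
  moreover have "open_cl r ?d \<subseteq> closed_cl r ?d" unfolding open_cl_def closed_cl_def using val_gt_imp_ge by blast
  ultimately have 2: "open_cl r ?d \<subset> s" using ab(1,2) equalityD2[OF s_eq] by blast
  have "\<not> (open_cl r ?d \<subset> t \<and> t \<subset> s)" if t: "cluster v R t" for t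
  proof
    assume t2: "open_cl r ?d \<subset> t \<and> t \<subset> s"
    have "r \<in> open_cl r ?d" unfolding open_cl_def using rR by simp
    then have "r \<in> t" using t2 by blast
    then obtain d'' where d'': "t = closed_cl r d''" using clusterE[OF t] by blast
    show False
    proof (cases "d'' \<le> ?d")
      case True
      then have "closed_cl r ?d \<subseteq> t" unfolding d'' closed_cl_def using val_ge_mono by blast
      then have "s \<subseteq> t" by (rule ord_eq_le_trans[OF s_eq])
      then show False using t2 by blast
    next
      case False
      then have "t \<subseteq> open_cl r ?d" unfolding d'' closed_cl_def open_cl_def val_ge_def val_gt_def by auto
      then show False using t2 by blast
    qed
  qed
  then show ?thesis unfolding child_def using 1 2 by blast
qed

text \<open>\<open>c\<close> and the open disc around one of its roots are nested, and both are
  maximal.\<close>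

lemma childE:
  assumes s: "proper_cluster v R s" and c: "child v R s c"
  obtains r where "r \<in> s" "c = open_cl r (depth v s)"
proof -
  have cl: "cluster v R c" "c \<subset> s" and max: "\<And>t. cluster v R t \<Longrightarrow> \<not> (c \<subset> t \<and> t \<subset> s)"
    using c unfolding child_def by blast+
  obtain r where r: "r \<in> c" using cluster_subset(3)[OF cl(1)] by blast
  then have rs: "r \<in> s" and rR: "r \<in> R" using cl cluster_subset(1) by blast+
  let ?c = "open_cl r (depth v s)"
  have ch: "child v R s ?c" using child_open_cl[OF s rs] .
  have "r \<in> ?c" unfolding open_cl_def using rR by simp
  then have "c \<subseteq> ?c \<or> ?c \<subseteq> c" using clusters_nested[OF cl(1) _ r] ch unfolding child_def by blast
  then have "c = ?c" using max ch cl unfolding child_def by blast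
  then show ?thesis using that rs by blast
qed

lemma child_imp_proper: "cluster v R s \<Longrightarrow> child v R s c \<Longrightarrow> proper_cluster v R s"
proof -
  assume s: "cluster v R s" and c: "child v R s c"
  have "c \<subset> s" "c \<noteq> {}" using c cluster_subset(3) unfolding child_def by auto
  then have "0 < card c" "card c < card s"
    using cluster_subset(2)[OF s] by (auto simp: card_gt_0_iff psubset_card_mono finite_subset)
  then show ?thesis using s unfolding proper_cluster_def by simp
qed

subsection \<open>Stabilisers\<close>

abbreviation Stab :: "'a set \<Rightarrow> ('a \<Rightarrow> 'a) set" where "Stab s \<equiv> stabilizer I image s"

lemma Stab_iff: "\<sigma> \<in> Stab s \<longleftrightarrow> \<sigma> \<in> carrier I \<and> \<sigma> ` s = s"
  unfolding stabilizer_def by simp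

lemma image_mult:
  assumes "\<sigma> \<in> carrier I" "\<tau> \<in> carrier I" "s \<subseteq> L"
  shows "(\<sigma> \<otimes>\<^bsub>I\<^esub> \<tau>) ` s = \<sigma> ` \<tau> ` s"
  unfolding image_image using assms by (intro image_cong refl I_mult) auto

lemma image_inv:
  assumes "\<sigma> \<in> carrier I" "s \<subseteq> L" shows "(inv\<^bsub>I\<^esub> \<sigma>) ` \<sigma> ` s = s" "\<sigma> ` (inv\<^bsub>I\<^esub> \<sigma>) ` s = s"
proof -
  have "(\<lambda>x. (inv\<^bsub>I\<^esub> \<sigma>) (\<sigma> x)) ` s = (\<lambda>x. x) ` s" "(\<lambda>x. \<sigma> ((inv\<^bsub>I\<^esub> \<sigma>) x)) ` s = (\<lambda>x. x) ` s"
    using assms by (intro image_cong refl inv_apply; blast)+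
  then show "(inv\<^bsub>I\<^esub> \<sigma>) ` \<sigma> ` s = s" "\<sigma> ` (inv\<^bsub>I\<^esub> \<sigma>) ` s = s" by (simp_all add: image_image)
qed

lemma image_eq_iff:
  assumes "\<sigma> \<in> carrier I" "\<tau> \<in> carrier I" "s \<subseteq> L"
  shows "\<sigma> ` s = \<tau> ` s \<longleftrightarrow> (inv\<^bsub>I\<^esub> \<sigma> \<otimes>\<^bsub>I\<^esub> \<tau>) ` s = s"
proof -
  have t: "\<tau> ` s \<subseteq> L" using assms maps by blast
  have "(inv\<^bsub>I\<^esub> \<sigma> \<otimes>\<^bsub>I\<^esub> \<tau>) ` s = (inv\<^bsub>I\<^esub> \<sigma>) ` \<tau> ` s" using assms by (intro image_mult) auto
  then show ?thesis using image_inv(1)[OF assms(1,3)] image_inv(2)[OF assms(1) t] by metis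
qed

lemma subgroup_Stab:
  assumes "s \<subseteq> L" shows "subgroup (Stab s) I"
proof (rule I.subgroupI)
  show "Stab s \<subseteq> carrier I" by (auto simp: Stab_iff)
  have "\<one>\<^bsub>I\<^esub> ` s = s" using I_one assms by (simp add: subset_iff)
  then show "Stab s \<noteq> {}" using Stab_iff I.one_closed by blast
  fix \<sigma> assume s: "\<sigma> \<in> Stab s"
  then show "inv\<^bsub>I\<^esub> \<sigma> \<in> Stab s" using image_inv(1)[of \<sigma> s] assms unfolding Stab_iff by simp
  fix \<tau> assume t: "\<tau> \<in> Stab s"
  then show "\<sigma> \<otimes>\<^bsub>I\<^esub> \<tau> \<in> Stab s" using s image_mult[of \<sigma> \<tau> s] assms unfolding Stab_iff by simp
qed

lemma carrier_cluster_stab: "carrier (cluster_stab I s) = Stab s"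
  unfolding cluster_stab_def by simp

lemma stab_index_eq:
  assumes "s \<subseteq> L" shows "stab_index I s * card (Stab s) = e" "stab_index I s = e div card (Stab s)"
proof -
  show 1: "stab_index I s * card (Stab s) = e"
    unfolding stab_index_def carrier_cluster_stab using index[OF subgroup_Stab[OF assms]] .
  show "stab_index I s = e div card (Stab s)"
    using card_subgroup_pos[OF subgroup_Stab[OF assms]] unfolding 1[symmetric] by simp
qed

lemma orbit_card:
  assumes s: "s \<subseteq> L" and c: "c \<subseteq> L"
  shows "card (Stab s) = card (orbit (cluster_stab I s) image c) * card {\<sigma> \<in> Stab s. \<sigma> ` c = c}"
proof -
  interpret S: subgroup "Stab s" I using subgroup_Stab[OF s] .
  have "orbit (cluster_stab I s) image c = (\<lambda>\<sigma>. \<sigma> ` c) ` Stab s"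
    unfolding orbit_def carrier_cluster_stab by blast
  moreover have "card (Stab s) = card ((\<lambda>\<sigma>. \<sigma> ` c) ` Stab s) * card {\<sigma> \<in> Stab s. \<sigma> ` c = c}"
  proof (rule I.card_fibres[OF finite_subgroup[OF subgroup_Stab[OF s]] subgroup_Stab[OF s]])
    show "\<sigma> ` c = \<tau> ` c \<longleftrightarrow> inv\<^bsub>I\<^esub> \<sigma> \<otimes>\<^bsub>I\<^esub> \<tau> \<in> {\<sigma> \<in> Stab s. \<sigma> ` c = c}"
      if "\<sigma> \<in> Stab s" "\<tau> \<in> Stab s" for \<sigma> \<tau>
      using that image_eq_iff[OF _ _ c] by simp
  qed blast
  ultimately show ?thesis by simp
qed

lemma fixed_centre:
  assumes s: "proper_cluster v R s"
  shows "\<exists>z\<in>L. (\<forall>\<sigma>\<in>Stab s. \<sigma> z = z) \<and> (\<forall>r\<in>s. val_ge v (r - z) (depth v s))"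
proof -
  have cl: "cluster v R s" using s unfolding proper_cluster_def by blast
  have sL: "s \<subseteq> L" using cluster_subset(1)[OF cl] R_L by blast
  have H: "subgroup (Stab s) I" using subgroup_Stab[OF sL] .
  obtain q where q: "q \<in> s" using cluster_subset(3)[OF cl] by blast
  let ?n = "of_nat (card (Stab s)) :: 'a"
  define T where "T = (\<Sum>\<sigma>\<in>Stab s. \<sigma> q)"
  have T: "T \<in> L" unfolding T_def using q sL maps Stab_iff by (intro sum_in) blast
  note n = tame_subgroup[OF H]
  show ?thesis
  proof (intro bexI[of _ "T / ?n"] conjI ballI)
    show "T / ?n \<in> L" using T by (intro closed)
    show "\<sigma> (T / ?n) = T / ?n" if s: "\<sigma> \<in> Stab s" for \<sigma>
    proof -
      have "\<sigma> \<in> carrier I" using s Stab_iff by blast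
      then interpret \<sigma>: field_endo L \<sigma> using endo by blast
      have "\<sigma> T = T" unfolding T_def using trace_invariant[OF H _ s] q sL by blast
      then show ?thesis using T by (simp add: \<sigma>.divide \<sigma>.of_nat of_nat_in)
    qed
    show "val_ge v (r - T / ?n) (depth v s)" if r: "r \<in> s" for r
    proof -
      \<comment> \<open>\<open>r - T / ?n\<close> is the average of the elements
        \<open>r - \<sigma> q\<close>, and division by the unit \<open>?n\<close> keeps their
        bound.\<close>
      have "val_ge v (\<Sum>\<sigma>\<in>Stab s. r - \<sigma> q) (depth v s)"
        using depth_props(1)[OF s r] q by (intro val_ge_sum) (auto simp: Stab_iff)
      also have "(\<Sum>\<sigma>\<in>Stab s. r - \<sigma> q) = ?n * (r - T / ?n)"
        unfolding T_def using n(1) by (simp add: sum_subtractf algebra_simps)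
      finally show ?thesis using n by (simp add: val_ge_mult_unit)
    qed
  qed
qed

text \<open>Subtracting the fixed centre \<open>z\<close> gives \<sigma> r - r = \<sigma> (r - z) -
  (r - z). If r - z has value exactly the depth, the character decides whether the child around
  \<open>r\<close> moves. Otherwise the child never moves, and not being an orphan is what brings
  the character back in.\<close>

lemma child_stabilizer:
  assumes s: "proper_cluster v R s" and c: "child v R s c" and no: "\<not> orphan v R I s c"
  shows "{\<sigma> \<in> Stab s. \<sigma> ` c = c} = kernel (Stab s) (depth v s)"
proof -
  let ?d = "depth v s" and ?H = "Stab s"
  have cl: "cluster v R s" using s unfolding proper_cluster_def by blast
  have sL: "s \<subseteq> L" and sR: "s \<subseteq> R" using cluster_subset(1)[OF cl] R_L by blast+
  obtain z where z: "z \<in> L" "\<And>\<sigma>. \<sigma> \<in> ?H \<Longrightarrow> \<sigma> z = z" "\<And>r. r \<in> s \<Longrightarrow> val_ge v (r - z) ?d"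
    using fixed_centre[OF s] by blast
  have open_eq: "open_cl a ?d = open_cl b ?d \<longleftrightarrow> val_gt v (a - b) ?d" if "a \<in> s" "b \<in> s" for a b
  proof
    assume eq: "open_cl a ?d = open_cl b ?d"
    have "a \<in> open_cl a ?d" unfolding open_cl_def using that sR by auto
    then show "val_gt v (a - b) ?d" using eq unfolding open_cl_def by blast
  next
    assume ab: "val_gt v (a - b) ?d"
    have "val_gt v (x - a) ?d \<longleftrightarrow> val_gt v (x - b) ?d" for x
      using val_gt_diff_trans[of x a ?d b] val_gt_diff_trans[of x b ?d a] ab val_gt_minus_commute by blast
    then show "open_cl a ?d = open_cl b ?d" unfolding open_cl_def by blast
  qed
  have fix_iff: "\<sigma> ` open_cl r ?d = open_cl r ?d \<longleftrightarrow> val_gt v (\<sigma> r - r) ?d"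
    if "\<sigma> \<in> ?H" "r \<in> s" for \<sigma> r
  proof -
    have "\<sigma> \<in> carrier I" "\<sigma> r \<in> s" using that unfolding Stab_iff by blast+
    then show ?thesis using image_cl(2)[of \<sigma> r ?d] open_eq[of "\<sigma> r" r] that sL by auto
  qed
  have diff_eq: "\<sigma> (r - z) - (r - z) = \<sigma> r - r" if "\<sigma> \<in> ?H" "r \<in> s" for \<sigma> r
  proof -
    interpret \<sigma>: field_endo L \<sigma> using endo that unfolding Stab_iff by blast
    have "r \<in> L" using that sL by blast
    then show ?thesis using z(1) by (simp add: \<sigma>.diff z(2)[OF that(1)])
  qed
  have central: "\<sigma> ` open_cl r ?d = open_cl r ?d" if "\<sigma> \<in> ?H" "r \<in> s" "val_gt v (r - z) ?d" for \<sigma> r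
  proof -
    have "\<sigma> \<in> carrier I" "r - z \<in> L" using that sL z(1) diff_in unfolding Stab_iff by blast+
    then have "val_gt v (\<sigma> (r - z)) ?d" using val_I(2) that(3) by blast
    then have "val_gt v (\<sigma> (r - z) - (r - z)) ?d" using that(3) by (rule val_gt_diff)
    then show ?thesis using fix_iff[OF that(1,2)] diff_eq[OF that(1,2)] by simp
  qed
  have noncentral: "\<sigma> ` open_cl r ?d = open_cl r ?d \<longleftrightarrow> \<theta> \<sigma> ?d \<approx> 1"
    if "\<sigma> \<in> ?H" "r \<in> s" "\<not> val_gt v (r - z) ?d" for \<sigma> r
  proof -
    have "\<sigma> \<in> carrier I" "r - z \<in> L" using that sL z(1) diff_in unfolding Stab_iff by blast+
    moreover have "r - z \<noteq> 0" "v (r - z) = ?d" using that(3) z(3)[OF that(2)] unfolding val_ge_def val_gt_def by auto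
    ultimately show ?thesis using \<theta>_cong_1_iff[of \<sigma> "r - z" ?d] fix_iff[OF that(1,2)] diff_eq[OF that(1,2)] by simp
  qed
  obtain r where r: "r \<in> s" "c = open_cl r ?d" using childE[OF s c] .
  show ?thesis
  proof (cases "val_gt v (r - z) ?d")
    case False
    then show ?thesis unfolding kernel_def r(2) using noncentral[OF _ r(1)] by blast
  next
    case True
    have all: "{\<sigma> \<in> ?H. \<sigma> ` c = c} = ?H" using central[OF _ r(1) True] r(2) by blast
    \<comment> \<open>An element of nontrivial character would move every child away from the centre
      and leave \<open>c\<close> as the only fixed child, that is, as an orphan.\<close>
    have "kernel ?H ?d = ?H"
    proof (rule ccontr)
      assume "kernel ?H ?d \<noteq> ?H"
      then obtain \<tau> where t: "\<tau> \<in> ?H" "\<not> \<theta> \<tau> ?d \<approx> 1" unfolding kernel_def by blast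
      have "{c'. child v R s c' \<and> (\<forall>\<sigma>\<in>?H. \<sigma> ` c' = c')} = {c}"
      proof (intro equalityI subsetI)
        fix c' assume "c' \<in> {c'. child v R s c' \<and> (\<forall>\<sigma>\<in>?H. \<sigma> ` c' = c')}"
        then have c': "child v R s c'" "\<tau> ` c' = c'" using t by blast+
        obtain r' where r': "r' \<in> s" "c' = open_cl r' ?d" using childE[OF s c'(1)] .
        have "val_gt v (r' - z) ?d" using noncentral[OF t(1) r'(1)] t(2) c'(2) r'(2) by blast
        then have "val_gt v (r' - r) ?d"
          using True val_gt_diff_trans[of r' z ?d r] val_gt_minus_commute by blast
        then show "c' \<in> {c}" using open_eq[OF r'(1) r(1)] r' r by simp
      next
        fix c' assume "c' \<in> {c}"
        then show "c' \<in> {c'. child v R s c' \<and> (\<forall>\<sigma>\<in>?H. \<sigma> ` c' = c')}" using c all by blast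
      qed
      then show False using no unfolding orphan_def carrier_cluster_stab by blast
    qed
    then show ?thesis using all by simp
  qed
qed

lemma orbit_length:
  assumes s: "proper_cluster v R s" and c: "child v R s c" and no: "\<not> orphan v R I s c"
  shows "card (orbit (cluster_stab I s) image c) = denom (depth v s * of_nat (stab_index I s))"
proof -
  let ?d = "depth v s"
  have cl: "cluster v R s" using s unfolding proper_cluster_def by blast
  have sL: "s \<subseteq> L" using cluster_subset(1)[OF cl] R_L by blast
  have cL: "c \<subseteq> L" using c sL unfolding child_def by blast
  have H: "subgroup (Stab s) I" using subgroup_Stab[OF sL] .
  have d: "?d \<in> \<Gamma>" using depth_props(3)[OF s] .
  have "card (orbit (cluster_stab I s) image c) * card (kernel (Stab s) ?d)
      = denom (of_nat (e div card (Stab s)) * ?d) * card (kernel (Stab s) ?d)"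
    using orbit_card[OF sL cL] child_stabilizer[OF assms] card_kernel[OF H d] by simp
  then show ?thesis
    using card_subgroup_pos[OF subgroup_kernel[OF H d]] stab_index_eq(2)[OF sL] by (simp add: mult.commute)
qed

text \<open>The smallest cluster around the two roots. The depths thus account for every difference
  of roots, in particular for \<sigma> r - r.\<close>

lemma proper_cluster_of_pair:
  assumes r: "r \<in> R" "r' \<in> R" "r \<noteq> r'"
  shows "\<exists>s. proper_cluster v R s \<and> depth v s = v (r - r')"
proof -
  let ?d = "v (r - r')" let ?s = "closed_cl r ?d"
  have rs: "r \<in> ?s" "r' \<in> ?s" unfolding closed_cl_def using r v_minus_commute[of r r'] by (auto simp: val_ge_def)
  have cl: "cluster v R ?s" using cluster_closed_cl[OF r(1)] .
  have "card {r, r'} \<le> card ?s" using cluster_subset(2)[OF cl] rs by (intro card_mono) auto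
  then have p: "proper_cluster v R ?s" unfolding proper_cluster_def using cl r(3) by simp
  have "depth v ?s \<le> ?d" using depth_props(1)[OF p rs] r(3) by (simp add: val_ge_def)
  moreover have "?d \<le> depth v ?s"
  proof -
    obtain a b where ab: "a \<in> ?s" "b \<in> ?s" "a \<noteq> b" "v (a - b) = depth v ?s" using depth_props(2)[OF p] by blast
    have "val_ge v (a - b) ?d"
      using ab(1,2) val_ge_diff_trans[of a r ?d b] val_ge_minus_commute[of b r] unfolding closed_cl_def by blast
    then show ?thesis using ab by (simp add: val_ge_def)
  qed
  ultimately show ?thesis using p by force
qed

text \<open>\<open>m\<close> divides \<open>e\<close> because \<open>e\<close> clears the
  denominators of all values. Conversely, an element on which \<theta>(1/m) is trivial has trivial
  character at every depth, so it moves no root and is the identity; counting the kernel gives e =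
  denom (1/m), a divisor of \<open>m\<close>.\<close>

lemma lcm_depths: "(LCM s\<in>{s. proper_cluster v R s}. denom (depth v s)) = e"
proof -
  define m where "m = (LCM s\<in>{s. proper_cluster v R s}. denom (depth v s))"
  have m_dvd: "m dvd e"
    unfolding m_def using depth_props(3) e_mult_int by (intro Lcm_least) (auto simp: denom_dvd_iff)
  then obtain k where k: "e = m * k" by blast
  have m0: "m > 0" using k e_pos by (intro Nat.gr0I) auto
  have k0: "k > 0" using k e_pos by (intro Nat.gr0I) auto
  have "1 / of_nat m = of_nat k * (1 / of_nat e :: rat)" unfolding k using m0 k0 by simp
  then have \<Gamma>: "1 / of_nat m \<in> \<Gamma>" using \<Gamma>_nat_mult[OF inverse_e_in_\<Gamma>] by simp
  have "kernel (carrier I) (1 / of_nat m) \<subseteq> {\<one>\<^bsub>I\<^esub>}"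
  proof
    fix \<sigma> assume "\<sigma> \<in> kernel (carrier I) (1 / of_nat m)"
    then have s: "\<sigma> \<in> carrier I" "\<theta> \<sigma> (1 / of_nat m) \<approx> 1" unfolding kernel_def by auto
    have "\<sigma> r = r" if r: "r \<in> R" for r
    proof (rule ccontr)
      assume ne: "\<sigma> r \<noteq> r"
      have "\<sigma> r \<in> R" using I_R[OF s(1)] r by blast
      then obtain t where t: "proper_cluster v R t" "depth v t = v (\<sigma> r - r)"
        using proper_cluster_of_pair[of "\<sigma> r" r] r ne by blast
      have "denom (depth v t) dvd m" unfolding m_def using t(1) by (intro dvd_Lcm) blast
      then obtain z where z: "of_nat m * depth v t = of_int z"
        unfolding denom_dvd_iff by (auto elim: Ints_cases)
      then have "v (\<sigma> r - r) = of_int z * (1 / of_nat m)" using m0 t(2) by (simp add: field_simps)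
      then have "\<theta> \<sigma> (v (\<sigma> r - r)) \<approx> 1" using \<theta>_int_mult_trivial[OF s(1) \<Gamma> s(2)] by simp
      then show False using \<theta>_displacement[OF s(1) _ ne] r R_L by blast
    qed
    then show "\<sigma> \<in> {\<one>\<^bsub>I\<^esub>}" using faithful[OF s(1)] by blast
  qed
  then have "kernel (carrier I) (1 / of_nat m) = {\<one>\<^bsub>I\<^esub>}"
    using subgroup.one_closed[OF subgroup_kernel[OF I.subgroup_self \<Gamma>]] by blast
  then have "e = denom (1 / of_nat m)" using card_kernel[OF I.subgroup_self \<Gamma>] e_pos by simp
  moreover have "denom (1 / of_nat m) dvd m" unfolding denom_dvd_iff using m0 by simp
  ultimately show ?thesis using m_dvd dvd_antisym unfolding m_def by metis
qed

lemma cluster_R: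
  assumes "R \<noteq> {}" shows "cluster v R R"
proof -
  obtain r where r: "r \<in> R" using assms by blast
  \<comment> \<open>The term x = r contributes the unspecified \<open>v 0\<close>, which like the
    inserted 0 can only lower the minimum.\<close>
  let ?d = "Min (insert 0 ((\<lambda>x. v (x - r)) ` R))"
  have "R = closed_cl r ?d" unfolding closed_cl_def val_ge_def using finite_R by auto
  then show ?thesis using cluster_closed_cl[OF r, of ?d] by simp
qed

text \<open>\<open>s\<close> is a child of the smallest cluster \<open>P\<close> above it. If
  \<open>s\<close> is an orphan, both have the same stabiliser; otherwise the index of
  \<open>P\<close> is multiplied by the length of an orbit of children, which turns it into its lcm
  with the denominator of the depth of \<open>P\<close>.\<close>

lemma stab_index_formula:
  assumes "cluster v R s"
  shows "stab_index I s = (LCM s'\<in>{s'. cluster v R s' \<and> s \<subset> s'}. denom (depth_star v R I s s'))"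
  using assms
proof (induction "card R - card s" arbitrary: s rule: less_induct)
  case less
  note s = less.prems
  have sR: "s \<subseteq> R" and sL: "s \<subseteq> L" using cluster_subset(1)[OF s] R_L by blast+
  show ?case
  proof (cases "s = R")
    case True
    then have none: "{s'. cluster v R s' \<and> s \<subset> s'} = {}" using cluster_subset(1) by blast
    have "Stab s = carrier I" using I_R True by (auto simp: Stab_iff)
    then have "stab_index I s = 1" using stab_index_eq(2)[OF sL] e_pos by simp
    then show ?thesis unfolding none by simp
  next
    case False
    let ?C = "\<lambda>s. {t. cluster v R t \<and> s \<subset> t}"
    have "R \<in> ?C s" using sR False cluster_subset(3)[OF s] cluster_R by blast
    then obtain P where P: "P \<in> ?C s" and P_min: "\<And>t. t \<in> ?C s \<Longrightarrow> card P \<le> card t"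
      using ex_has_least_nat[of "\<lambda>t. t \<in> ?C s" R card] by blast
    have Pcl: "cluster v R P" and sP: "s \<subset> P" using P by auto
    have PL: "P \<subseteq> L" using cluster_subset(1)[OF Pcl] R_L by blast
    have child: "child v R P s"
      unfolding child_def using s sP P_min psubset_card_mono[OF cluster_subset(2)[OF Pcl]]
      by (metis (no_types, lifting) mem_Collect_eq not_le)
    have Pprop: "proper_cluster v R P" using child_imp_proper[OF Pcl child] .
    obtain r where r: "r \<in> s" using cluster_subset(3)[OF s] by blast
    have rP: "r \<in> P" using r sP by blast
    \<comment> \<open>Clusters above \<open>s\<close> meet \<open>P\<close> in \<open>r\<close>, so
      they are nested with \<open>P\<close>, and by minimality none lies strictly inside
      \<open>P\<close>.\<close>
    have C_eq: "?C s = insert P (?C P)"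
    proof (intro equalityI subsetI)
      fix t assume t: "t \<in> ?C s"
      then have "r \<in> t" using r by blast
      then have "t \<subseteq> P \<or> P \<subseteq> t" using clusters_nested[OF _ Pcl] t rP by blast
      moreover have "\<not> t \<subset> P"
        using P_min[OF t] psubset_card_mono[OF cluster_subset(2)[OF Pcl], of t] by linarith
      ultimately show "t \<in> insert P (?C P)" using t by blast
    next
      fix t assume "t \<in> insert P (?C P)"
      then show "t \<in> ?C s" using P sP by blast
    qed
    \<comment> \<open>The starred depth only sees the child of \<open>t\<close> that contains
      \<open>s\<close>, and this child contains \<open>P\<close> as well.\<close>
    have star: "depth_star v R I s t = depth_star v R I P t" if t: "t \<in> ?C P" for t
    proof -
      have "s \<subseteq> c \<longleftrightarrow> P \<subseteq> c" if c: "child v R t c" for c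
      proof
        assume "s \<subseteq> c"
        then have "r \<in> c" using r by blast
        then have "P \<subseteq> c \<or> c \<subseteq> P" using clusters_nested[OF Pcl _ rP] c unfolding child_def by blast
        moreover have "\<not> c \<subset> P" using c t Pcl unfolding child_def by blast
        ultimately show "P \<subseteq> c" by blast
      qed (use sP in blast)
      then have "(\<exists>c. child v R t c \<and> s \<subseteq> c \<and> orphan v R I t c) \<longleftrightarrow>
          (\<exists>c. child v R t c \<and> P \<subseteq> c \<and> orphan v R I t c)" by blast
      then show ?thesis unfolding depth_star_def by simp
    qed
    have "c = s" if "child v R P c" "s \<subseteq> c" for c
      using that child unfolding child_def by blast
    then have star_P: "depth_star v R I s P = (if orphan v R I P s then 1 else depth v P)"
      unfolding depth_star_def using child by (metis order_refl)
    have fin: "finite (?C P)"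
      by (rule finite_subset[of _ "Pow R"]) (use cluster_subset(1) finite_R in auto)
    have "card s < card P" using psubset_card_mono[OF cluster_subset(2)[OF Pcl] sP] .
    moreover have "card P \<le> card R" using card_mono[OF finite_R cluster_subset(1)[OF Pcl]] .
    ultimately have "card R - card P < card R - card s" by simp
    from less.hyps[OF this Pcl]
    have IH: "stab_index I P = (LCM t\<in>?C P. denom (depth_star v R I P t))" .
    have "(LCM t\<in>?C s. denom (depth_star v R I s t))
        = lcm (denom (depth_star v R I s P)) (LCM t\<in>?C P. denom (depth_star v R I s t))"
      unfolding C_eq by simp
    also have "(LCM t\<in>?C P. denom (depth_star v R I s t)) = stab_index I P"
      unfolding IH using star by (intro arg_cong[where f = Lcm] image_cong) auto
    finally have rhs: "(LCM t\<in>?C s. denom (depth_star v R I s t))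
        = lcm (denom (depth_star v R I s P)) (stab_index I P)" .
    have sub: "Stab s = {\<sigma> \<in> Stab P. \<sigma> ` s = s}"
    proof -
      \<comment> \<open>The image of \<open>P\<close> meets \<open>P\<close> in \<open>r\<close>;
        the two are nested and of equal cardinality, hence equal.\<close>
      have im_P: "\<sigma> ` P = P" if \<sigma>: "\<sigma> \<in> Stab s" for \<sigma>
      proof -
        have I: "\<sigma> \<in> carrier I" and im: "\<sigma> ` s = s" using \<sigma> unfolding Stab_iff by auto
        have "r \<in> \<sigma> ` P" using r im sP by blast
        then have nest: "\<sigma> ` P \<subseteq> P \<or> P \<subseteq> \<sigma> ` P" using clusters_nested[OF cluster_image[OF I Pcl] Pcl] rP by blast
        have "inj_on \<sigma> P" using inv_apply(1)[OF I] PL by (metis inj_on_def subsetD)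
        then have "card (\<sigma> ` P) = card P" by (rule card_image)
        then show ?thesis using nest card_subset_eq cluster_subset(2)[OF Pcl] finite_imageI by metis
      qed
      show ?thesis
      proof (intro equalityI subsetI)
        show "\<sigma> \<in> {\<sigma> \<in> Stab P. \<sigma> ` s = s}" if "\<sigma> \<in> Stab s" for \<sigma>
          using im_P[OF that] that unfolding mem_Collect_eq Stab_iff by simp
        show "\<sigma> \<in> Stab s" if "\<sigma> \<in> {\<sigma> \<in> Stab P. \<sigma> ` s = s}" for \<sigma>
          using that unfolding mem_Collect_eq Stab_iff by simp
      qed
    qed
    have Ppos: "card (Stab s) > 0" "stab_index I P > 0"
      using card_subgroup_pos[OF subgroup_Stab[OF sL]] stab_index_eq(1)[OF PL] e_pos by (auto intro: Nat.gr0I)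
    show ?thesis
    proof (cases "orphan v R I P s")
      case True
      then have "\<forall>\<sigma>\<in>Stab P. \<sigma> ` s = s" unfolding orphan_def carrier_cluster_stab by blast
      then have "{\<sigma> \<in> Stab P. \<sigma> ` s = s} = Stab P" by blast
      then have "Stab s = Stab P" by (rule trans[OF sub])
      then have "stab_index I s = stab_index I P" using stab_index_eq(2) sL PL by simp
      then show ?thesis unfolding rhs star_P using True by simp
    next
      case False
      let ?b = "denom (of_nat (stab_index I P) * depth v P)"
      have "Stab s = kernel (Stab P) (depth v P)" 
        by (rule trans[OF sub child_stabilizer[OF Pprop child False]])
      then have "card (Stab P) = ?b * card (Stab s)"
        using card_kernel[OF subgroup_Stab[OF PL] depth_props(3)[OF Pprop]] stab_index_eq(2)[OF PL] by simp
      then have "stab_index I s * card (Stab s) = (stab_index I P * ?b) * card (Stab s)"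
        using stab_index_eq(1)[OF PL] stab_index_eq(1)[OF sL] by simp
      then have "stab_index I s = stab_index I P * ?b" using Ppos(1) by simp
      also have "\<dots> = lcm (denom (depth v P)) (stab_index I P)" using mult_denom_eq_lcm[OF Ppos(2)] .
      finally show ?thesis unfolding rhs star_P using False by simp
    qed
  qed
qed

end

lemma (in local_field) tame_clusters:
  assumes tame: "\<not> p dvd card (carrier I)"
  shows "tame_clusters v L I (ac_roots f)"
proof -
  have I_G: "\<sigma> \<in> carrier G" if "\<sigma> \<in> carrier I" for \<sigma> using that carrier_I by blast
  have card0: "card (carrier I) \<noteq> 0" using tame by (intro notI) simp
  have ext: "\<sigma> = \<tau>" if "\<sigma> \<in> carrier I" "\<tau> \<in> carrier I" "\<And>x. x \<in> L \<Longrightarrow> \<sigma> x = \<tau> x" for \<sigma> \<tau>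
  proof (rule extensionalityI[of _ L])
    show "\<sigma> \<in> extensional L" "\<tau> \<in> extensional L"
      using that(1,2)[THEN I_G] unfolding G_def galois_group_carrier Bij_def by auto
  qed (rule that(3))
  interpret I: group I by (rule group_I)
  show ?thesis
  proof (intro tame_clusters.intro tame_inertia.intro tame_inertia_axioms.intro
      tame_clusters_axioms.intro)
    show "valued_field v" "field_set L" "group I"
      by (rule valued_field_axioms L.field_set_axioms group_I)+
    show "finite (carrier I)" using finite_G carrier_I by simp
    show "(\<sigma> \<otimes>\<^bsub>I\<^esub> \<tau>) x = \<sigma> (\<tau> x)" if "\<sigma> \<in> carrier I" "\<tau> \<in> carrier I" "x \<in> L" for \<sigma> \<tau> x
      using G_mult that I_G I_simps(1) by simp
    show "\<one>\<^bsub>I\<^esub> x = x" if "x \<in> L" for x using G_one that I_simps(2) by simp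
    show "\<sigma> = \<tau>" if "\<sigma> \<in> carrier I" "\<tau> \<in> carrier I" "\<And>x. x \<in> L \<Longrightarrow> \<sigma> x = \<tau> x" for \<sigma> \<tau>
      using that by (rule ext)
    show "infinitesimal (\<sigma> x - x)" if "\<sigma> \<in> carrier I" "x \<in> L" "integral x" for \<sigma> x
      using that carrier_I by blast
    show "v (\<sigma> x) = v x" if "\<sigma> \<in> carrier I" "x \<in> L" "x \<noteq> 0" for \<sigma> x
      using v_galois I_G that by blast
    show "\<exists>x\<in>L. x \<noteq> 0 \<and> v x = of_int k \<and> (\<forall>\<sigma>\<in>carrier I. \<sigma> x = x)" for k
      using v_K_surj[of k] K_L G_fixes I_G by blast
    show "of_nat (card (carrier I)) \<noteq> (0 :: 'k alg_closure)" using card0 by simp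
    show "v (of_nat (card (carrier I))) = 0" using v_of_nat_prime_to_p[OF tame] .
    show "v x \<in> \<int>" if "x \<in> L" "x \<noteq> 0" "\<And>\<sigma>. \<sigma> \<in> carrier I \<Longrightarrow> \<sigma> x = x" for x
      using tame that by (rule inertia_fixed_field_unramified)
    show "finite (ac_roots f)" using f0 by (rule finite_ac_roots)
    show "ac_roots f \<subseteq> L" unfolding L_def by (rule roots_in_root_field)
    show "\<sigma> ` ac_roots f = ac_roots f" if "\<sigma> \<in> carrier I" for \<sigma>
      using galois_roots[OF f0] I_G[OF that] unfolding G_def K_def L_def by blast
    show "field_endo L \<sigma>" if "\<sigma> \<in> carrier I" for \<sigma> using endo[OF I_G[OF that]] .
    show "\<sigma> = \<one>\<^bsub>I\<^esub>" if s: "\<sigma> \<in> carrier I" and fix_R: "\<And>r. r \<in> ac_roots f \<Longrightarrow> \<sigma> r = r" for \<sigma>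
    proof (rule ext[OF s I.one_closed])
      interpret \<sigma>: field_endo L \<sigma> using endo[OF I_G[OF s]] .
      \<comment> \<open>The elements of \<open>L\<close> fixed by \<sigma> form a field that
        contains K and the roots, and these generate \<open>L\<close>.\<close>
      have "root_field f \<subseteq> {x \<in> L. \<sigma> x = x}"
      proof (rule root_field_least)
        show "field_set {x \<in> L. \<sigma> x = x}"
          by unfold_locales
            (auto simp: L.closed \<sigma>.add \<sigma>.mult \<sigma>.uminus \<sigma>.inverse \<sigma>.zero \<sigma>.one)
        show "range to_ac \<subseteq> {x \<in> L. \<sigma> x = x}" using G_fixes[OF I_G[OF s]] K_L unfolding K_def by blast
        show "ac_roots f \<subseteq> {x \<in> L. \<sigma> x = x}" using fix_R roots_in_root_field unfolding L_def by blast
      qed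
      then show "\<sigma> x = \<one>\<^bsub>I\<^esub> x" if "x \<in> L" for x
        using that G_one I_simps(2) unfolding L_def by auto
    qed
  qed
qed

theorem theorem1p3:
  fixes p :: nat
    and w :: "'q::field_char_0 \<Rightarrow> rat"
    and \<iota> :: "'q \<Rightarrow> 'k::field_char_0"
    and v :: "'k alg_closure \<Rightarrow> rat"
    and f :: "'k poly"
    and R :: "'k alg_closure set"
    and I :: "('k alg_closure \<Rightarrow> 'k alg_closure) monoid"
  assumes "prime p" and "odd p"
    and "is_Qp p w"
    and "finite_field_extension \<iota>"
    and "normalised_valuation w \<iota> v"
    and "squarefree f"
    and R: "R = ac_roots f"
    and I: "I = inertia_group v (range to_ac) (root_field f)"
    and tame: "\<not> p dvd card (carrier I)"
  shows
    "(LCM s\<in>{s. proper_cluster v R s}. denom (depth v s)) = card (carrier I) \<and>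
     (\<forall>s. cluster v R s \<longrightarrow>
        (\<forall>c c'. child v R s c \<and> \<not> orphan v R I s c \<and> child v R s c' \<and> \<not> orphan v R I s c' \<longrightarrow>
           card (orbit (cluster_stab I s) image c) = card (orbit (cluster_stab I s) image c'))) \<and>
     (\<forall>s s'. proper_cluster v R s \<and> child v R s s' \<and> \<not> orphan v R I s s' \<longrightarrow>
        card (orbit (cluster_stab I s) image s') = denom (depth v s * of_nat (stab_index I s))) \<and>
     (\<forall>s. cluster v R s \<longrightarrow>
        stab_index I s = (LCM s'\<in>{s'. cluster v R s' \<and> s \<subset> s'}. denom (depth_star v R I s s')))"
proof -
  \<comment> \<open>0 is not squarefree, because the square of the nonunit 0 divides it.\<close>
  have "f \<noteq> 0"
    using \<open>squarefree f\<close> unfolding squarefree_def by (metis dvd_0_left_iff dvd_0_right zero_neq_one)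
  interpret F: local_field p w \<iota> v f
    using assms(1,3-5) \<open>f \<noteq> 0\<close> by unfold_locales
  have I_eq: "I = F.I" unfolding I F.I_def F.K_def F.L_def ..
  interpret C: tame_clusters v F.L I R
    unfolding R I_eq using tame I_eq by (intro F.tame_clusters) simp
  show ?thesis
  proof (intro conjI allI impI)
    \<comment> \<open>A cluster that has a child is proper, so one formula, independent of the
      child, gives both lengths.\<close>
    show "card (orbit (cluster_stab I s) image c) = card (orbit (cluster_stab I s) image c')"
      if "cluster v R s" "child v R s c \<and> \<not> orphan v R I s c \<and> child v R s c' \<and> \<not> orphan v R I s c'"
      for s c c'
      using that C.child_imp_proper[of s c] C.orbit_length[of s c] C.orbit_length[of s c'] by simp
  qed (use C.lcm_depths C.orbit_length C.stab_index_formula in simp_all)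
qed

end
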